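(* Let $f\colon\mathbb R^n\times\mathbb R^l\times\mathbb R^m\to\mathbb R^n$, let $\varphi_i\colon\mathbb R^n\times\mathbb R^l\to\mathbb R$, $i=1,\dots,s$, and put $$C(p):=\{x\in\mathbb R^n\mid\varphi_i(x,p)\le0,\ i=1,\dots,s\},\qquad\breve S(v,p,q):=\{x\in\mathbb R^n\mid v\in f(x,p,q)+N_{C(p)}(x)\}.$$ Let $(\bar x,\bar v,\bar p,\bar q)\in\mathbb R^n\times\mathbb R^n\times\mathbb R^l\times\mathbb R^m$ satisfy $\bar x\in\breve S(\bar v,\bar p,\bar q)$, let the $\varphi_i$ be $\mathcal C^2$-smooth around $(\bar x,\bar p)$, and let $f$ satisfy (A1) and (A4) (see context). Then the following assertions hold: (i) If both the partial MFCQ and the partial CRCQ with respect to $x$ are fulfilled at $(\bar x,\bar p)$, then the validity of the general strong second-order sufficient condition (GSSOSC) at $(\bar x,\bar p,\bar q,\bar v)$ ensures that $\bar x$ is a (Lipschitzian) fully stable solution of $v\in f(x,p,q)+N_{C(p)}(x)$ corresponding to $(\bar v,\bar p,\bar q)$. (ii) If the partial LICQ holds at $(\bar x,\bar p)$, then GSSOSC at $(\bar x,\bar p,\bar q,\bar v)$ is necessary and sufficient for $\bar x$ to be a (Lipschitzian) fully stable solution corresponding to $(\bar v,\bar p,\bar q)$.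
   Context: All spaces are Euclidean. $N_\Omega(x)$ is the limiting normal cone: the set of limits of $v_k\in\hat N_\Omega(x_k)$ with $\Omega\ni x_k\to x$, where $\hat N_\Omega(x)=\{v\mid\limsup_{u\to x,u\in\Omega}\frac{\langle v,u-x\rangle}{\|u-x\|}\le0\}$; $N_\Omega(x)=\emptyset$ if $x\notin\Omega$. Assumptions. (A1) $f$ is Lipschitz continuous on a neighborhood of $(\bar x,\bar p,\bar q)$. (A4) $f$ is differentiable with respect to $x$ around $(\bar x,\bar p,\bar q)$ uniformly in $(p,q)$ (i.e. there is a neighborhood $U\times P\times Q$ such that for each $x\in U$ the derivative of $f(\cdot,p,q)$ at $x$ exists for all $(p,q)\in P\times Q$ with remainder $o(\|h\|)$ uniform in $(p,q)$), and $\nabla_xf$ is continuous at $(\bar x,\bar p,\bar q)$. Constraint qualifications. $I(x,p):=\{i\mid\varphi_i(x,p)=0\}$. Partial MFCQ at $(\bar x,\bar p)$: there is $d\in\mathbb R^n$ with $\langle\nabla_x\varphi_i(\bar x,\bar p),d\rangle<0$ for all $i\in I(\bar x,\bar p)$. Partial CRCQ at $(\bar x,\bar p)$: there is a neighborhood $W$ of $(\bar x,\bar p)$ such that for any $J\subset I(\bar x,\bar p)$ the family $\{\nabla_x\varphi_i(x,p)\mid i\in J\}$ has the same rank for all $(x,p)\in W$. Partial LICQ at $(\bar x,\bar p)$: the gradients $\nabla_x\varphi_i(\bar x,\bar p)$, $i\in I(\bar x,\bar p)$, are linearly independent. Lagrangian. $L(x,p,q,\lambda):=f(x,p,q)+\sum_{i=1}^s\lambda_i\nabla_x\varphi_i(x,p)$,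 $\lambda\in\mathbb R^s$; $\varphi=(\varphi_1,\dots,\varphi_s)$; $\Lambda(x,p,q,v):=\{\lambda\in\mathbb R^s_+\mid v=L(x,p,q,\lambda),\ \langle\lambda,\varphi(x,p)\rangle=0\}$; $I_+(x,p,\lambda):=\{i\in I(x,p)\mid\lambda_i>0\}$. GSSOSC at $(\bar x,\bar p,\bar q,\bar v)$: for all $\lambda\in\Lambda(\bar x,\bar p,\bar q,\bar v)$ one has $\langle u,\nabla_xL(\bar x,\bar p,\bar q,\lambda)u\rangle>0$ whenever $u\ne0$ and $\langle\nabla_x\varphi_i(\bar x,\bar p),u\rangle=0$ for all $i\in I_+(\bar x,\bar p,\lambda)$. Full stability. $\bar x$ is a (Lipschitzian) fully stable solution corresponding to $(\bar v,\bar p,\bar q)$ if there are a neighborhood $V\times P\times Q\times U$ of $(\bar v,\bar p,\bar q,\bar x)$ and a single-valued mapping $\vartheta\colon V\times P\times Q\to U$, defined on all of $V\times P\times Q$, with $\operatorname{gph}\vartheta=\operatorname{gph}\breve S\cap(V\times P\times Q\times U)$, together with $\kappa,\ell>0$ such that for all $(v_i,p_i,q_i)\in V\times P\times Q$, $i=1,2$, $$\|(v_1-v_2)-2\kappa[\vartheta(v_1,p_1,q_1)-\vartheta(v_2,p_2,q_2)]\|\le\|v_1-v_2\|+\ell[\|p_1-p_2\|+\|q_1-q_2\|].$$ *)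

theory Defs
  imports "HOL-Analysis.Analysis"
begin

text \<open>
  A neighbourhood of a point \<open>z\<close> is rendered as a set \<open>W\<close> with \<open>z \<in> interior W\<close>.
  Parametric data are functions of tuples: \<open>f (x, p, q)\<close> and \<open>\<phi> i (x, p)\<close>.
\<close>

section \<open>Normal cones\<close>

text \<open>At an isolated point of \<open>\<Omega>\<close> the filter is trivial, the upper limit is \<open>-\<infinity>\<close>, and the
  cone is the whole space, which is the usual convention.\<close>

definition regular_normal_cone :: "'a::euclidean_space set \<Rightarrow> 'a \<Rightarrow> 'a set" where
  "regular_normal_cone \<Omega> x =
     (if x \<in> \<Omega>
      then {v. Limsup (at x within \<Omega>) (\<lambda>u. ereal (inner v (u - x) / norm (u - x))) \<le> 0}
      else {})"

definition limiting_normal_cone :: "'a::euclidean_space set \<Rightarrow> 'a \<Rightarrow> 'a set" where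
  "limiting_normal_cone \<Omega> x =
     (if x \<in> \<Omega>
      then {v. \<exists>xs vs. (\<forall>k::nat. xs k \<in> \<Omega> \<and> vs k \<in> regular_normal_cone \<Omega> (xs k))
                 \<and> xs \<longlonglongrightarrow> x \<and> vs \<longlonglongrightarrow> v}
      else {})"

section \<open>Smoothness\<close>

definition C2_around :: "('a::euclidean_space \<Rightarrow> real) \<Rightarrow> 'a \<Rightarrow> bool" where
  "C2_around g z \<longleftrightarrow>
     (\<exists>W (g' :: 'a \<Rightarrow> 'a \<Rightarrow>\<^sub>L real) (g'' :: 'a \<Rightarrow> 'a \<Rightarrow>\<^sub>L ('a \<Rightarrow>\<^sub>L real)).
        open W \<and> z \<in> W \<and>
        (\<forall>y\<in>W. (g has_derivative blinfun_apply (g' y)) (at y)) \<and>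
        (\<forall>y\<in>W. (g' has_derivative blinfun_apply (g'' y)) (at y)) \<and>
        continuous_on W g'')"

text \<open>Partial gradient and partial Jacobian in the first argument; they carry meaning only where
  the partial derivative exists.\<close>

definition grad_x :: "('a::real_inner \<times> 'b \<Rightarrow> real) \<Rightarrow> 'a \<times> 'b \<Rightarrow> 'a" where
  "grad_x g = (\<lambda>(x, p). THE D. GDERIV (\<lambda>y. g (y, p)) x :> D)"

definition jac_x :: "((real^'n) \<times> 'b \<Rightarrow> real^'n) \<Rightarrow> (real^'n) \<times> 'b \<Rightarrow> real^'n^'n" where
  "jac_x F = (\<lambda>(x, w). jacobian (\<lambda>y. F (y, w)) (at x))"

definition lipschitz_around :: "('a::metric_space \<Rightarrow> 'b::metric_space) \<Rightarrow> 'a \<Rightarrow> bool" where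
  "lipschitz_around g z \<longleftrightarrow> (\<exists>W K. z \<in> interior W \<and> K-lipschitz_on W g)"

definition uniformly_differentiable_x ::
  "((real^'n) \<times> (real^'l) \<times> (real^'m) \<Rightarrow> real^'n) \<Rightarrow> real^'n \<Rightarrow> real^'l \<Rightarrow> real^'m \<Rightarrow> bool" where
  "uniformly_differentiable_x f xb pb qb \<longleftrightarrow>
     (\<exists>U P Q. xb \<in> interior U \<and> pb \<in> interior P \<and> qb \<in> interior Q \<and>
        (\<forall>x\<in>U.
           (\<forall>p\<in>P. \<forall>q\<in>Q. (\<lambda>y. f (y, p, q)) differentiable (at x)) \<and>
           (\<forall>\<epsilon>>0. \<exists>\<delta>>0. \<forall>p\<in>P. \<forall>q\<in>Q. \<forall>h. norm h < \<delta> \<longrightarrow>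
              norm (f (x + h, p, q) - f (x, p, q) - jac_x f (x, p, q) *v h) \<le> \<epsilon> * norm h)))"

section \<open>The constraint system\<close>

definition feasible_set ::
  "('s::finite \<Rightarrow> (real^'n) \<times> (real^'l) \<Rightarrow> real) \<Rightarrow> real^'l \<Rightarrow> (real^'n) set" where
  "feasible_set \<phi> p = {x. \<forall>i. \<phi> i (x, p) \<le> 0}"

definition solution_map ::
  "((real^'n) \<times> (real^'l) \<times> (real^'m) \<Rightarrow> real^'n) \<Rightarrow> ('s::finite \<Rightarrow> (real^'n) \<times> (real^'l) \<Rightarrow> real)
     \<Rightarrow> real^'n \<Rightarrow> real^'l \<Rightarrow> real^'m \<Rightarrow> (real^'n) set" where
  "solution_map f \<phi> v p q =
     {x. v \<in> (\<lambda>w. f (x, p, q) + w) ` limiting_normal_cone (feasible_set \<phi> p) x}"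

definition active_set ::
  "('s::finite \<Rightarrow> (real^'n) \<times> (real^'l) \<Rightarrow> real) \<Rightarrow> real^'n \<Rightarrow> real^'l \<Rightarrow> 's set" where
  "active_set \<phi> x p = {i. \<phi> i (x, p) = 0}"

definition partial_MFCQ ::
  "('s::finite \<Rightarrow> (real^'n) \<times> (real^'l) \<Rightarrow> real) \<Rightarrow> real^'n \<Rightarrow> real^'l \<Rightarrow> bool" where
  "partial_MFCQ \<phi> xb pb \<longleftrightarrow>
     (\<exists>d. \<forall>i\<in>active_set \<phi> xb pb. inner (grad_x (\<phi> i) (xb, pb)) d < 0)"

definition partial_CRCQ ::
  "('s::finite \<Rightarrow> (real^'n) \<times> (real^'l) \<Rightarrow> real) \<Rightarrow> real^'n \<Rightarrow> real^'l \<Rightarrow> bool" where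
  "partial_CRCQ \<phi> xb pb \<longleftrightarrow>
     (\<exists>W. (xb, pb) \<in> interior W \<and>
        (\<forall>J\<subseteq>active_set \<phi> xb pb. \<exists>r. \<forall>z\<in>W. dim ((\<lambda>i. grad_x (\<phi> i) z) ` J) = r))"

text \<open>Independence is that of the indexed family, so coinciding gradients are excluded by
  injectivity.\<close>

definition partial_LICQ ::
  "('s::finite \<Rightarrow> (real^'n) \<times> (real^'l) \<Rightarrow> real) \<Rightarrow> real^'n \<Rightarrow> real^'l \<Rightarrow> bool" where
  "partial_LICQ \<phi> xb pb \<longleftrightarrow>
     inj_on (\<lambda>i. grad_x (\<phi> i) (xb, pb)) (active_set \<phi> xb pb) \<and>
     independent ((\<lambda>i. grad_x (\<phi> i) (xb, pb)) ` active_set \<phi> xb pb)"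

section \<open>Lagrangian and second-order condition\<close>

definition lagrangian ::
  "((real^'n) \<times> (real^'l) \<times> (real^'m) \<Rightarrow> real^'n) \<Rightarrow> ('s::finite \<Rightarrow> (real^'n) \<times> (real^'l) \<Rightarrow> real)
     \<Rightarrow> real^'s \<Rightarrow> (real^'n) \<times> (real^'l) \<times> (real^'m) \<Rightarrow> real^'n" where
  "lagrangian f \<phi> lam = (\<lambda>(x, p, q). f (x, p, q) + (\<Sum>i\<in>UNIV. (lam $ i) *\<^sub>R grad_x (\<phi> i) (x, p)))"

definition multipliers ::
  "((real^'n) \<times> (real^'l) \<times> (real^'m) \<Rightarrow> real^'n) \<Rightarrow> ('s::finite \<Rightarrow> (real^'n) \<times> (real^'l) \<Rightarrow> real)
     \<Rightarrow> real^'n \<Rightarrow> real^'l \<Rightarrow> real^'m \<Rightarrow> real^'n \<Rightarrow> (real^'s) set" where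
  "multipliers f \<phi> x p q v =
     {lam. (\<forall>i. 0 \<le> lam $ i) \<and> v = lagrangian f \<phi> lam (x, p, q) \<and> inner lam (\<chi> i. \<phi> i (x, p)) = 0}"

definition strongly_active_set ::
  "('s::finite \<Rightarrow> (real^'n) \<times> (real^'l) \<Rightarrow> real) \<Rightarrow> real^'n \<Rightarrow> real^'l \<Rightarrow> real^'s \<Rightarrow> 's set" where
  "strongly_active_set \<phi> x p lam = {i \<in> active_set \<phi> x p. lam $ i > 0}"

definition GSSOSC ::
  "((real^'n) \<times> (real^'l) \<times> (real^'m) \<Rightarrow> real^'n) \<Rightarrow> ('s::finite \<Rightarrow> (real^'n) \<times> (real^'l) \<Rightarrow> real)
     \<Rightarrow> real^'n \<Rightarrow> real^'l \<Rightarrow> real^'m \<Rightarrow> real^'n \<Rightarrow> bool" where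
  "GSSOSC f \<phi> xb pb qb vb \<longleftrightarrow>
     (\<forall>lam\<in>multipliers f \<phi> xb pb qb vb. \<forall>u.
        u \<noteq> 0 \<and> (\<forall>i\<in>strongly_active_set \<phi> xb pb lam. inner (grad_x (\<phi> i) (xb, pb)) u = 0)
        \<longrightarrow> inner u (jac_x (lagrangian f \<phi> lam) (xb, pb, qb) *v u) > 0)"

section \<open>Full stability\<close>

definition fully_stable ::
  "(real^'n \<Rightarrow> real^'l \<Rightarrow> real^'m \<Rightarrow> (real^'n) set)
     \<Rightarrow> real^'n \<Rightarrow> real^'n \<Rightarrow> real^'l \<Rightarrow> real^'m \<Rightarrow> bool" where
  "fully_stable S xb vb pb qb \<longleftrightarrow>
     (\<exists>V P Q U \<theta>.
        vb \<in> interior V \<and> pb \<in> interior P \<and> qb \<in> interior Q \<and> xb \<in> interior U \<and>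
        (\<forall>v\<in>V. \<forall>p\<in>P. \<forall>q\<in>Q. \<theta> v p q \<in> U) \<and>
        {(v, p, q, \<theta> v p q) |v p q. v \<in> V \<and> p \<in> P \<and> q \<in> Q}
          = {(v, p, q, x) |v p q x. x \<in> S v p q} \<inter> (V \<times> P \<times> Q \<times> U) \<and>
        (\<exists>\<kappa>>0. \<exists>l>0. \<forall>v1\<in>V. \<forall>v2\<in>V. \<forall>p1\<in>P. \<forall>p2\<in>P. \<forall>q1\<in>Q. \<forall>q2\<in>Q.
           norm ((v1 - v2) - (2 * \<kappa>) *\<^sub>R (\<theta> v1 p1 q1 - \<theta> v2 p2 q2))
             \<le> norm (v1 - v2) + l * (norm (p1 - p2) + norm (q1 - q2))))"

end

theory Submission
  imports Defs
begin

text \<open>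
  Near the reference point MFCQ turns the inclusion \<open>v \<in> f(x,p,q) + N(x)\<close>, \<open>N\<close> being the normal cone of
  \<open>C(p)\<close>, into the KKT system \<open>v = f(x,p,q) + (\<Sum>i. \<lambda>\<^sub>i \<nabla>\<phi>\<^sub>i(x,p))\<close> with \<open>\<lambda> \<ge> 0\<close> complementary to
  \<open>\<phi>(x,p)\<close> and bounded (\<open>solution_map_iff\<close>, \<open>multipliers_bound\<close>). All arguments are carried out on KKT points.

  Monotonicity. Let \<open>x\<^sub>1, x\<^sub>2\<close> be KKT points for the same \<open>(p,q)\<close>, with right-hand sides \<open>v\<^sub>1, v\<^sub>2\<close> and
  multipliers \<open>\<lambda>, \<mu>\<close>, and put \<open>h = x\<^sub>1 - x\<^sub>2\<close>. Symmetrizing the multiplier terms and applying the trapezoidal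
  rule to each \<open>\<phi>\<^sub>i\<close> gives, up to \<open>o(\<parallel>h\<parallel>\<^sup>2)\<close>, that \<open>\<langle>v\<^sub>1 - v\<^sub>2, h\<rangle>\<close> is the quadratic form of the Lagrangian at
  the averaged multiplier \<open>(\<lambda> + \<mu>)/2\<close> plus \<open>\<Sum>i. (\<lambda>\<^sub>i - \<mu>\<^sub>i) (\<phi>\<^sub>i(x\<^sub>1) - \<phi>\<^sub>i(x\<^sub>2))\<close>. Complementarity makes every summand
  nonnegative. If \<open>\<langle>v\<^sub>1 - v\<^sub>2, h\<rangle>\<close> were not at least \<open>\<kappa> \<parallel>h\<parallel>\<^sup>2\<close>, these summands would be \<open>O(\<parallel>h\<parallel>\<^sup>2)\<close>, so the limit of
  \<open>h/\<parallel>h\<parallel>\<close>, where the quadratic form is nonpositive, would be orthogonal to the gradients with positive averaged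
  multiplier. This contradicts GSSOSC, as the average of two multipliers is a multiplier (\<open>strong_monotonicity\<close>).
  Uniqueness of nearby solutions follows.

  Existence. Put \<open>T = f + N\<close>. For large \<open>\<rho>\<close> the inclusion \<open>w \<in> \<rho> x + N(x)\<close> is solved by projecting \<open>w/\<rho>\<close> onto \<open>C(p)\<close>,
  a prox-regular set. Adding \<open>f\<close> is a contraction step because \<open>\<rho>\<close> dominates its Lipschitz constant; removing
  \<open>\<rho> x\<close> from \<open>T + \<rho> I\<close> is another one because strong monotonicity of \<open>T\<close> makes the inverse of
  \<open>T + \<rho> I\<close> Lipschitz with constant \<open>1/(\<rho> + \<kappa>)\<close> (\<open>solution_exists_nearby\<close>).

  Parameters. Every solution has a multiplier whose support \<open>J\<close> indexes independent gradients at
  \<open>(x,p)\<close>, and by CRCQ also at the reference point. Two solutions sharing \<open>J\<close> solve one and the same system of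
  equations, which GSSOSC makes strongly regular, so they depend Lipschitz continuously on the data
  (\<open>common_support_lipschitz\<close>). Along a segment of parameters the finitely many sets of instants with support in \<open>J\<close>
  are closed and cover the segment; hence the solution is Lipschitz along it. Under LICQ both MFCQ and CRCQ hold, so
      sufficiency in the second
  assertion is a special case of the first.

  Necessity. LICQ allows one to straighten all active constraints simultaneously. Two curves of feasible points, which
  keep the strongly active constraints at zero and whose velocities differ by a given critical \<open>u\<close>,
      solve the problem for suitable \<open>v\<close>
  with the reference multiplier. The monotonicity contained in full stability, divided by \<open>t\<^sup>2\<close>, becomes
  \<open>\<kappa> \<parallel>u\<parallel>\<^sup>2 \<le> \<langle>u, \<nabla>L u\<rangle>\<close> in the limit
      (\<open>GSSOSC_if_fully_stable\<close>).
\<close>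

section \<open>Strict differentiability in one argument\<close>

text \<open>Strict differentiability in the first argument combined with a Lipschitz bound in the second. It is the
  common form of smoothness of \<open>f\<close>, which is merely Lipschitz in \<open>(p,q)\<close>, of the constraints and of
  their gradients.\<close>

definition partial_strict_derivative ::
  "('a::real_normed_vector \<times> 'b::real_normed_vector \<Rightarrow> 'c::real_normed_vector) \<Rightarrow> ('a
      \<Rightarrow> 'c) \<Rightarrow> 'a \<Rightarrow> 'b \<Rightarrow> bool"
  where
  "partial_strict_derivative F A a b \<longleftrightarrow>
     bounded_linear A \<and>
     (\<exists>K\<ge>0. \<forall>e>0. \<exists>d>0. \<forall>x\<in>ball a d. \<forall>y\<in>ball a d.
         \<forall>u\<in>ball b d. \<forall>w\<in>ball b d.
        norm (F (x, u) - F (y, w) - A (x - y)) \<le> e * norm (x - y) + K * norm (u - w))"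

lemma partial_strict_derivative_lipschitz:
  assumes "partial_strict_derivative F A a b"
  obtains d K where "0 < d" "0 \<le> K"
    "\<And>x y u w. \<lbrakk>x \<in> ball a d; y \<in> ball a d; u \<in> ball b d; w \<in> ball b d\<rbrakk>
       \<Longrightarrow> norm (F (x, u) - F (y, w)) \<le> K * (norm (x - y) + norm (u - w))"
proof -
  from assms obtain K where bl: "bounded_linear A" and "K \<ge> 0" and
    K: "\<forall>e>0. \<exists>d>0. \<forall>x\<in>ball a d. \<forall>y\<in>ball a d. \<forall>u\<in>ball b d.
        \<forall>w\<in>ball b d.
        norm (F (x, u) - F (y, w) - A (x - y)) \<le> e * norm (x - y) + K * norm (u - w)"
    unfolding partial_strict_derivative_def by blast
  obtain B where B: "B \<ge> 0" "\<And>x. norm (A x) \<le> B * norm x"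
    using bounded_linear.nonneg_bounded[OF bl] by (metis mult.commute)
  from K[rule_format, of 1] obtain d where "d > 0" and
    d: "\<And>x y u w. \<lbrakk>x\<in>ball a d; y\<in>ball a d; u\<in>ball b d; w\<in>ball b d\<rbrakk> \<Longrightarrow>
        norm (F (x, u) - F (y, w) - A (x - y)) \<le> norm (x - y) + K * norm (u - w)"
    by auto
  show ?thesis
  proof (rule that[of d "B + K + 1"])
    fix x y u w assume xy: "x \<in> ball a d" "y \<in> ball a d" "u \<in> ball b d" "w \<in> ball b d"
    have "norm (F (x, u) - F (y, w)) \<le> norm (F (x, u) - F (y, w) - A (x - y)) + norm (A (x - y))"
      by (metis add.commute diff_add_cancel norm_triangle_ineq)
    also have "\<dots> \<le> norm (x - y) + K * norm (u - w) + B * norm (x - y)"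
      using d[OF xy] B(2)[of "x-y"] by linarith
    also have "\<dots> \<le> (B + K + 1) * (norm (x - y) + norm (u - w))"
      using \<open>K \<ge> 0\<close> \<open>B \<ge> 0\<close> by (simp add: algebra_simps)
    finally show "norm (F (x, u) - F (y, w)) \<le> (B + K + 1) * (norm (x - y) + norm (u - w))" .
  qed (use \<open>d > 0\<close> \<open>K \<ge> 0\<close> \<open>B \<ge> 0\<close> in auto)
qed

lemma partial_strict_derivative_tendsto:
  assumes "partial_strict_derivative F A a b" "X \<longlonglongrightarrow> a" "U \<longlonglongrightarrow> b"
  shows "(\<lambda>k. F (X k, U k)) \<longlonglongrightarrow> F (a, b)"
proof -
  obtain d K where dK: "0 < d" "0 \<le> K"
    "\<And>x y u w. \<lbrakk>x \<in> ball a d; y \<in> ball a d; u \<in> ball b d; w \<in> ball b d\<rbrakk>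
       \<Longrightarrow> norm (F (x, u) - F (y, w)) \<le> K * (norm (x - y) + norm (u - w))"
    using partial_strict_derivative_lipschitz[OF assms(1)] by metis
  have "(\<lambda>k. F (X k, U k) - F (a, b)) \<longlonglongrightarrow> 0"
  proof (rule Lim_null_comparison)
    have "\<forall>\<^sub>F k in sequentially. X k \<in> ball a d" "\<forall>\<^sub>F k in sequentially. U k \<in> ball b d"
      using assms dK(1) by (auto simp: tendsto_iff dist_commute)
    then show "\<forall>\<^sub>F k in sequentially. norm (F (X k, U k) - F (a, b)) \<le> K * (norm (X k - a) + norm (U k - b))"
      by eventually_elim (use dK in auto)
    have "(\<lambda>k. K * (norm (X k - a) + norm (U k - b))) \<longlonglongrightarrow> K * (norm (a - a) + norm (b - b))"
      by (intro tendsto_intros assms)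
    then show "(\<lambda>k. K * (norm (X k - a) + norm (U k - b))) \<longlonglongrightarrow> 0" by simp
  qed
  then show ?thesis by (simp add: LIM_zero_iff)
qed

text \<open>The scaling \<open>s\<close> is left free because it is the distance of two solutions in some
  applications and the parameter of a curve in others.\<close>

lemma partial_strict_derivative_quotient:
  assumes F: "partial_strict_derivative F A a b"
    and lim: "X \<longlonglongrightarrow> a" "Y \<longlonglongrightarrow> a" "U \<longlonglongrightarrow> b" "W
        \<longlonglongrightarrow> b"
    and s: "\<And>k. s k > 0"
    and h: "(\<lambda>k. (X k - Y k) /\<^sub>R s k) \<longlonglongrightarrow> h"
    and par: "(\<lambda>k. norm (U k - W k) / s k) \<longlonglongrightarrow> 0"
  shows "(\<lambda>k. (F (X k, U k) - F (Y k, W k)) /\<^sub>R s k) \<longlonglongrightarrow> A h"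
proof -
  from F obtain K where bl: "bounded_linear A" and "K \<ge> 0" and
    K: "\<forall>e>0. \<exists>d>0. \<forall>x\<in>ball a d. \<forall>y\<in>ball a d. \<forall>u\<in>ball b d.
        \<forall>w\<in>ball b d.
        norm (F (x, u) - F (y, w) - A (x - y)) \<le> e * norm (x - y) + K * norm (u - w)"
    unfolding partial_strict_derivative_def by blast
  have nh: "(\<lambda>k. norm (X k - Y k) / s k) \<longlonglongrightarrow> norm h"
    using tendsto_norm[OF h] s by (simp add: divide_inverse_commute less_imp_le abs_of_pos)
  have "(\<lambda>k. (F (X k, U k) - F (Y k, W k)) /\<^sub>R s k - A ((X k - Y k) /\<^sub>R s k)) \<longlonglongrightarrow> 0"
  proof (rule tendstoI)
    fix \<epsilon> :: real assume "\<epsilon> > 0"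
    define n where "n = norm h + 1"
    have "n > 0" unfolding n_def by (simp add: add_nonneg_pos)
    define e where "e = \<epsilon> / (2 * n)"
    have "e > 0" "e * (norm h + 1) = \<epsilon> / 2"
      using \<open>\<epsilon> > 0\<close> \<open>n > 0\<close> by (simp_all add: e_def flip: n_def)
    note e2 = this(2)
    from K[rule_format, OF \<open>e > 0\<close>] obtain d where "d > 0" and
      d: "\<And>x y u w. \<lbrakk>x\<in>ball a d; y\<in>ball a d; u\<in>ball b d; w\<in>ball b d\<rbrakk> \<Longrightarrow>
        norm (F (x, u) - F (y, w) - A (x - y)) \<le> e * norm (x - y) + K * norm (u - w)" by blast
    have "\<forall>\<^sub>F k in sequentially. X k \<in> ball a d" "\<forall>\<^sub>F k in sequentially. U k \<in> ball b d"
      "\<forall>\<^sub>F k in sequentially. Y k \<in> ball a d" "\<forall>\<^sub>F k in sequentially. W k \<in> ball b d"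
      using lim \<open>d > 0\<close> by (auto simp: tendsto_iff dist_commute)
    moreover have "\<forall>\<^sub>F k in sequentially. norm (X k - Y k) / s k < norm h + 1"
      using nh by (rule order_tendstoD) simp
    moreover have "\<forall>\<^sub>F k in sequentially. K * (norm (U k - W k) / s k) < \<epsilon> / 2"
      by (rule order_tendstoD(2)[OF tendsto_mult_right_zero[OF par]]) (use \<open>\<epsilon> > 0\<close> in simp)
    ultimately show "\<forall>\<^sub>F k in sequentially.
        dist ((F (X k, U k) - F (Y k, W k)) /\<^sub>R s k - A ((X k - Y k) /\<^sub>R s k)) 0 < \<epsilon>"
    proof eventually_elim
      case (elim k)
      have "norm ((F (X k, U k) - F (Y k, W k)) /\<^sub>R s k - A ((X k - Y k) /\<^sub>R s k))
        = norm ((F (X k, U k) - F (Y k, W k) - A (X k - Y k)) /\<^sub>R s k)"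
        unfolding linear_cmul[OF bounded_linear.linear[OF bl]] by (simp only: scaleR_diff_right)
      also have "\<dots> = norm (F (X k, U k) - F (Y k, W k) - A (X k - Y k)) / s k"
        using s[of k] by (simp add: divide_inverse_commute)
      also have "\<dots> \<le> (e * norm (X k - Y k) + K * norm (U k - W k)) / s k"
        by (rule divide_right_mono[OF d]) (use elim s[of k] in auto)
      also have "\<dots> = e * (norm (X k - Y k) / s k) + K * (norm (U k - W k) / s k)"
        by (simp add: add_divide_distrib)
      also have "\<dots> < e * (norm h + 1) + \<epsilon> / 2"
        using elim \<open>e > 0\<close> by (intro add_le_less_mono mult_left_mono) auto
      finally show ?case using e2 by simp
    qed
  qed
  moreover have "(\<lambda>k. A ((X k - Y k) /\<^sub>R s k)) \<longlonglongrightarrow> A h"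
    by (rule bounded_linear.tendsto[OF bl h])
  ultimately show ?thesis using tendsto_add by fastforce
qed

text \<open>The mean value inequality on a ball applies to \<open>F\<close> minus its derivative at the centre; the parameter
  part of the derivative goes into the Lipschitz constant.\<close>

lemma C1_imp_partial_strict_derivative:
  fixes F :: "'a::real_normed_vector \<times> 'b::real_normed_vector \<Rightarrow> 'c::real_normed_vector"
    and F' :: "'a \<times> 'b \<Rightarrow> ('a \<times> 'b) \<Rightarrow>\<^sub>L 'c"
  assumes S: "open S" "(a, b) \<in> S"
    and der: "\<And>z. z \<in> S \<Longrightarrow> (F has_derivative blinfun_apply (F' z)) (at z)"
    and cont: "isCont F' (a, b)"
  shows "partial_strict_derivative F (\<lambda>h. blinfun_apply (F' (a, b)) (h, 0)) a b"
proof -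
  let ?D = "F' (a, b)"
  have bl: "bounded_linear (\<lambda>h. blinfun_apply ?D (h, 0))"
    by (intro bounded_linear_intros)
  have "\<exists>d>0. \<forall>x\<in>ball a d. \<forall>y\<in>ball a d. \<forall>u\<in>ball b d. \<forall>w\<in>ball b d.
        norm (F (x, u) - F (y, w) - blinfun_apply ?D (x - y, 0)) \<le> e * norm (x - y) + (norm ?D + 1) * norm (u - w)"
    if "e > 0" for e :: real
  proof -
    define e' where "e' = min e 1"
    have e': "e' > 0" "e' \<le> e" "e' \<le> 1" using that by (auto simp: e'_def)
    obtain d1 where d1: "d1 > 0" "\<And>z. dist z (a,b) < d1 \<Longrightarrow> dist (F' z) ?D < e'"
      using cont e'(1) unfolding continuous_at_eps_delta by metis
    obtain d2 where d2: "d2 > 0" "ball (a,b) d2 \<subseteq> S"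
      using S openE by blast
    define r where "r = min d1 d2"
    have r: "r > 0" using d1 d2 by (auto simp: r_def)
    have bd: "norm (F z1 - F z2 - blinfun_apply ?D (z1 - z2)) \<le> e' * norm (z1 - z2)"
      if z: "z1 \<in> ball (a,b) r" "z2 \<in> ball (a,b) r" for z1 z2
    proof -
      have "norm ((\<lambda>z. F z - blinfun_apply ?D z) z1 - (\<lambda>z. F z - blinfun_apply ?D z) z2) \<le> e' *
          norm (z1 - z2)"
      proof (rule differentiable_bound[where S = "ball (a,b) r" and f' = "\<lambda>z. blinfun_apply (F' z - ?D)"])
        fix z assume zz: "z \<in> ball (a,b) r"
        then have "z \<in> S" using d2 by (auto simp: r_def)
        then have "((\<lambda>z. F z - blinfun_apply ?D z) has_derivative (\<lambda>h. blinfun_apply (F' z) h -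
            blinfun_apply ?D h)) (at z)"
          by (intro derivative_intros der) (auto intro!: bounded_linear_imp_has_derivative blinfun.bounded_linear_right)
        then show "((\<lambda>z. F z - blinfun_apply ?D z) has_derivative blinfun_apply (F' z - ?D)) (at z within ball (a,b) r)"
          by (auto simp: blinfun.diff_left[abs_def] intro: has_derivative_at_withinI)
        have "norm (F' z - ?D) < e'" using zz d1(2)[of z] by (auto simp: r_def dist_commute dist_norm norm_minus_commute)
        then show "onorm (blinfun_apply (F' z - ?D)) \<le> e'" by (simp add: norm_blinfun.rep_eq[symmetric])
      qed (use z in auto)
      then show ?thesis by (simp add: blinfun.diff_right algebra_simps)
    qed
    have "r/2 > 0" using r by simp
    moreover have "norm (F (x, u) - F (y, w) - blinfun_apply ?D (x - y, 0)) \<le> e * norm (x - y) + (norm ?D + 1) * norm (u - w)"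
      if xy: "x\<in>ball a (r/2)" "y\<in>ball a (r/2)" "u\<in>ball b (r/2)" "w\<in>ball b (r/2)" for x y u w
    proof -
      have inr: "(x,u) \<in> ball (a,b) r" if "x\<in>ball a (r/2)" "u\<in>ball b (r/2)" for x u
      proof -
        have "norm (a - x, b - u) \<le> norm (a - x) + norm (b - u)" by (rule norm_Pair_le)
        then show ?thesis using that by (simp add: dist_norm)
      qed
      have "F (x, u) - F (y, w) - blinfun_apply ?D (x - y, 0) =
        (F (x, u) - F (y, w) - blinfun_apply ?D ((x,u) - (y,w))) + blinfun_apply ?D (0, u - w)"
        by (simp add: blinfun.add_right[symmetric] blinfun.diff_right[symmetric] algebra_simps)
      then have "norm (F (x, u) - F (y, w) - blinfun_apply ?D (x - y, 0)) \<le>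
        norm (F (x, u) - F (y, w) - blinfun_apply ?D ((x,u) - (y,w))) + norm (blinfun_apply ?D (0, u - w))"
        by (metis norm_triangle_ineq)
      also have "\<dots> \<le> e' * norm ((x,u) - (y,w)) + norm ?D * norm (0::'a, u - w)"
        using bd[OF inr inr, of x u y w] xy norm_blinfun[of ?D "(0, u-w)"] by fastforce
      also have "\<dots> \<le> e' * (norm (x - y) + norm (u - w)) + norm ?D * norm (u - w)"
        using norm_Pair_le[of "x-y" "u-w"] e' by (intro add_mono mult_left_mono) (auto simp: norm_Pair)
      also have "\<dots> \<le> e * norm (x - y) + (norm ?D + 1) * norm (u - w)"
        using mult_right_mono[OF e'(2), of "norm (x-y)"] mult_right_mono[OF e'(3), of "norm (u-w)"]
        by (simp add: algebra_simps)
      finally show ?thesis .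
    qed
    ultimately show ?thesis by blast
  qed
  then show ?thesis unfolding partial_strict_derivative_def using bl
    by (intro conjI exI[of _ "norm ?D + 1"]) auto
qed

lemma partial_strict_derivative_imp_has_derivative:
  assumes "partial_strict_derivative F A a b"
  shows "((\<lambda>x. F (x, b)) has_derivative A) (at a)"
proof -
  obtain K where bl: "bounded_linear A" and
    K: "\<forall>e>0. \<exists>d>0. \<forall>x\<in>ball a d. \<forall>y\<in>ball a d. \<forall>u\<in>ball b d.
        \<forall>w\<in>ball b d.
        norm (F (x, u) - F (y, w) - A (x - y)) \<le> e * norm (x - y) + K * norm (u - w)"
    using assms unfolding partial_strict_derivative_def by blast
  show ?thesis unfolding has_derivative_at_alt
  proof (intro conjI allI impI bl)
    fix e :: real assume "e > 0"
    from K[rule_format, OF this] obtain d where "d > 0" and d: "\<And>x y u w. \<lbrakk>x\<in>ball a d; y\<in>ball a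
        d; u\<in>ball b d; w\<in>ball b d\<rbrakk> \<Longrightarrow>
        norm (F (x, u) - F (y, w) - A (x - y)) \<le> e * norm (x - y) + K * norm (u - w)" by blast
    show "\<exists>d>0. \<forall>y. norm (y - a) < d \<longrightarrow> norm (F (y, b) - F (a, b) - A (y - a)) \<le> e
        * norm (y - a)"
      using \<open>d > 0\<close> d[of _ a b b] by (intro exI[of _ d]) (auto simp: dist_norm norm_minus_commute)
  qed
qed

text \<open>The partial gradient is the full derivative followed by the bounded linear map \<open>T\<close> that represents the
  restriction of a functional to the first factor. Hence it is as smooth as the full derivative.\<close>

lemma C2_around_imp_partial_strict_derivatives:
  fixes g :: "'a::euclidean_space \<times> 'b::euclidean_space \<Rightarrow> real"
  assumes "C2_around g (a, b)"
  obtains r H where "0 < r"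
    "\<And>x p. x \<in> ball a r \<Longrightarrow> p \<in> ball b r \<Longrightarrow>
       ((\<lambda>y. g (y, p)) has_derivative (\<lambda>h. inner (grad_x g (x, p)) h)) (at x)"
    "partial_strict_derivative g (\<lambda>h. inner (grad_x g (a, b)) h) a b"
    "partial_strict_derivative (grad_x g) H a b"
proof -
  obtain W and g' :: "'a \<times> 'b \<Rightarrow> ('a \<times> 'b) \<Rightarrow>\<^sub>L real"
      and g'' :: "'a \<times> 'b \<Rightarrow> ('a \<times> 'b) \<Rightarrow>\<^sub>L (('a \<times> 'b)
          \<Rightarrow>\<^sub>L real)"
    where W: "open W" "(a, b) \<in> W"
      and g': "\<And>y. y \<in> W \<Longrightarrow> (g has_derivative blinfun_apply (g' y)) (at y)"
      and g'': "\<And>y. y \<in> W \<Longrightarrow> (g' has_derivative blinfun_apply (g'' y)) (at y)"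
      and cont: "continuous_on W g''"
    using assms unfolding C2_around_def by blast
  define T :: "(('a \<times> 'b) \<Rightarrow>\<^sub>L real) \<Rightarrow> 'a" where "T L = (\<Sum>i\<in>Basis.
      blinfun_apply L (i, 0) *\<^sub>R i)" for L
  have T: "blinfun_apply L (h, 0) = inner (T L) h" for L h
  proof -
    have "inner (T L) h = (\<Sum>i\<in>Basis. blinfun_apply L ((h \<bullet> i) *\<^sub>R (i, 0)))"
      unfolding T_def inner_sum_left by (simp only: blinfun.scaleR_right) (simp add: inner_commute mult.commute)
    also have "\<dots> = blinfun_apply L (\<Sum>i\<in>Basis. (h \<bullet> i) *\<^sub>R (i, 0))" by (simp only: blinfun.sum_right)
    also have "(\<Sum>i\<in>Basis. (h \<bullet> i) *\<^sub>R (i, 0::'b)) = (h, 0)"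
      by (rule prod_eqI) (simp_all add: fst_sum snd_sum euclidean_representation)
    finally show ?thesis by simp
  qed
  have blT: "bounded_linear T" unfolding T_def by (intro bounded_linear_intros)
  have der: "((\<lambda>y. g (y, p)) has_derivative (\<lambda>h. inner (T (g' (x, p))) h)) (at x)" if "(x, p) \<in> W" for x p
  proof -
    have "((\<lambda>y. (y, p)) has_derivative (\<lambda>h. (h, 0))) (at x)" by (auto intro!: derivative_eq_intros)
    from has_derivative_compose[OF this g'[OF that]] show ?thesis by (simp add: T)
  qed
  have grad: "grad_x g z = T (g' z)" if "z \<in> W" for z
  proof -
    obtain x p where z: "z = (x, p)" by (cases z)
    have "(THE D. GDERIV (\<lambda>y. g (y, p)) x :> D) = T (g' (x, p))"
    proof (rule the_equality)
      show "GDERIV (\<lambda>y. g (y, p)) x :> T (g' (x, p))"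
        using der that z by (simp add: gderiv_def inner_commute)
      fix D assume "GDERIV (\<lambda>y. g (y, p)) x :> D"
      then have "(\<lambda>h. inner h D) = (\<lambda>h. inner (T (g' (x, p))) h)"
        using has_derivative_unique der that z unfolding gderiv_def by blast
      then have "\<And>h. inner h D = inner h (T (g' (x, p)))" by (simp add: fun_eq_iff inner_commute)
      then show "D = T (g' (x, p))" using vector_eq_ldot by blast
    qed
    then show ?thesis by (simp add: grad_x_def z)
  qed
  have contg'': "isCont g'' (a, b)" using cont W by (simp add: continuous_on_eq_continuous_at)
  have contg': "isCont g' (a, b)" using has_derivative_continuous g'' W by blast
  have grad_der: "(grad_x g has_derivative blinfun_apply (Blinfun T o\<^sub>L g'' z)) (at z)" if "z \<in> W" for z
  proof -
    have "((\<lambda>z. T (g' z)) has_derivative (\<lambda>h. T (blinfun_apply (g'' z) h))) (at z)"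
      by (rule bounded_linear.has_derivative[OF blT g''[OF that]])
    then have "((\<lambda>z. T (g' z)) has_derivative blinfun_apply (Blinfun T o\<^sub>L g'' z)) (at z)"
      by (simp add: bounded_linear_Blinfun_apply[OF blT] blinfun_compose.rep_eq comp_def)
    then show ?thesis
      by (rule has_derivative_transform_within_open[OF _ W(1) that]) (simp add: grad)
  qed
  have "isCont (\<lambda>z. Blinfun T o\<^sub>L g'' z) (a, b)"
    by (rule bounded_linear.isCont[OF bounded_bilinear.bounded_linear_right[OF bounded_bilinear_blinfun_compose] contg''])
  from C1_imp_partial_strict_derivative[OF W grad_der this]
  obtain H where H: "partial_strict_derivative (grad_x g) H a b" by blast
  have P: "partial_strict_derivative g (\<lambda>h. inner (grad_x g (a, b)) h) a b"
    using C1_imp_partial_strict_derivative[OF W g' contg'] by (simp add: T grad W(2))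
  obtain e where e: "e > 0" "ball (a,b) e \<subseteq> W" using W openE by blast
  show ?thesis
  proof (rule that[OF _ _ P H, of "e/2"])
    fix x p assume xp: "x \<in> ball a (e/2)" "p \<in> ball b (e/2)"
    have "norm (a - x, b - p) \<le> norm (a - x) + norm (b - p)" by (rule norm_Pair_le)
    then have "(x, p) \<in> ball (a,b) e" using xp by (simp add: dist_norm)
    then show "((\<lambda>y. g (y, p)) has_derivative (\<lambda>h. inner (grad_x g (x, p)) h)) (at x)"
      using der e grad by auto
  qed (use e in simp)
qed

text \<open>Averaging the gradients at both ends absorbs the second-order term of Taylor's formula, so the error
  is \<open>o\<close> of the squared distance, uniformly for pairs of points near the reference point. Along the segment the function
  \<open>\<psi>\<close> subtracts the second-order polynomial built from the gradient at \<open>y\<close>.\<close>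

lemma trapezoid_estimate:
  fixes g :: "'a::euclidean_space \<times> 'b::real_normed_vector \<Rightarrow> real"
  assumes r: "0 < r"
    and der: "\<And>x p. x \<in> ball a r \<Longrightarrow> p \<in> ball b r \<Longrightarrow>
       ((\<lambda>y. g (y, p)) has_derivative (\<lambda>h. inner (G (x, p)) h)) (at x)"
    and G: "partial_strict_derivative G H a b" and e: "0 < e"
  obtains d where "0 < d" "\<And>x y p. x \<in> ball a d \<Longrightarrow> y \<in> ball a d \<Longrightarrow> p \<in>
      ball b d \<Longrightarrow>
      \<bar>g (x, p) - g (y, p) - inner (G (x, p) + G (y, p)) (x - y) / 2\<bar> \<le> e * (norm (x - y))\<^sup>2"
proof -
  obtain K where bl: "bounded_linear H" and
    K: "\<forall>e>0. \<exists>d>0. \<forall>x\<in>ball a d. \<forall>y\<in>ball a d. \<forall>u\<in>ball b d.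
        \<forall>w\<in>ball b d.
        norm (G (x, u) - G (y, w) - H (x - y)) \<le> e * norm (x - y) + K * norm (u - w)"
    using G unfolding partial_strict_derivative_def by blast
  have "e/2 > 0" using e by simp
  from K[rule_format, OF this] obtain d0 where "d0 > 0" and d0: "\<And>x y u w. \<lbrakk>x\<in>ball a d0; y\<in>ball
      a d0; u\<in>ball b d0; w\<in>ball b d0\<rbrakk> \<Longrightarrow>
        norm (G (x, u) - G (y, w) - H (x - y)) \<le> e/2 * norm (x - y) + K * norm (u - w)" by blast
  define d where "d = min r d0"
  show ?thesis
  proof (rule that[of d])
    fix x y p assume xyp: "x \<in> ball a d" "y \<in> ball a d" "p \<in> ball b d"
    define \<Delta> where "\<Delta> = x - y"
    define z where "z t = y + t *\<^sub>R \<Delta>" for t :: real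
    have zin: "z t \<in> ball a d" if "0 \<le> t" "t \<le> 1" for t
    proof -
      have "z t = (1 - t) *\<^sub>R y + t *\<^sub>R x" by (simp add: z_def \<Delta>_def algebra_simps)
      then show ?thesis using convexD[OF convex_ball xyp(2,1), of "1 - t" t] that by simp
    qed
    have Gz: "norm (G (z t, p) - G (y, p) - H (t *\<^sub>R \<Delta>)) \<le> e/2 * norm \<Delta>" if "0 \<le> t" "t \<le> 1" for t
    proof -
      have "norm (G (z t, p) - G (y, p) - H (z t - y)) \<le> e/2 * norm (z t - y) + K * norm (p - p)"
        using zin[OF that] xyp by (intro d0) (auto simp: d_def)
      also have "\<dots> = e/2 * (t * norm \<Delta>)" using that by (simp add: z_def)
      also have "\<dots> \<le> e/2 * (1 * norm \<Delta>)" using that e by (intro mult_left_mono mult_right_mono) auto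
      finally show ?thesis by (simp add: z_def)
    qed
    define \<psi> where "\<psi> t = g (z t, p) - t * inner (G (y, p)) \<Delta> - t\<^sup>2 / 2 * inner (H \<Delta>)
        \<Delta>" for t
    have d\<psi>: "DERIV \<psi> t :> inner (G (z t, p) - G (y, p) - H (t *\<^sub>R \<Delta>)) \<Delta>" if t: "0
        \<le> t" "t \<le> 1" for t
    proof -
      have "(z has_derivative (\<lambda>s. s *\<^sub>R \<Delta>)) (at t)" unfolding z_def by (auto intro!: derivative_eq_intros)
      moreover have "((\<lambda>y. g (y, p)) has_derivative (\<lambda>h. inner (G (z t, p)) h)) (at (z t))"
        using zin[OF t] xyp by (intro der) (auto simp: d_def)
      ultimately have "((\<lambda>t. g (z t, p)) has_derivative (\<lambda>s. inner (G (z t, p)) (s *\<^sub>R \<Delta>))) (at t)"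
        by (rule has_derivative_compose)
      moreover have "(\<lambda>s. inner (G (z t, p)) (s *\<^sub>R \<Delta>)) = (*) (inner (G (z t, p)) \<Delta>)"
        by (simp add: fun_eq_iff)
      ultimately have D: "((\<lambda>t. g (z t, p)) has_field_derivative inner (G (z t, p)) \<Delta>) (at t)"
        unfolding has_field_derivative_def by (simp only:)
      show ?thesis unfolding \<psi>_def
        by (rule derivative_eq_intros D refl | simp add: inner_diff_left inner_add_left linear_cmul[OF
            bounded_linear.linear[OF bl]] field_simps)+
    qed
    obtain t where t: "0 < t" "t < 1" "\<psi> 1 - \<psi> 0 = (1 - 0) * inner (G (z t, p) - G (y, p) - H (t *\<^sub>R
        \<Delta>)) \<Delta>"
      using MVT2[of 0 1 \<psi> "\<lambda>t. inner (G (z t, p) - G (y, p) - H (t *\<^sub>R \<Delta>)) \<Delta>"] d\<psi> by auto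
    have cs: "\<bar>inner (G (z s, p) - G (y, p) - H (s *\<^sub>R \<Delta>)) \<Delta>\<bar> \<le> e/2 * (norm
        \<Delta>)\<^sup>2" if "0 \<le> s" "s \<le> 1" for s
    proof -
      have "\<bar>inner (G (z s, p) - G (y, p) - H (s *\<^sub>R \<Delta>)) \<Delta>\<bar> \<le> norm (G (z s, p) - G
          (y, p) - H (s *\<^sub>R \<Delta>)) * norm \<Delta>"
        by (rule Cauchy_Schwarz_ineq2)
      also have "\<dots> \<le> (e/2 * norm \<Delta>) * norm \<Delta>" by (rule mult_right_mono[OF Gz[OF that]]) simp
      finally show ?thesis by (simp add: power2_eq_square)
    qed
    have z1: "z 1 = x" "z 0 = y" by (auto simp: z_def \<Delta>_def)
    have "\<psi> 1 - \<psi> 0 = g (x, p) - g (y, p) - inner (G (y, p)) \<Delta> - inner (H \<Delta>) \<Delta> / 2"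
      by (simp add: \<psi>_def z1)
    moreover have "inner (G (z 1, p) - G (y, p) - H (1 *\<^sub>R \<Delta>)) \<Delta>
        = inner (G (x, p)) \<Delta> - inner (G (y, p)) \<Delta> - inner (H \<Delta>) \<Delta>"
      by (simp add: z1 inner_diff_left)
    moreover have "\<bar>\<psi> 1 - \<psi> 0\<bar> \<le> e/2 * (norm \<Delta>)\<^sup>2"
      using cs[of t] t by simp
    moreover have "\<bar>inner (G (z 1, p) - G (y, p) - H (1 *\<^sub>R \<Delta>)) \<Delta>\<bar> \<le> e/2 * (norm
        \<Delta>)\<^sup>2"
      by (rule cs) auto
    moreover have "inner (G (x, p) + G (y, p)) (x - y) = inner (G (x, p)) \<Delta> + inner (G (y, p)) \<Delta>"
      by (simp add: \<Delta>_def inner_add_left)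
    moreover have "0 \<le> e * (norm \<Delta>)\<^sup>2" using e by simp
    ultimately have "\<bar>g (x, p) - g (y, p) - inner (G (x, p) + G (y, p)) (x - y) / 2\<bar> \<le> e * (norm \<Delta>)\<^sup>2"
      by linarith
    then show "\<bar>g (x, p) - g (y, p) - inner (G (x, p) + G (y, p)) (x - y) / 2\<bar> \<le> e * (norm (x - y))\<^sup>2"
      by (simp add: \<Delta>_def)
  qed (use r \<open>d0 > 0\<close> in \<open>simp add: d_def\<close>)
qed

text \<open>For a fixed parameter the mean value inequality applies to \<open>f\<close> minus its reference Jacobian, since
  the Jacobians are close to it; a change of the parameter costs the Lipschitz constant of \<open>f\<close>.\<close>

lemma jac_x_imp_partial_strict_derivative:
  fixes f :: "(real^'n) \<times> (real^'l) \<times> (real^'m) \<Rightarrow> real^'n"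
  assumes A1: "lipschitz_around f (xb, pb, qb)"
    and A4_diff: "uniformly_differentiable_x f xb pb qb"
    and A4_cont: "isCont (jac_x f) (xb, pb, qb)"
  shows "partial_strict_derivative f (\<lambda>h. jac_x f (xb, pb, qb) *v h) xb (pb, qb)"
proof -
  obtain W K where W: "(xb, pb, qb) \<in> interior W" and lip: "K-lipschitz_on W f"
    using A1 unfolding lipschitz_around_def by blast
  have K0: "K \<ge> 0" using lip by (rule lipschitz_on_nonneg)
  obtain d1 where d1: "d1 > 0" "ball (xb, pb, qb) d1 \<subseteq> W"
    using W unfolding mem_interior by blast
  obtain U P Q where UPQ: "xb \<in> interior U" "pb \<in> interior P" "qb \<in> interior Q"
    and diff: "\<And>x p q. x \<in> U \<Longrightarrow> p \<in> P \<Longrightarrow> q \<in> Q \<Longrightarrow>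
        (\<lambda>y. f (y, p, q)) differentiable (at x)"
    using A4_diff unfolding uniformly_differentiable_x_def by blast
  have opn: "open (interior U \<times> interior P \<times> interior Q)" by (intro open_Times open_interior)
  obtain d2 where d2: "d2 > 0" "ball (xb, pb, qb) d2 \<subseteq> interior U \<times> interior P \<times> interior Q"
    using openE[OF opn, of "(xb, pb, qb)"] UPQ by auto
  have der: "((\<lambda>y. f (y, p, q)) has_derivative (\<lambda>h. jac_x f (x, p, q) *v h)) (at x)"
    if "(x, p, q) \<in> ball (xb, pb, qb) d2" for x p q
  proof -
    have "x \<in> U" "p \<in> P" "q \<in> Q" using that d2 interior_subset by blast+
    then have "(\<lambda>y. f (y, p, q)) differentiable (at x)" by (rule diff)
    then show ?thesis using jacobian_works unfolding jac_x_def by auto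
  qed
  have inr: "(x, w) \<in> ball (xb, pb, qb) d" if "x \<in> ball xb (d/2)" "w \<in> ball (pb, qb) (d/2)" for x w d
  proof -
    have "norm (xb - x, (pb, qb) - w) \<le> norm (xb - x) + norm ((pb, qb) - w)" by (rule norm_Pair_le)
    then show ?thesis using that by (simp add: dist_norm)
  qed
  define c where "c = real CARD('n) * real CARD('n)"
  have "c > 0" by (simp add: c_def)
  let ?A = "jac_x f (xb, pb, qb)"
  have "\<exists>d>0. \<forall>x\<in>ball xb d. \<forall>y\<in>ball xb d. \<forall>u\<in>ball (pb, qb) d.
      \<forall>w\<in>ball (pb, qb) d.
        norm (f (x, u) - f (y, w) - ?A *v (x - y)) \<le> e * norm (x - y) + K * norm (u - w)" if e: "e > 0" for e
  proof -
    have "e / c > 0" using e \<open>c > 0\<close> by simp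
    then obtain d3 where d3: "d3 > 0" "\<And>z. dist z (xb, pb, qb) < d3 \<Longrightarrow> norm (jac_x f z - ?A) < e / c"
      using A4_cont unfolding continuous_at_eps_delta dist_norm by metis
    define d where "d = min d1 (min d2 d3)"
    have d: "d > 0" "d \<le> d1" "d \<le> d2" "d \<le> d3" using d1 d2 d3 by (auto simp: d_def)
    have "norm (f (x, u) - f (y, w) - ?A *v (x - y)) \<le> e * norm (x - y) + K * norm (u - w)"
      if xy: "x\<in>ball xb (d/2)" "y\<in>ball xb (d/2)" "u\<in>ball (pb, qb) (d/2)" "w\<in>ball (pb, qb) (d/2)" for x y u w
    proof -
      obtain p q where u: "u = (p, q)" by (cases u)
      have "norm ((\<lambda>x. f (x, u) - ?A *v x) x - (\<lambda>x. f (x, u) - ?A *v x) y) \<le> e * norm (x - y)"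
      proof (rule differentiable_bound[where S = "ball xb (d/2)" and f' = "\<lambda>x h. (jac_x f (x, u) - ?A) *v h"])
        fix z assume z: "z \<in> ball xb (d/2)"
        have zin: "(z, u) \<in> ball (xb, pb, qb) d" using inr[OF z xy(3)] .
        then have "((\<lambda>y. f (y, u)) has_derivative (\<lambda>h. jac_x f (z, u) *v h)) (at z)"
          using der[of z p q] d u by auto
        then have "((\<lambda>x. f (x, u) - ?A *v x) has_derivative (\<lambda>h. jac_x f (z, u) *v h - ?A *v h)) (at z)"
          by (intro has_derivative_diff bounded_linear_imp_has_derivative matrix_vector_mul_bounded_linear)
        then show "((\<lambda>x. f (x, u) - ?A *v x) has_derivative (\<lambda>h. (jac_x f (z, u) - ?A) *v h)) (at z
            within ball xb (d/2))"
          by (simp add: matrix_vector_mult_diff_rdistrib has_derivative_at_withinI)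
        have n: "norm (jac_x f (z, u) - ?A) < e / c" using d3(2)[of "(z, u)"] zin d by (auto simp: dist_commute)
        have "\<bar>(jac_x f (z, u) - ?A) $ i $ j\<bar> \<le> e / c" for i j
          using n component_le_norm_cart[of "(jac_x f (z, u) - ?A) $ i" j]
            Finite_Cartesian_Product.norm_nth_le[of "jac_x f (z, u) - ?A" i] by linarith
        then have "onorm ((*v) (jac_x f (z, u) - ?A)) \<le> real CARD('n) * real CARD('n) * (e / c)"
          by (rule onorm_le_matrix_component)
        then show "onorm (\<lambda>h. (jac_x f (z, u) - ?A) *v h) \<le> e" using \<open>c > 0\<close> by (simp add: c_def)
      qed (use xy in auto)
      then have 1: "norm (f (x, u) - f (y, u) - ?A *v (x - y)) \<le> e * norm (x - y)"
        by (simp add: matrix_vector_mult_diff_distrib algebra_simps)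
      have "ball (xb, pb, qb) d \<subseteq> W" using d d1 by (auto simp: subset_iff)
      then have "(y, u) \<in> W" "(y, w) \<in> W" using inr[OF xy(2,3)] inr[OF xy(2,4)] by blast+
      then have "dist (f (y, u)) (f (y, w)) \<le> K * dist (y, u) (y, w)" using lip by (auto simp: lipschitz_on_def)
      then have 2: "norm (f (y, u) - f (y, w)) \<le> K * norm (u - w)" by (simp add: dist_norm norm_Pair)
      have "f (x, u) - f (y, w) - ?A *v (x - y) = (f (x, u) - f (y, u) - ?A *v (x - y)) + (f (y, u) - f (y, w))" by simp
      then have "norm (f (x, u) - f (y, w) - ?A *v (x - y)) \<le> norm (f (x, u) - f (y, u) - ?A *v (x - y)) + norm
          (f (y, u) - f (y, w))"
        by (metis norm_triangle_ineq)
      then show ?thesis using 1 2 by linarith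
    qed
    then show ?thesis using d by (intro exI[of _ "d/2"]) auto
  qed
  then show ?thesis unfolding partial_strict_derivative_def using K0 matrix_vector_mul_bounded_linear by blast
qed

section \<open>Normal cones and perturbed inclusions\<close>

lemma regular_normal_coneI_quadratic:
  assumes "x \<in> \<Omega>"
    and quad: "\<forall>\<^sub>F u in at x within \<Omega>. inner v (u - x) \<le> c * (norm (u - x))\<^sup>2"
  shows "v \<in> regular_normal_cone \<Omega> x"
proof -
  have "\<forall>\<^sub>F u in at x within \<Omega>. ereal (inner v (u - x) / norm (u - x)) < y" if y: "0 < y" for y :: ereal
  proof -
    obtain e where e: "0 < ereal e" "ereal e < y" using ereal_dense2[OF y] by blast
    have "((\<lambda>u. c * norm (u - x)) \<longlongrightarrow> c * norm (x - x)) (at x within \<Omega>)"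
      by (intro tendsto_intros)
    then have "\<forall>\<^sub>F u in at x within \<Omega>. c * norm (u - x) < e"
      by (rule order_tendstoD(2)) (use e in simp)
    moreover have "\<forall>\<^sub>F u in at x within \<Omega>. u \<noteq> x"
      by (simp add: eventually_at_filter)
    ultimately show ?thesis using quad
    proof eventually_elim
      case (elim u)
      then have "inner v (u - x) / norm (u - x) \<le> c * norm (u - x)"
        by (simp add: pos_divide_le_eq power2_eq_square mult.assoc)
      with elim have "ereal (inner v (u - x) / norm (u - x)) < ereal e" by simp
      then show ?case using e(2) by (rule less_trans)
    qed
  qed
  then show ?thesis using assms(1) by (simp add: regular_normal_cone_def Limsup_le_iff)
qed

text \<open>Along a feasible ray the defining quotient is constant.\<close>

lemma regular_normal_coneD_direction:
  assumes v: "v \<in> regular_normal_cone \<Omega> x"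
    and feas: "\<forall>\<^sub>F t in at_right 0. x + t *\<^sub>R d \<in> \<Omega>"
  shows "inner v d \<le> 0"
proof (rule ccontr)
  assume "\<not> inner v d \<le> 0"
  then have pos: "inner v d > 0" and "d \<noteq> 0" by auto
  have "Limsup (at x within \<Omega>) (\<lambda>u. ereal (inner v (u - x) / norm (u - x))) \<le> 0"
    using v by (auto simp: regular_normal_cone_def split: if_splits)
  moreover have "0 < ereal (inner v d / norm d)" using pos \<open>d \<noteq> 0\<close> by simp
  ultimately have "\<forall>\<^sub>F u in at x within \<Omega>. ereal (inner v (u - x) / norm (u - x)) < ereal (inner
      v d / norm d)"
    unfolding Limsup_le_iff by blast
  moreover have "filterlim (\<lambda>t. x + t *\<^sub>R d) (at x within \<Omega>) (at_right (0::real))"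
    unfolding filterlim_at
  proof
    have "((\<lambda>t. x + t *\<^sub>R d) \<longlongrightarrow> x + 0 *\<^sub>R d) (at_right (0::real))" by (intro
        tendsto_intros)
    then show "((\<lambda>t. x + t *\<^sub>R d) \<longlongrightarrow> x) (at_right (0::real))" by simp
    have "\<forall>\<^sub>F t in at_right (0::real). t > 0" by (simp add: eventually_at_right_less)
    with feas show "\<forall>\<^sub>F t in at_right 0. x + t *\<^sub>R d \<in> \<Omega> \<and> x + t *\<^sub>R d \<noteq> x"
      by eventually_elim (use \<open>d \<noteq> 0\<close> in auto)
  qed
  ultimately have "\<forall>\<^sub>F t in at_right (0::real). inner v (t *\<^sub>R d) / norm (t *\<^sub>R d) < inner v d / norm d"
    by (auto simp: filterlim_iff)
  moreover have "\<forall>\<^sub>F t in at_right (0::real). t > 0" by (simp add: eventually_at_right_less)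
  ultimately have "\<forall>\<^sub>F t in at_right (0::real). False"
    by eventually_elim simp
  then show False by (simp add: trivial_limit_at_right_real eventually_False)
qed

text \<open>The last hypothesis makes the ball invariant.\<close>

lemma contraction_on_cball:
  fixes T :: "'a::banach \<Rightarrow> 'a"
  assumes c: "0 \<le> c" "c < 1" and "0 \<le> \<delta>"
    and lip: "\<And>x y. x \<in> cball a \<delta> \<Longrightarrow> y \<in> cball a \<delta> \<Longrightarrow> norm
        (T x - T y) \<le> c * norm (x - y)"
    and start: "norm (T a - a) \<le> (1 - c) * \<delta>"
  obtains x where "x \<in> cball a \<delta>" "T x = x"
proof -
  have "\<exists>!x\<in>cball a \<delta>. T x = x"
  proof (rule Banach_fix[OF _ _ c])
    show "complete (cball a \<delta>)" by (simp add: complete_eq_closed)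
    show "cball a \<delta> \<noteq> {}" using \<open>0 \<le> \<delta>\<close> by simp
    show "T ` cball a \<delta> \<subseteq> cball a \<delta>"
    proof safe
      fix x assume x: "x \<in> cball a \<delta>"
      have "norm (T x - a) \<le> norm (T x - T a) + norm (T a - a)" using norm_triangle_ineq[of "T x - T a" "T a - a"] by simp
      also have "\<dots> \<le> c * norm (x - a) + (1 - c) * \<delta>" using lip[OF x, of a] start \<open>0 \<le>
          \<delta>\<close> by auto
      also have "\<dots> \<le> c * \<delta> + (1 - c) * \<delta>" using x c by (intro add_right_mono mult_left_mono)
          (auto simp: dist_norm norm_minus_commute)
      finally show "T x \<in> cball a \<delta>" by (simp add: dist_norm norm_minus_commute algebra_simps)
    qed
    show "dist (T x) (T y) \<le> c * dist x y" if "x \<in> cball a \<delta>" "y \<in> cball a \<delta>" for x y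
      using lip[OF that] by (simp add: dist_norm)
  qed
  then show ?thesis using that by blast
qed

text \<open>Solvability for all data near the reference data, by points as close to \<open>x0\<close> as desired.
  Uniqueness enters separately, through a Lipschitz estimate for solutions.\<close>

definition locally_solvable ::
  "('t::metric_space \<Rightarrow> 'a::metric_space \<Rightarrow> 'b::metric_space set) \<Rightarrow> 't
      \<Rightarrow> 'a \<Rightarrow> 'b \<Rightarrow> bool" where
  "locally_solvable M t0 x0 w0 \<longleftrightarrow>
     (\<forall>e>0. \<exists>d>0. \<forall>t\<in>ball t0 d. \<forall>w\<in>ball w0 d. \<exists>x\<in>cball x0 e. w \<in> M t x)"

text \<open>A solution of \<open>v + h t x \<in> M t x\<close> is a fixed point of the map sending \<open>x\<close> to the solution for the datum
  \<open>v + h t x\<close>, a contraction with factor \<open>a * b\<close>. Solutions are first found in the fixed ball of radius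
  \<open>e0\<close>; the Lipschitz estimate then places them in the small ball of radius \<open>\<epsilon>\<close>, whose
  choice may therefore depend on the solvability radius \<open>d1\<close>.\<close>

lemma locally_solvable_perturbation:
  fixes M :: "'t::metric_space \<Rightarrow> 'a::banach \<Rightarrow> 'b::real_normed_vector set"
  assumes solv: "locally_solvable M t0 x0 w0"
    and ab: "0 \<le> a" "0 \<le> b" "a * b < 1" and "0 < e0"
    and lip: "\<And>t x1 x2 w1 w2. \<lbrakk>t \<in> ball t0 e0; x1 \<in> cball x0 e0; x2 \<in> cball x0 e0;
        w1 \<in> ball w0 e0; w2 \<in> ball w0 e0; w1 \<in> M t x1; w2 \<in> M t x2\<rbrakk>
        \<Longrightarrow> norm (x1 - x2) \<le> a * norm (w1 - w2)"
    and hlip: "\<And>t x y. \<lbrakk>t \<in> ball t0 e0; x \<in> cball x0 e0; y \<in> cball x0 e0\<rbrakk>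
        \<Longrightarrow> norm (h t x - h t y) \<le> b * norm (x - y)"
    and hcont: "isCont (\<lambda>t. h t x0) t0"
  shows "locally_solvable (\<lambda>t x. {v. v + h t x \<in> M t x}) t0 x0 (w0 - h t0 x0)"
  unfolding locally_solvable_def
proof (intro allI impI)
  fix e :: real assume "e > 0"
  obtain d1 where d1: "d1 > 0" "\<And>t w. t \<in> ball t0 d1 \<Longrightarrow> w \<in> ball w0 d1 \<Longrightarrow>
      \<exists>x\<in>cball x0 e0. w \<in> M t x"
    using solv \<open>0 < e0\<close> unfolding locally_solvable_def by blast
  define m where "m = min e0 d1"
  define \<epsilon> where "\<epsilon> = min (min e e0) (m / (3 * (b + 1)))"
  have "m > 0" using d1 \<open>0 < e0\<close> by (simp add: m_def)
  then have \<epsilon>: "\<epsilon> > 0" "\<epsilon> \<le> e" "\<epsilon> \<le> e0" using ab \<open>e > 0\<close>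
      \<open>0 < e0\<close> by (auto simp: \<epsilon>_def)
  have "(b + 1) * \<epsilon> \<le> (b + 1) * (m / (3 * (b + 1)))" using ab by (intro mult_left_mono) (auto simp: \<epsilon>_def)
  also have "\<dots> = m / 3" using nonzero_mult_divide_mult_cancel_left[of "b + 1" m 3] ab by (simp add: mult.commute)
  finally have b\<epsilon>: "b * \<epsilon> \<le> m / 3" using \<epsilon> ab by (simp add: algebra_simps)
  have "(1 - a * b) * \<epsilon> > 0" using ab \<epsilon> by simp
  then obtain d2 where d2: "d2 > 0"
    "\<And>t w. t \<in> ball t0 d2 \<Longrightarrow> w \<in> ball w0 d2 \<Longrightarrow> \<exists>x\<in>cball x0 ((1
        - a * b) * \<epsilon>). w \<in> M t x"
    using solv unfolding locally_solvable_def by meson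
  define m2 where "m2 = min m d2"
  have m2: "m2 > 0" "m2 \<le> m" "m2 \<le> d2" using \<open>m > 0\<close> d2 by (auto simp: m2_def)
  have "m2 / 3 > 0" using m2 by simp
  then obtain d3 where d3: "d3 > 0" "\<And>t. dist t t0 < d3 \<Longrightarrow> norm (h t x0 - h t0 x0) < m2 / 3"
    using hcont unfolding continuous_at_eps_delta dist_norm by metis
  define d where "d = min d3 (min m2 (m2 / 3))"
  have "d > 0" using d3 m2 by (simp add: d_def)
  moreover have "\<exists>x\<in>cball x0 e. v \<in> {v. v + h t x \<in> M t x}"
    if t: "t \<in> ball t0 d" and v: "v \<in> ball (w0 - h t0 x0) d" for t v
  proof -
    have tt: "t \<in> ball t0 e0" "t \<in> ball t0 d1" "t \<in> ball t0 d2" "dist t t0 < d3"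
      using t m2 by (auto simp: d_def m_def dist_commute)
    have ws: "norm (v + h t x0 - w0) < 2 * m2 / 3"
    proof -
      have "norm (v + h t x0 - w0) = norm ((v - (w0 - h t0 x0)) + (h t x0 - h t0 x0))" by (simp add: algebra_simps)
      also have "\<dots> \<le> norm (v - (w0 - h t0 x0)) + norm (h t x0 - h t0 x0)" by (rule norm_triangle_ineq)
      also have "\<dots> < m2 / 3 + m2 / 3" using v d3(2)[OF tt(4)]
        by (intro add_strict_mono) (auto simp: d_def dist_norm norm_minus_commute)
      finally show ?thesis by simp
    qed
    have near: "v + h t x \<in> ball w0 m" if "x \<in> cball x0 \<epsilon>" for x
    proof -
      have "norm (h t x - h t x0) \<le> b * norm (x - x0)" using hlip[OF tt(1)] that \<epsilon> by auto
      also have "\<dots> \<le> b * \<epsilon>" using that ab by (intro mult_left_mono) (auto simp: dist_norm norm_minus_commute)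
      finally have "norm (h t x - h t x0) \<le> m / 3" using b\<epsilon> by linarith
      moreover have "v + h t x - w0 = (v + h t x0 - w0) + (h t x - h t x0)" by simp
      then have "norm (v + h t x - w0) \<le> norm (v + h t x0 - w0) + norm (h t x - h t x0)" by (metis norm_triangle_ineq)
      ultimately have "norm (v + h t x - w0) < m" using ws m2 by linarith
      then show ?thesis by (simp add: dist_norm norm_minus_commute)
    qed
    have "\<forall>x\<in>cball x0 \<epsilon>. \<exists>y. y \<in> cball x0 e0 \<and> v + h t x \<in> M t y"
    proof
      fix x assume "x \<in> cball x0 \<epsilon>"
      then show "\<exists>y. y \<in> cball x0 e0 \<and> v + h t x \<in> M t y"
        using d1(2)[OF tt(2), of "v + h t x"] near[of x] by (auto simp: m_def)
    qed
    then obtain T where T: "\<And>x. x \<in> cball x0 \<epsilon> \<Longrightarrow> T x \<in> cball x0 e0 \<and> v + h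
        t x \<in> M t (T x)" by metis
    obtain y where y: "y \<in> cball x0 ((1 - a * b) * \<epsilon>)" "v + h t x0 \<in> M t y"
      using d2(2)[OF tt(3), of "v + h t x0"] ws m2 by (auto simp: dist_norm norm_minus_commute)
    have e0w: "v + h t x \<in> ball w0 e0" if "x \<in> cball x0 \<epsilon>" for x
      using near[OF that] by (simp add: m_def)
    have "(1 - a * b) * \<epsilon> \<le> 1 * \<epsilon>" using ab \<epsilon> by (intro mult_right_mono) auto
    then have ye0: "y \<in> cball x0 e0" using y(1) \<epsilon> unfolding mem_cball by linarith
    have x0in: "x0 \<in> cball x0 \<epsilon>" using \<epsilon> by simp
    have Tx0: "T x0 = y"
      using lip[OF tt(1) _ ye0 e0w[OF x0in] e0w[OF x0in] _ y(2), of "T x0"] T[OF x0in] by simp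
    obtain x where x: "x \<in> cball x0 \<epsilon>" "T x = x"
    proof (rule contraction_on_cball[of "a * b" \<epsilon> x0 T])
      fix x y assume xy: "x \<in> cball x0 \<epsilon>" "y \<in> cball x0 \<epsilon>"
      have "norm (T x - T y) \<le> a * norm ((v + h t x) - (v + h t y))"
        by (rule lip[OF tt(1)]) (use T e0w xy in auto)
      also have "\<dots> \<le> a * (b * norm (x - y))"
        using hlip[OF tt(1), of x y] xy \<epsilon> ab by (intro mult_left_mono) auto
      finally show "norm (T x - T y) \<le> a * b * norm (x - y)" by (simp add: mult.assoc)
    next
      show "norm (T x0 - x0) \<le> (1 - a * b) * \<epsilon>" using y(1) Tx0 by (simp add: dist_norm norm_minus_commute)
    qed (use ab \<epsilon> in auto)
    then have "x \<in> cball x0 e" "v + h t x \<in> M t x" using T[OF x(1)] \<epsilon> by auto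
    then show ?thesis by blast
  qed
  ultimately show "\<exists>d>0. \<forall>t\<in>ball t0 d. \<forall>w\<in>ball (w0 - h t0 x0) d. \<exists>x\<in>cball
      x0 e. w \<in> {v. v + h t x \<in> M t x}"
    by blast
qed

text \<open>The norm inequality in the definition of full stability encodes strong monotonicity in \<open>v\<close>.\<close>

lemma norm_diff_scaled_le_iff:
  fixes a b :: "'a::real_inner"
  assumes "0 < \<kappa>"
  shows "norm (a - (2 * \<kappa>) *\<^sub>R b) \<le> norm a \<longleftrightarrow> \<kappa> * (norm b)\<^sup>2 \<le> inner a b"
proof -
  have "(norm (a - (2 * \<kappa>) *\<^sub>R b))\<^sup>2 = (norm a)\<^sup>2 - 2 * (2 * \<kappa>) * inner a b + (2 *
      \<kappa>)\<^sup>2 * (norm b)\<^sup>2"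
    unfolding power2_norm_eq_inner
    by (simp add: inner_diff_left inner_diff_right inner_commute[of b a] power2_eq_square algebra_simps)
  then have "(norm (a - (2 * \<kappa>) *\<^sub>R b))\<^sup>2 = (norm a)\<^sup>2 - 4 * \<kappa> * (inner a b -
      \<kappa> * (norm b)\<^sup>2)"
    by (simp add: power2_eq_square power2_norm_eq_inner[symmetric] algebra_simps)
  moreover have "norm (a - (2 * \<kappa>) *\<^sub>R b) \<le> norm a \<longleftrightarrow> (norm (a - (2 * \<kappa>)
      *\<^sub>R b))\<^sup>2 \<le> (norm a)\<^sup>2"
    by (rule power_mono_iff[symmetric]) auto
  ultimately show ?thesis using assms by (simp add: zero_le_mult_iff)
qed

section \<open>Independent families of vectors\<close>

text \<open>Independence of an indexed family: repeated vectors count as dependent.\<close>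

definition independent_family :: "'i set \<Rightarrow> ('i \<Rightarrow> 'a::real_vector) \<Rightarrow> bool" where
  "independent_family J g \<longleftrightarrow> (\<forall>c. (\<Sum>j\<in>J. c j *\<^sub>R g j) = 0 \<longrightarrow>
      (\<forall>j\<in>J. c j = 0))"

lemma independent_family_iff:
  assumes "finite J"
  shows "independent_family J g \<longleftrightarrow> inj_on g J \<and> independent (g ` J)"
proof
  assume ind: "independent_family J g"
  have inj: "inj_on g J"
  proof (rule inj_onI, rule ccontr)
    fix i j assume ij: "i \<in> J" "j \<in> J" "g i = g j" "i \<noteq> j"
    define c :: "'a \<Rightarrow> real" where "c k = (if k = i then 1 else 0) - (if k = j then 1 else 0)" for k
    have "(\<Sum>k\<in>J. c k *\<^sub>R g k) = (\<Sum>k\<in>J. (if k = i then g k else 0)) - (\<Sum>k\<in>J. (if k =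
        j then g k else 0))"
      unfolding sum_subtractf[symmetric] by (intro sum.cong) (auto simp: c_def)
    also have "\<dots> = 0" using ij assms by simp
    finally have "c i = 0" using ind ij unfolding independent_family_def by blast
    then show False using ij by (simp add: c_def)
  qed
  moreover have "independent (g ` J)"
  proof
    assume "dependent (g ` J)"
    then obtain u where u: "\<exists>v\<in>g ` J. u v \<noteq> 0" "(\<Sum>v\<in>g ` J. u v *\<^sub>R v) = 0"
      using dependent_finite[of "g ` J"] assms by auto
    then have "(\<Sum>j\<in>J. (u (g j)) *\<^sub>R g j) = 0" by (simp add: sum.reindex[OF inj])
    then have "\<forall>j\<in>J. u (g j) = 0"
      using ind unfolding independent_family_def by (auto dest: spec[of _ "\<lambda>j. u (g j)"])
    then show False using u by auto
  qed
  ultimately show "inj_on g J \<and> independent (g ` J)" by simp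
next
  assume *: "inj_on g J \<and> independent (g ` J)"
  show "independent_family J g" unfolding independent_family_def
  proof (intro allI impI ballI)
    fix c j assume c: "(\<Sum>j\<in>J. c j *\<^sub>R g j) = 0" and j: "j \<in> J"
    have "(\<Sum>v\<in>g ` J. c (the_inv_into J g v) *\<^sub>R v) = (\<Sum>j\<in>J. c j *\<^sub>R g j)"
      using * by (simp add: sum.reindex the_inv_into_f_f)
    then have "\<forall>v\<in>g ` J. c (the_inv_into J g v) = 0"
      using * dependent_finite[of "g ` J"] assms c by auto
    then show "c j = 0" using * j by (simp add: the_inv_into_f_f)
  qed
qed

text \<open>CRCQ is a condition on ranks, the arguments need independence.\<close>

lemma independent_family_iff_rank:
  fixes g :: "'i \<Rightarrow> 'a::euclidean_space"
  assumes "finite J"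
  shows "independent_family J g \<longleftrightarrow> dim (g ` J) = card J"
proof
  assume "independent_family J g"
  then show "dim (g ` J) = card J"
    using assms by (simp add: independent_family_iff dim_eq_card_independent card_image)
next
  assume d: "dim (g ` J) = card J"
  have "dim (g ` J) \<le> card (g ` J)" using assms by (intro dim_le_card') auto
  moreover have "card (g ` J) \<le> card J" using assms by (rule card_image_le)
  ultimately have c: "card (g ` J) = card J" "dim (g ` J) = card (g ` J)" using d by auto
  have "inj_on g J" using assms c(1) by (rule eq_card_imp_inj_on)
  moreover have "independent (g ` J)"
    by (rule card_le_dim_spanning[of _ "g ` J"]) (use assms c(2) in \<open>auto intro: span_base\<close>)
  ultimately show "independent_family J g" using assms by (simp add: independent_family_iff)
qed

text \<open>The dual vector \<open>h j\<close> is the component of \<open>g j\<close> orthogonal to the span of the other vectors,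
  rescaled.\<close>

lemma independent_family_dual:
  fixes g :: "'i \<Rightarrow> 'a::euclidean_space"
  assumes "finite J" "independent_family J g"
  obtains h where "\<And>i j. i \<in> J \<Longrightarrow> j \<in> J \<Longrightarrow> inner (g i) (h j) = (if i = j
      then 1 else 0)"
proof -
  have inj: "inj_on g J" and ind: "independent (g ` J)" using assms by (auto simp: independent_family_iff)
  have "\<exists>h. \<forall>i\<in>J. inner (g i) h = (if i = j then 1 else 0)" if j: "j \<in> J" for j
  proof -
    have eq: "g ` J - {g j} = g ` (J - {j})" using inj j by (auto simp: inj_on_def)
    have notin: "g j \<notin> span (g ` (J - {j}))" using ind j eq unfolding dependent_def by auto
    obtain y z where y: "y \<in> span (g ` (J - {j}))" and z: "\<And>w. w \<in> span (g ` (J - {j}))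
        \<Longrightarrow> orthogonal z w"
      and gj: "g j = y + z" using orthogonal_subspace_decomp_exists[of "g ` (J - {j})" "g j"] by metis
    have "z \<noteq> 0" using gj y notin by auto
    have "inner (g j) z = inner z z" using gj z[OF y] by (simp add: inner_add_left orthogonal_def inner_commute[of y])
    moreover have "inner (g i) z = 0" if "i \<in> J" "i \<noteq> j" for i
      using z[of "g i"] that by (simp add: span_base orthogonal_def inner_commute)
    ultimately show ?thesis using \<open>z \<noteq> 0\<close>
      by (intro exI[of _ "z /\<^sub>R (inner z z)"]) auto
  qed
  then obtain h where "\<And>j i. j \<in> J \<Longrightarrow> i \<in> J \<Longrightarrow> inner (g i) (h j) = (if i =
      j then 1 else 0)" by metis
  then show ?thesis using that by metis
qed

text \<open>Pairing with a dual family recovers the coefficients. For a nearby family the same pairing has an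
  error of at most half the sum of the coefficients, which moves to the left-hand side.\<close>

lemma independent_family_coefficient_bound:
  fixes g :: "'i \<Rightarrow> 'a::euclidean_space"
  assumes fin: "finite J" and ind: "independent_family J g"
  obtains \<eta> M where "0 < \<eta>" "0 \<le> M"
    "\<And>g' c. \<forall>j\<in>J. norm (g' j - g j) \<le> \<eta>
       \<Longrightarrow> (\<Sum>j\<in>J. \<bar>c j\<bar>) \<le> M * norm (\<Sum>j\<in>J. c j *\<^sub>R g' j)"
proof -
  obtain h where h: "\<And>i j. i \<in> J \<Longrightarrow> j \<in> J \<Longrightarrow> inner (g i) (h j) = (if i = j
      then 1 else 0)"
    using independent_family_dual[OF assms] by metis
  define D where "D = (\<Sum>j\<in>J. norm (h j))"
  have "D \<ge> 0" by (auto simp: D_def intro: sum_nonneg)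
  define \<eta> where "\<eta> = 1 / (2 * (D + 1))"
  have \<eta>: "\<eta> > 0" using \<open>D \<ge> 0\<close> by (simp add: \<eta>_def)
  have D\<eta>: "D * \<eta> \<le> 1 / 2" using \<open>D \<ge> 0\<close> by (simp add: \<eta>_def divide_simps)
  show ?thesis
  proof (rule that[of \<eta> "2 * D"])
    fix g' :: "'i \<Rightarrow> 'a" and c :: "'i \<Rightarrow> real" assume g': "\<forall>j\<in>J. norm (g' j - g j) \<le> \<eta>"
    define s where "s = (\<Sum>j\<in>J. \<bar>c j\<bar>)"
    define N where "N = norm (\<Sum>j\<in>J. c j *\<^sub>R g' j)"
    have "norm (\<Sum>j\<in>J. c j *\<^sub>R g j) = norm ((\<Sum>j\<in>J. c j *\<^sub>R g' j) - (\<Sum>j\<in>J. c j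
        *\<^sub>R (g' j - g j)))"
      by (simp add: sum_subtractf[symmetric] scaleR_diff_right)
    also have "\<dots> \<le> N + norm (\<Sum>j\<in>J. c j *\<^sub>R (g' j - g j))" unfolding N_def by (rule norm_triangle_ineq4)
    also have "norm (\<Sum>j\<in>J. c j *\<^sub>R (g' j - g j)) \<le> (\<Sum>j\<in>J. \<bar>c j\<bar> * \<eta>)"
      by (rule sum_norm_le) (use g' in \<open>auto intro: mult_left_mono\<close>)
    also have "\<dots> = s * \<eta>" by (simp add: s_def sum_distrib_right)
    finally have n: "norm (\<Sum>j\<in>J. c j *\<^sub>R g j) \<le> N + s * \<eta>" by simp
    have cj: "\<bar>c j\<bar> \<le> norm (h j) * (N + s * \<eta>)" if j: "j \<in> J" for j
    proof -
      have "inner (\<Sum>i\<in>J. c i *\<^sub>R g i) (h j) = (\<Sum>i\<in>J. if i = j then c i else 0)"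
        unfolding inner_sum_left by (intro sum.cong) (auto simp: h j)
      also have "\<dots> = c j" using fin j by simp
      finally have "\<bar>c j\<bar> = \<bar>inner (\<Sum>i\<in>J. c i *\<^sub>R g i) (h j)\<bar>" by simp
      also have "\<dots> \<le> norm (\<Sum>i\<in>J. c i *\<^sub>R g i) * norm (h j)" by (rule Cauchy_Schwarz_ineq2)
      also have "\<dots> \<le> (N + s * \<eta>) * norm (h j)" by (rule mult_right_mono[OF n]) simp
      finally show ?thesis by (simp add: mult.commute)
    qed
    have "s \<le> (\<Sum>j\<in>J. norm (h j) * (N + s * \<eta>))" using sum_mono[OF cj, of J] by (simp only: s_def)
    also have "\<dots> = D * (N + s * \<eta>)" by (simp only: D_def sum_distrib_right)
    also have "\<dots> = D * N + (D * \<eta>) * s" by (simp add: algebra_simps)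
    also have "\<dots> \<le> D * N + 1/2 * s"
      by (intro add_left_mono mult_right_mono D\<eta>) (auto simp: s_def intro: sum_nonneg)
    finally show "(\<Sum>j\<in>J. \<bar>c j\<bar>) \<le> 2 * D * norm (\<Sum>j\<in>J. c j *\<^sub>R g' j)"
      unfolding s_def[symmetric] N_def[symmetric] by simp
  qed (use \<eta> \<open>D \<ge> 0\<close> in auto)
qed

text \<open>From a dependent family one subtracts the multiple of a linear relation at which the first coefficient
  vanishes, and repeats.\<close>

lemma conic_caratheodory:
  fixes g :: "'i \<Rightarrow> 'a::real_vector"
  assumes fin: "finite I" and nonneg: "\<And>i. i \<in> I \<Longrightarrow> 0 \<le> lam i"
  obtains J mu where "J \<subseteq> I" "independent_family J g" "\<And>i. i \<in> J \<Longrightarrow> 0 \<le> mu i"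
    "(\<Sum>i\<in>J. mu i *\<^sub>R g i) = (\<Sum>i\<in>I. lam i *\<^sub>R g i)"
proof -
  have "\<exists>J mu. J \<subseteq> I \<and> independent_family J g \<and> (\<forall>i\<in>J. (0::real) \<le> mu i) \<and>
      (\<Sum>i\<in>J. mu i *\<^sub>R g i) = (\<Sum>i\<in>I. lam i *\<^sub>R g i)"
    using assms
  proof (induction "card I" arbitrary: I lam rule: less_induct)
    case less
    show ?case
    proof (cases "independent_family I g")
      case True
      then show ?thesis using less.prems by blast
    next
      case False
      then obtain c0 k where c0: "(\<Sum>j\<in>I. c0 j *\<^sub>R g j) = 0" "k \<in> I" "c0 k \<noteq> 0"
        unfolding independent_family_def by blast
      obtain c where c: "(\<Sum>j\<in>I. c j *\<^sub>R g j) = 0" "c k > 0"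
      proof (cases "c0 k > 0")
        case True then show ?thesis using c0 that by blast
      next
        case neg: False
        show ?thesis by (rule that[of "\<lambda>j. - c0 j"]) (use c0 neg in \<open>auto simp: sum_negf\<close>)
      qed
      define P where "P = {j\<in>I. c j > 0}"
      have P: "finite P" "P \<noteq> {}" using less.prems(1) c0 c by (auto simp: P_def)
      define t where "t = Min ((\<lambda>j. lam j / c j) ` P)"
      have "t \<in> (\<lambda>j. lam j / c j) ` P" unfolding t_def using P by (intro Min_in) auto
      then obtain m where m: "m \<in> P" "t = lam m / c m" by blast
      have t: "t \<ge> 0" using m less.prems(2) by (auto simp: P_def)
      define mu where "mu j = lam j - t * c j" for j
      have mu0: "mu j \<ge> 0" if "j \<in> I" for j
      proof (cases "c j > 0")
        case True
        then have "t \<le> lam j / c j" unfolding t_def using P that by (intro Min_le) (auto simp: P_def)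
        then show ?thesis using True by (simp add: mu_def field_simps)
      next
        case False
        then have "t * c j \<le> 0" using t by (simp add: mult_nonneg_nonpos)
        then show ?thesis using less.prems(2)[OF that] by (simp add: mu_def)
      qed
      have mI: "m \<in> I" "mu m = 0" using m by (auto simp: P_def mu_def)
      have "(\<Sum>i\<in>I. mu i *\<^sub>R g i) = (\<Sum>i\<in>I. lam i *\<^sub>R g i) - t *\<^sub>R (\<Sum>i\<in>I.
          c i *\<^sub>R g i)"
        by (simp add: mu_def scaleR_diff_left sum_subtractf scaleR_sum_right)
      then have eq: "(\<Sum>i\<in>I - {m}. mu i *\<^sub>R g i) = (\<Sum>i\<in>I. lam i *\<^sub>R g i)"
        using c mI less.prems(1) by (simp add: sum.remove[of I m])
      have "card (I - {m}) < card I" using mI less.prems(1) by (intro psubset_card_mono) auto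
      from less.hyps[OF this, of mu] obtain J nu where "J \<subseteq> I - {m}" "independent_family J g"
        "\<forall>i\<in>J. (0::real) \<le> nu i" "(\<Sum>i\<in>J. nu i *\<^sub>R g i) = (\<Sum>i\<in>I - {m}. mu i *\<^sub>R g i)"
        using less.prems(1) mu0 by auto
      then show ?thesis using eq by (metis Diff_subset subset_trans)
    qed
  qed
  then show ?thesis using that by blast
qed

section \<open>The problem on a box around the reference point\<close>

text \<open>At a feasible point all complementarity products have the same sign, so their sum vanishes only
  termwise.\<close>

lemma multipliers_iff:
  assumes "x \<in> feasible_set \<phi> p"
  shows "lam \<in> multipliers f \<phi> x p q v \<longleftrightarrow>
    (\<forall>i. 0 \<le> lam $ i) \<and> v = f (x, p, q) + (\<Sum>i\<in>UNIV. lam $ i *\<^sub>R grad_x (\<phi> i) (x, p)) \<and>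
    (\<forall>i. lam $ i * \<phi> i (x, p) = 0)"
proof -
  have "inner lam (\<chi> i. \<phi> i (x, p)) = 0 \<longleftrightarrow> (\<forall>i. lam $ i * \<phi> i (x, p) = 0)"
      if "\<forall>i. 0 \<le> lam $ i"
  proof -
    have "\<And>i. lam $ i * \<phi> i (x, p) \<le> 0" using that assms by (simp add: feasible_set_def mult_nonneg_nonpos)
    then have "(\<Sum>i\<in>UNIV. - (lam $ i * \<phi> i (x, p))) = 0 \<longleftrightarrow> (\<forall>i. lam $ i *
        \<phi> i (x, p) = 0)"
      by (subst sum_nonneg_eq_0_iff) auto
    then show ?thesis by (simp add: inner_vec_def sum_negf)
  qed
  then show ?thesis unfolding multipliers_def lagrangian_def by auto
qed

text \<open>A box of radius \<open>r\<close> around the reference point on which one constant \<open>K\<close> serves for all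
  estimates of first order, together with the strict derivatives at the reference point. The quadratic lower
  bound \<open>phi_lower\<close> is what makes \<open>C(p)\<close> prox-regular.\<close>

locale parametric_system =
  fixes f :: "(real^'n) \<times> (real^'l) \<times> (real^'m) \<Rightarrow> real^'n"
    and \<phi> :: "'s::finite \<Rightarrow> (real^'n) \<times> (real^'l) \<Rightarrow> real"
    and xb :: "real^'n" and pb :: "real^'l" and qb :: "real^'m"
    and A :: "real^'n \<Rightarrow> real^'n" and H :: "'s \<Rightarrow> real^'n \<Rightarrow> real^'n"
    and r K :: real
  assumes r_pos: "0 < r" and K_nonneg: "0 \<le> K"
    and f_strict: "partial_strict_derivative f A xb (pb, qb)"
    and phi_strict: "partial_strict_derivative (\<phi> i) (\<lambda>h. inner (grad_x (\<phi> i) (xb, pb)) h) xb pb"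
    and grad_strict: "partial_strict_derivative (grad_x (\<phi> i)) (H i) xb pb"
    and phi_deriv: "\<lbrakk>x \<in> ball xb r; p \<in> ball pb r\<rbrakk> \<Longrightarrow>
        ((\<lambda>y. \<phi> i (y, p)) has_derivative (\<lambda>h. inner (grad_x (\<phi> i) (x, p)) h)) (at x)"
    and f_lip: "\<lbrakk>x \<in> ball xb r; y \<in> ball xb r; p \<in> ball pb r; p' \<in> ball pb r; q \<in> ball qb
        r; q' \<in> ball qb r\<rbrakk> \<Longrightarrow>
        norm (f (x, p, q) - f (y, p', q')) \<le> K * (norm (x - y) + norm (p - p') + norm (q - q'))"
    and phi_lip: "\<lbrakk>x \<in> ball xb r; y \<in> ball xb r; p \<in> ball pb r; p' \<in> ball pb r\<rbrakk> \<Longrightarrow>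
        \<bar>\<phi> i (x, p) - \<phi> i (y, p')\<bar> \<le> K * (norm (x - y) + norm (p - p'))"
    and grad_lip: "\<lbrakk>x \<in> ball xb r; y \<in> ball xb r; p \<in> ball pb r; p' \<in> ball pb r\<rbrakk> \<Longrightarrow>
        norm (grad_x (\<phi> i) (x, p) - grad_x (\<phi> i) (y, p')) \<le> K * (norm (x - y) + norm (p - p'))"
    and phi_lower: "\<lbrakk>x \<in> ball xb r; y \<in> ball xb r; p \<in> ball pb r\<rbrakk> \<Longrightarrow>
        \<phi> i (x, p) + inner (grad_x (\<phi> i) (x, p)) (y - x) - K * (norm (y - x))\<^sup>2 \<le> \<phi> i (y, p)"
    and base_feasible: "xb \<in> feasible_set \<phi> pb"
    and inactive: "\<lbrakk>i \<notin> active_set \<phi> xb pb; x \<in> ball xb r; p \<in> ball pb r\<rbrakk>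
        \<Longrightarrow> \<phi> i (x, p) < 0"

text \<open>Finitely many local estimates that survive shrinking the radius and enlarging the constant hold with a
  common radius and constant.\<close>

lemma uniform_constants:
  fixes P :: "'s::finite \<Rightarrow> real \<Rightarrow> real \<Rightarrow> bool"
  assumes ex: "\<And>i. \<exists>r>0. \<exists>K\<ge>0. P i r K"
    and mono: "\<And>i r r' K K'. \<lbrakk>P i r K; 0 < r'; r' \<le> r; K \<le> K'\<rbrakk> \<Longrightarrow> P i r' K'"
  shows "\<exists>r>0. \<exists>K\<ge>0. \<forall>i. P i r K"
proof -
  obtain r K where rK: "\<And>i. 0 < r i" "\<And>i. 0 \<le> K i" "\<And>i. P i (r i) (K i)" using ex by metis
  have "0 < Min (range r)" using rK(1) by simp
  moreover have "Min (range r) \<le> r i" for i by simp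
  moreover have "K i \<le> (\<Sum>i\<in>UNIV. K i)" for i using rK(2) by (intro member_le_sum) auto
  moreover have "0 \<le> (\<Sum>i\<in>UNIV. K i)" using rK(2) by (intro sum_nonneg) auto
  ultimately show ?thesis using mono rK(3) by blast
qed

lemma parametric_system_exists:
  fixes \<phi> :: "'s::finite \<Rightarrow> (real^'n) \<times> (real^'l) \<Rightarrow> real"
    and f :: "(real^'n) \<times> (real^'l) \<times> (real^'m) \<Rightarrow> real^'n"
  assumes f: "partial_strict_derivative f A xb (pb, qb)"
    and phi: "\<And>i. partial_strict_derivative (\<phi> i) (\<lambda>h. inner (grad_x (\<phi> i) (xb, pb)) h) xb pb"
    and grad: "\<And>i. partial_strict_derivative (grad_x (\<phi> i)) (H i) xb pb"
    and der: "\<And>i. \<exists>r>0. \<forall>x\<in>ball xb r. \<forall>p\<in>ball pb r.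
        ((\<lambda>y. \<phi> i (y, p)) has_derivative (\<lambda>h. inner (grad_x (\<phi> i) (x, p)) h)) (at x)"
    and feas: "xb \<in> feasible_set \<phi> pb" and "0 < R"
  obtains r K where "r \<le> R" "parametric_system f \<phi> xb pb qb A H r K"
proof -
  define P where "P i r K \<longleftrightarrow>
      (\<forall>x\<in>ball xb r. \<forall>p\<in>ball pb r. ((\<lambda>y. \<phi> i (y, p)) has_derivative (\<lambda>h.
          inner (grad_x (\<phi> i) (x, p)) h)) (at x)) \<and>
      (\<forall>x\<in>ball xb r. \<forall>y\<in>ball xb r. \<forall>p\<in>ball pb r. \<forall>p'\<in>ball pb r.
         \<bar>\<phi> i (x, p) - \<phi> i (y, p')\<bar> \<le> K * (norm (x - y) + norm (p - p'))) \<and>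
      (\<forall>x\<in>ball xb r. \<forall>y\<in>ball xb r. \<forall>p\<in>ball pb r. \<forall>p'\<in>ball pb r.
         norm (grad_x (\<phi> i) (x, p) - grad_x (\<phi> i) (y, p')) \<le> K * (norm (x - y) + norm (p - p'))) \<and>
      (\<forall>x\<in>ball xb r. \<forall>y\<in>ball xb r. \<forall>p\<in>ball pb r.
         \<phi> i (x, p) + inner (grad_x (\<phi> i) (x, p)) (y - x) - K * (norm (y - x))\<^sup>2 \<le> \<phi> i (y, p)) \<and>
      (i \<notin> active_set \<phi> xb pb \<longrightarrow> (\<forall>x\<in>ball xb r. \<forall>p\<in>ball pb r.
          \<phi> i (x, p) < 0))" for i r K
  have "\<exists>r>0. \<exists>K\<ge>0. \<forall>i. P i r K"
  proof (rule uniform_constants)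
    fix i r r' K K' assume P: "P i r K" and r': "0 < r'" "r' \<le> r" "K \<le> K'"
    have sub: "ball a r' \<subseteq> ball a r" for a :: "'z::metric_space" using r' by auto
    have "z \<le> K * t \<Longrightarrow> 0 \<le> t \<Longrightarrow> z \<le> K' * t" for z t :: real
      using mult_right_mono[OF r'(3), of t] by linarith
    moreover have "z - K * t \<le> w \<Longrightarrow> 0 \<le> t \<Longrightarrow> z - K' * t \<le> w" for z t w :: real
      using mult_right_mono[OF r'(3), of t] by linarith
    ultimately show "P i r' K'" using P sub[of xb] sub[of pb] unfolding P_def
      by (intro conjI) (blast | (intro ballI impI, simp add: subset_eq))+
  next
    fix i
    obtain r1 where r1: "r1 > 0" "\<And>x p. x \<in> ball xb r1 \<Longrightarrow> p \<in> ball pb r1 \<Longrightarrow>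
        ((\<lambda>y. \<phi> i (y, p)) has_derivative (\<lambda>h. inner (grad_x (\<phi> i) (x, p)) h)) (at x)" using der by blast
    obtain r2 K2 where r2: "r2 > 0" "K2 \<ge> 0" "\<And>x y p p'. \<lbrakk>x\<in>ball xb r2; y\<in>ball xb r2;
        p\<in>ball pb r2; p'\<in>ball pb r2\<rbrakk> \<Longrightarrow>
         norm (\<phi> i (x, p) - \<phi> i (y, p')) \<le> K2 * (norm (x - y) + norm (p - p'))"
      using partial_strict_derivative_lipschitz[OF phi[of i]] by metis
    obtain r3 K3 where r3: "r3 > 0" "K3 \<ge> 0" "\<And>x y p p'. \<lbrakk>x\<in>ball xb r3; y\<in>ball xb r3;
        p\<in>ball pb r3; p'\<in>ball pb r3\<rbrakk> \<Longrightarrow>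
         norm (grad_x (\<phi> i) (x, p) - grad_x (\<phi> i) (y, p')) \<le> K3 * (norm (x - y) + norm (p - p'))"
      using partial_strict_derivative_lipschitz[OF grad[of i]] by metis
    obtain r4 where r4: "r4 > 0" "\<And>x y p. x \<in> ball xb r4 \<Longrightarrow> y \<in> ball xb r4
        \<Longrightarrow> p \<in> ball pb r4 \<Longrightarrow>
      \<bar>\<phi> i (x, p) - \<phi> i (y, p) - inner (grad_x (\<phi> i) (x, p) + grad_x (\<phi> i) (y, p)) (x - y) /
          2\<bar> \<le> 1 * (norm (x - y))\<^sup>2"
      using trapezoid_estimate[OF r1 grad, of 1] by (metis zero_less_one)
    \<comment> \<open>Moving \<open>x\<close> and \<open>p\<close> by at most \<open>r5\<close> each cannot raise an inactive constraint to zero.\<close>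
    define r5 where "r5 = (if i \<in> active_set \<phi> xb pb then 1 else - \<phi> i (xb, pb) / (2 * K2 + 1))"
    have neg: "\<phi> i (xb, pb) < 0" if "i \<notin> active_set \<phi> xb pb"
      using that feas by (auto simp: active_set_def feasible_set_def less_le)
    have r5: "r5 > 0" using neg r2 by (auto simp: r5_def divide_neg_pos)
    define r where "r = Min {r1, r2, r3, r4, r5}"
    have r: "r > 0" "r \<le> r1" "r \<le> r2" "r \<le> r3" "r \<le> r4" "r \<le> r5" using r1 r2 r3 r4 r5 by (auto simp: r_def)
    define K where "K = K2 + K3 + 1"
    have K: "K \<ge> 0" "K2 \<le> K" "K3 \<le> K" "K3 / 2 + 1 \<le> K" using r2(2) r3(2) by (auto simp: K_def)
    have "P i r K" unfolding P_def
    proof (intro conjI ballI impI)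
      fix x p assume "x \<in> ball xb r" "p \<in> ball pb r"
      then show "((\<lambda>y. \<phi> i (y, p)) has_derivative (\<lambda>h. inner (grad_x (\<phi> i) (x, p)) h)) (at x)"
        using r by (intro r1) auto
    next
      fix x y p p' assume *: "x \<in> ball xb r" "y \<in> ball xb r" "p \<in> ball pb r" "p' \<in> ball pb r"
      have "norm (\<phi> i (x, p) - \<phi> i (y, p')) \<le> K2 * (norm (x - y) + norm (p - p'))" using * r by (intro r2) auto
      also have "\<dots> \<le> K * (norm (x - y) + norm (p - p'))" using K by (intro mult_right_mono) auto
      finally show "\<bar>\<phi> i (x, p) - \<phi> i (y, p')\<bar> \<le> K * (norm (x - y) + norm (p - p'))" by simp
      have "norm (grad_x (\<phi> i) (x, p) - grad_x (\<phi> i) (y, p')) \<le> K3 * (norm (x - y) + norm (p - p'))"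
          using * r by (intro r3) auto
      also have "\<dots> \<le> K * (norm (x - y) + norm (p - p'))" using K by (intro mult_right_mono) auto
      finally show "norm (grad_x (\<phi> i) (x, p) - grad_x (\<phi> i) (y, p')) \<le> K * (norm (x - y) + norm (p - p'))" .
    next
      fix x y p assume *: "x \<in> ball xb r" "y \<in> ball xb r" "p \<in> ball pb r"
      let ?G = "grad_x (\<phi> i)"
      have t: "\<bar>\<phi> i (y, p) - \<phi> i (x, p) - inner (?G (y, p) + ?G (x, p)) (y - x) / 2\<bar> \<le> (norm
          (y - x))\<^sup>2"
        using r4(2)[of y x p] * r by auto
      have "norm (?G (y, p) - ?G (x, p)) \<le> K3 * norm (y - x)" using r3(3)[of y x p p] * r by auto
      then have "\<bar>inner (?G (y, p) - ?G (x, p)) (y - x)\<bar> \<le> K3 * norm (y - x) * norm (y - x)"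
        by (intro order_trans[OF Cauchy_Schwarz_ineq2] mult_right_mono) auto
      moreover have "inner (?G (y, p) + ?G (x, p)) (y - x) / 2 = inner (?G (x, p)) (y - x) + inner (?G (y, p) - ?G
          (x, p)) (y - x) / 2"
        by (simp add: inner_add_left inner_diff_left field_simps)
      moreover have n2: "K3 * norm (y - x) * norm (y - x) = K3 * (norm (y - x))\<^sup>2"
          "(K3 / 2 + 1) * (norm (y - x))\<^sup>2 = K3 * (norm (y - x))\<^sup>2 / 2 + (norm (y - x))\<^sup>2"
        by (simp_all add: power2_eq_square algebra_simps)
      moreover have "(K3 / 2 + 1) * (norm (y - x))\<^sup>2 \<le> K * (norm (y - x))\<^sup>2" using K by (intro
          mult_right_mono) auto
      ultimately show "\<phi> i (x, p) + inner (?G (x, p)) (y - x) - K * (norm (y - x))\<^sup>2 \<le> \<phi> i (y, p)"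
        using t n2 unfolding abs_le_iff by linarith
    next
      fix x p assume i: "i \<notin> active_set \<phi> xb pb" and *: "x \<in> ball xb r" "p \<in> ball pb r"
      have "norm (\<phi> i (x, p) - \<phi> i (xb, pb)) \<le> K2 * (norm (x - xb) + norm (p - pb))" using * r by (intro r2) auto
      also have "\<dots> \<le> K2 * (r5 + r5)" using * r r2(2) by (intro mult_left_mono) (auto simp: dist_norm norm_minus_commute)
      also have "\<dots> < (2 * K2 + 1) * r5" using r5 by (simp add: algebra_simps)
      also have "\<dots> = - \<phi> i (xb, pb)" using i r2(2) by (simp add: r5_def)
      finally show "\<phi> i (x, p) < 0" by simp
    qed
    then show "\<exists>r>0. \<exists>K\<ge>0. P i r K" using r K by blast
  qed
  then obtain r K where rK: "r > 0" "K \<ge> 0" "\<And>i. P i r K" by blast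
  obtain r0 K0 where r0: "r0 > 0" "K0 \<ge> 0" "\<And>x y u w. \<lbrakk>x\<in>ball xb r0; y\<in>ball xb r0;
      u\<in>ball (pb, qb) r0; w\<in>ball (pb, qb) r0\<rbrakk> \<Longrightarrow>
         norm (f (x, u) - f (y, w)) \<le> K0 * (norm (x - y) + norm (u - w))"
    using partial_strict_derivative_lipschitz[OF f] by metis
  define r' where "r' = Min {r, r0 / 2, R}"
  have r': "0 < r'" "r' \<le> r" "r' \<le> r0 / 2" "r' \<le> R" using rK r0 \<open>0 < R\<close> by (auto simp: r'_def)
  define K' where "K' = K + K0"
  have sub: "ball a r' \<subseteq> ball a r" for a :: "'z::metric_space" using r' by auto
  have K': "K \<le> K'" "K0 \<le> K'" "0 \<le> K'" using rK r0 by (auto simp: K'_def)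
  have up: "z \<le> K * t \<Longrightarrow> 0 \<le> t \<Longrightarrow> z \<le> K' * t" for z t :: real
    using mult_right_mono[OF K'(1), of t] by linarith
  have "parametric_system f \<phi> xb pb qb A H r' K'"
  proof
    fix x y p p' q q'
    assume *: "x \<in> ball xb r'" "y \<in> ball xb r'" "p \<in> ball pb r'" "p' \<in> ball pb r'" "q \<in> ball qb
        r'" "q' \<in> ball qb r'"
    have inr: "(p, q) \<in> ball (pb, qb) r0" if "p \<in> ball pb r'" "q \<in> ball qb r'" for p q
    proof -
      have "norm (pb - p, qb - q) \<le> norm (pb - p) + norm (qb - q)" by (rule norm_Pair_le)
      then show ?thesis using that r' by (simp add: dist_norm)
    qed
    have "norm (f (x, p, q) - f (y, p', q')) \<le> K0 * (norm (x - y) + norm ((p, q) - (p', q')))"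
      using * r' inr by (intro r0) auto
    also have "\<dots> \<le> K' * (norm (x - y) + (norm (p - p') + norm (q - q')))"
      using K' r0(2) norm_Pair_le[of "p - p'" "q - q'"] by (intro mult_mono add_left_mono) auto
    finally show "norm (f (x, p, q) - f (y, p', q')) \<le> K' * (norm (x - y) + norm (p - p') + norm (q - q'))"
      by (simp add: add.assoc)
  next
    fix i x y p p' assume *: "x \<in> ball xb r'" "y \<in> ball xb r'" "p \<in> ball pb r'" "p' \<in> ball pb r'"
    then have **: "x \<in> ball xb r" "y \<in> ball xb r" "p \<in> ball pb r" "p' \<in> ball pb r" using sub by blast+
    show "\<bar>\<phi> i (x, p) - \<phi> i (y, p')\<bar> \<le> K' * (norm (x - y) + norm (p - p'))"
      using rK(3)[of i] ** unfolding P_def by (intro up) auto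
    show "norm (grad_x (\<phi> i) (x, p) - grad_x (\<phi> i) (y, p')) \<le> K' * (norm (x - y) + norm (p - p'))"
      using rK(3)[of i] ** unfolding P_def by (intro up) auto
  next
    fix i x y p assume *: "x \<in> ball xb r'" "y \<in> ball xb r'" "p \<in> ball pb r'"
    then have **: "x \<in> ball xb r" "y \<in> ball xb r" "p \<in> ball pb r" using sub by blast+
    have "\<phi> i (x, p) + inner (grad_x (\<phi> i) (x, p)) (y - x) - K * (norm (y - x))\<^sup>2 \<le> \<phi> i (y, p)"
      using rK(3)[of i] ** unfolding P_def by blast
    then show "\<phi> i (x, p) + inner (grad_x (\<phi> i) (x, p)) (y - x) - K' * (norm (y - x))\<^sup>2 \<le> \<phi> i (y, p)"
      using mult_right_mono[OF K'(1), of "(norm (y - x))\<^sup>2"] by simp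
  next
    fix i x p assume *: "x \<in> ball xb r'" "p \<in> ball pb r'"
    then have **: "x \<in> ball xb r" "p \<in> ball pb r" using sub by blast+
    show "((\<lambda>y. \<phi> i (y, p)) has_derivative (\<lambda>h. inner (grad_x (\<phi> i) (x, p)) h)) (at x)"
      using rK(3)[of i] ** unfolding P_def by blast
    show "\<phi> i (x, p) < 0" if "i \<notin> active_set \<phi> xb pb"
      using rK(3)[of i] ** that unfolding P_def by blast
  qed (use r' K' f phi grad feas in auto)
  then show ?thesis using that r' by blast
qed

context parametric_system
begin

lemma base_in_box [simp]: "xb \<in> ball xb r" "pb \<in> ball pb r" "qb \<in> ball qb r"
  using r_pos by auto

lemma active_subset_base: "x \<in> ball xb r \<Longrightarrow> p \<in> ball pb r \<Longrightarrow> \<phi> i (x, p) =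
    0 \<Longrightarrow> i \<in> active_set \<phi> xb pb"
  using inactive[of i x p] by fastforce

lemma box_tendsto:
  assumes lim: "X \<longlonglongrightarrow> x" "P \<longlonglongrightarrow> p" and x: "x \<in> ball xb r" and p: "p
      \<in> ball pb r"
  shows "(\<lambda>k. \<phi> i (X k, P k)) \<longlonglongrightarrow> \<phi> i (x, p)"
    and "(\<lambda>k. grad_x (\<phi> i) (X k, P k)) \<longlonglongrightarrow> grad_x (\<phi> i) (x, p)"
    and "\<lbrakk>Q \<longlonglongrightarrow> q; q \<in> ball qb r\<rbrakk> \<Longrightarrow> (\<lambda>k. f (X k, P
        k, Q k)) \<longlonglongrightarrow> f (x, p, q)"
proof -
  have evX: "\<forall>\<^sub>F k in sequentially. X k \<in> ball xb r" "\<forall>\<^sub>F k in sequentially. P k \<in> ball pb r"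
    using topological_tendstoD[OF lim(1) open_ball x] topological_tendstoD[OF lim(2) open_ball p] by auto
  have z: "(\<lambda>k. K * (norm (X k - x) + norm (P k - p))) \<longlonglongrightarrow> 0"
  proof -
    have "(\<lambda>k. K * (norm (X k - x) + norm (P k - p))) \<longlonglongrightarrow> K * (norm (x - x) + norm (p - p))"
      by (intro tendsto_intros lim)
    then show ?thesis by simp
  qed
  show "(\<lambda>k. \<phi> i (X k, P k)) \<longlonglongrightarrow> \<phi> i (x, p)"
  proof (rule LIM_zero_cancel, rule Lim_null_comparison[OF _ z])
    show "\<forall>\<^sub>F k in sequentially. norm (\<phi> i (X k, P k) - \<phi> i (x, p)) \<le> K * (norm (X k - x)
        + norm (P k - p))"
      using evX by eventually_elim (use phi_lip x p in auto)
  qed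
  show "(\<lambda>k. grad_x (\<phi> i) (X k, P k)) \<longlonglongrightarrow> grad_x (\<phi> i) (x, p)"
  proof (rule LIM_zero_cancel, rule Lim_null_comparison[OF _ z])
    show "\<forall>\<^sub>F k in sequentially. norm (grad_x (\<phi> i) (X k, P k) - grad_x (\<phi> i) (x, p)) \<le> K
        * (norm (X k - x) + norm (P k - p))"
      using evX by eventually_elim (use grad_lip x p in auto)
  qed
  show "(\<lambda>k. f (X k, P k, Q k)) \<longlonglongrightarrow> f (x, p, q)" if Q: "Q \<longlonglongrightarrow> q"
      "q \<in> ball qb r"
  proof (rule LIM_zero_cancel, rule Lim_null_comparison)
    have "\<forall>\<^sub>F k in sequentially. Q k \<in> ball qb r" using topological_tendstoD[OF Q(1) open_ball Q(2)] by auto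
    with evX show "\<forall>\<^sub>F k in sequentially. norm (f (X k, P k, Q k) - f (x, p, q))
        \<le> K * (norm (X k - x) + norm (P k - p) + norm (Q k - q))"
      by eventually_elim (use f_lip x p Q in auto)
    have "(\<lambda>k. K * (norm (X k - x) + norm (P k - p) + norm (Q k - q))) \<longlonglongrightarrow> K * (norm (x
        - x) + norm (p - p) + norm (q - q))"
      by (intro tendsto_intros lim Q)
    then show "(\<lambda>k. K * (norm (X k - x) + norm (P k - p) + norm (Q k - q))) \<longlonglongrightarrow> 0" by simp
  qed
qed

lemma multipliers_closed_graph:
  assumes lim: "X \<longlonglongrightarrow> x" "P \<longlonglongrightarrow> p" "Q \<longlonglongrightarrow> q" "V
      \<longlonglongrightarrow> v" "L \<longlonglongrightarrow> lam"
    and box: "x \<in> ball xb r" "p \<in> ball pb r" "q \<in> ball qb r"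
    and feas: "\<And>k. X k \<in> feasible_set \<phi> (P k)"
    and L: "\<And>k. L k \<in> multipliers f \<phi> (X k) (P k) (Q k) (V k)"
  shows "x \<in> feasible_set \<phi> p" "lam \<in> multipliers f \<phi> x p q v"
proof -
  note pt = box_tendsto(1)[OF lim(1,2) box(1,2)]
  note gt = box_tendsto(2)[OF lim(1,2) box(1,2)]
  note ft = box_tendsto(3)[OF lim(1,2) box(1,2) lim(3) box(3)]
  note Lt = tendsto_vec_nth[OF lim(5)]
  show x: "x \<in> feasible_set \<phi> p"
    unfolding feasible_set_def using feas
    by (auto simp: feasible_set_def intro!: LIMSEQ_le_const2[OF pt])
  have "\<And>i. 0 \<le> lam $ i"
    using L feas by (auto simp: multipliers_iff intro!: LIMSEQ_le_const[OF Lt])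
  moreover have "lam $ i * \<phi> i (x, p) = 0" for i
  proof -
    have "(\<lambda>k. L k $ i * \<phi> i (X k, P k)) \<longlonglongrightarrow> lam $ i * \<phi> i (x, p)" by (intro
        tendsto_mult Lt pt)
    moreover have "(\<lambda>k. L k $ i * \<phi> i (X k, P k)) = (\<lambda>k. 0)" using L feas by (auto simp:
        multipliers_iff fun_eq_iff simp del: mult_eq_0_iff)
    ultimately show ?thesis by (metis LIMSEQ_unique tendsto_const)
  qed
  moreover have "v = f (x, p, q) + (\<Sum>i\<in>UNIV. lam $ i *\<^sub>R grad_x (\<phi> i) (x, p))"
  proof (rule LIMSEQ_unique[OF lim(4)])
    have "(\<lambda>k. f (X k, P k, Q k) + (\<Sum>i\<in>UNIV. L k $ i *\<^sub>R grad_x (\<phi> i) (X k, P k)))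
        \<longlonglongrightarrow>
       f (x, p, q) + (\<Sum>i\<in>UNIV. lam $ i *\<^sub>R grad_x (\<phi> i) (x, p))"
      by (intro tendsto_intros ft gt Lt)
    moreover have "V = (\<lambda>k. f (X k, P k, Q k) + (\<Sum>i\<in>UNIV. L k $ i *\<^sub>R grad_x (\<phi> i) (X k, P k)))"
      using L feas by (auto simp: multipliers_iff fun_eq_iff)
    ultimately show "V \<longlonglongrightarrow> f (x, p, q) + (\<Sum>i\<in>UNIV. lam $ i *\<^sub>R grad_x (\<phi> i)
        (x, p))" by simp
  qed
  ultimately show "lam \<in> multipliers f \<phi> x p q v" using x by (simp add: multipliers_iff)
qed

definition lagrangian_quadratic :: "real^'s \<Rightarrow> real^'n \<Rightarrow> real" where
  "lagrangian_quadratic lam u = inner u (A u + (\<Sum>i\<in>UNIV. lam $ i *\<^sub>R H i u))"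

text \<open>The Jacobian of the Lagrangian is read off from the strict derivatives, and a positive multiplier at a
  feasible point belongs to an active constraint.\<close>

lemma GSSOSC_iff:
  "GSSOSC f \<phi> xb pb qb vb \<longleftrightarrow>
     (\<forall>lam\<in>multipliers f \<phi> xb pb qb vb. \<forall>u. u \<noteq> 0 \<and>
        (\<forall>i. lam $ i > 0 \<longrightarrow> inner (grad_x (\<phi> i) (xb, pb)) u = 0) \<longrightarrow>
            lagrangian_quadratic lam u > 0)"
proof -
  have jac: "jac_x (lagrangian f \<phi> lam) (xb, pb, qb) *v u = A u + (\<Sum>i\<in>UNIV. lam $ i *\<^sub>R H i u)" for lam u
  proof -
    have d: "((\<lambda>x. lagrangian f \<phi> lam (x, pb, qb)) has_derivative (\<lambda>u. A u + (\<Sum>i\<in>UNIV.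
        lam $ i *\<^sub>R H i u))) (at xb)"
      unfolding lagrangian_def split
      by (intro derivative_intros partial_strict_derivative_imp_has_derivative[OF f_strict]
          partial_strict_derivative_imp_has_derivative[OF grad_strict])
    then have "(\<lambda>x. lagrangian f \<phi> lam (x, pb, qb)) differentiable (at xb)" by (rule differentiableI)
    then have "((\<lambda>x. lagrangian f \<phi> lam (x, pb, qb)) has_derivative (\<lambda>h. jac_x (lagrangian f
        \<phi> lam) (xb, pb, qb) *v h)) (at xb)"
      by (simp add: jacobian_works jac_x_def)
    from has_derivative_unique[OF this d] show ?thesis by (simp add: fun_eq_iff)
  qed
  have "i \<in> strongly_active_set \<phi> xb pb lam \<longleftrightarrow> lam $ i > 0" if "lam \<in> multipliers f
      \<phi> xb pb qb vb" for lam i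
    using that base_feasible by (auto simp: multipliers_iff strongly_active_set_def active_set_def) (metis less_irrefl)
  then show ?thesis unfolding GSSOSC_def jac lagrangian_quadratic_def by auto
qed

lemma difference_quotients_tendsto:
  assumes lim: "X1 \<longlonglongrightarrow> xb" "X2 \<longlonglongrightarrow> xb" "P1 \<longlonglongrightarrow> pb"
      "P2 \<longlonglongrightarrow> pb"
    and s: "\<And>k. 0 < s k" and u: "(\<lambda>k. (X1 k - X2 k) /\<^sub>R s k) \<longlonglongrightarrow> u"
    and P: "(\<lambda>k. norm (P1 k - P2 k) / s k) \<longlonglongrightarrow> 0"
  shows "(\<lambda>k. (\<phi> i (X1 k, P1 k) - \<phi> i (X2 k, P2 k)) / s k) \<longlonglongrightarrow> inner (grad_x
      (\<phi> i) (xb, pb)) u"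
    and "(\<lambda>k. (grad_x (\<phi> i) (X1 k, P1 k) - grad_x (\<phi> i) (X2 k, P2 k)) /\<^sub>R s k)
        \<longlonglongrightarrow> H i u"
    and "\<lbrakk>Q1 \<longlonglongrightarrow> qb; Q2 \<longlonglongrightarrow> qb; (\<lambda>k. norm (Q1 k - Q2 k) /
        s k) \<longlonglongrightarrow> 0\<rbrakk> \<Longrightarrow>
      (\<lambda>k. (f (X1 k, P1 k, Q1 k) - f (X2 k, P2 k, Q2 k)) /\<^sub>R s k) \<longlonglongrightarrow> A u"
proof -
  show "(\<lambda>k. (\<phi> i (X1 k, P1 k) - \<phi> i (X2 k, P2 k)) / s k) \<longlonglongrightarrow> inner (grad_x
      (\<phi> i) (xb, pb)) u"
    using partial_strict_derivative_quotient[OF phi_strict lim s u P] by (simp add: divide_inverse_commute)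
  show "(\<lambda>k. (grad_x (\<phi> i) (X1 k, P1 k) - grad_x (\<phi> i) (X2 k, P2 k)) /\<^sub>R s k)
      \<longlonglongrightarrow> H i u"
    by (rule partial_strict_derivative_quotient[OF grad_strict lim s u P])
  assume Q: "Q1 \<longlonglongrightarrow> qb" "Q2 \<longlonglongrightarrow> qb" "(\<lambda>k. norm (Q1 k - Q2 k) / s
      k) \<longlonglongrightarrow> 0"
  show "(\<lambda>k. (f (X1 k, P1 k, Q1 k) - f (X2 k, P2 k, Q2 k)) /\<^sub>R s k) \<longlonglongrightarrow> A u"
  proof (rule partial_strict_derivative_quotient[OF f_strict lim(1,2) _ _ s u])
    show "(\<lambda>k. (P1 k, Q1 k)) \<longlonglongrightarrow> (pb, qb)" "(\<lambda>k. (P2 k, Q2 k))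
        \<longlonglongrightarrow> (pb, qb)"
      using lim Q by (auto intro: tendsto_Pair)
    show "(\<lambda>k. norm ((P1 k, Q1 k) - (P2 k, Q2 k)) / s k) \<longlonglongrightarrow> 0"
    proof (rule Lim_null_comparison)
      show "\<forall>\<^sub>F k in sequentially. norm (norm ((P1 k, Q1 k) - (P2 k, Q2 k)) / s k)
          \<le> norm (P1 k - P2 k) / s k + norm (Q1 k - Q2 k) / s k"
      proof (rule always_eventually, rule allI)
        fix k show "norm (norm ((P1 k, Q1 k) - (P2 k, Q2 k)) / s k) \<le> norm (P1 k - P2 k) / s k + norm (Q1 k - Q2 k) / s k"
          using s[of k] norm_Pair_le[of "P1 k - P2 k" "Q1 k - Q2 k"]
          by (simp add: add_divide_distrib[symmetric] divide_right_mono)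
      qed
      show "(\<lambda>k. norm (P1 k - P2 k) / s k + norm (Q1 k - Q2 k) / s k) \<longlonglongrightarrow> 0"
        using tendsto_add[OF P Q(3)] by simp
    qed
  qed
qed

text \<open>The identity \<open>\<lambda>\<^sub>1 g\<^sub>1 - \<lambda>\<^sub>2 g\<^sub>2 = (\<lambda>\<^sub>1 + \<lambda>\<^sub>2)/2 (g\<^sub>1 - g\<^sub>2) + (\<lambda>\<^sub>1 - \<lambda>\<^sub>2) (g\<^sub>1 + g\<^sub>2)/2\<close> separates the curvature of
  the Lagrangian at the averaged multiplier from a term with averaged gradients. The latter is left in the
  statement: the two estimates for pairs of KKT points treat it differently.\<close>

lemma lagrangian_difference_tendsto:
  assumes lim: "X1 \<longlonglongrightarrow> xb" "X2 \<longlonglongrightarrow> xb" "P1 \<longlonglongrightarrow> pb"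
      "P2 \<longlonglongrightarrow> pb" "Q1 \<longlonglongrightarrow> qb" "Q2 \<longlonglongrightarrow> qb"
    and s: "\<And>k. 0 < s k" and u: "(\<lambda>k. (X1 k - X2 k) /\<^sub>R s k) \<longlonglongrightarrow> u"
    and P: "(\<lambda>k. norm (P1 k - P2 k) / s k) \<longlonglongrightarrow> 0"
    and Q: "(\<lambda>k. norm (Q1 k - Q2 k) / s k) \<longlonglongrightarrow> 0"
    and L: "L1 \<longlonglongrightarrow> l1" "L2 \<longlonglongrightarrow> l2"
    and V: "\<And>k. V1 k = lagrangian f \<phi> (L1 k) (X1 k, P1 k, Q1 k)"
      "\<And>k. V2 k = lagrangian f \<phi> (L2 k) (X2 k, P2 k, Q2 k)"
  shows "(\<lambda>k. inner (V1 k - V2 k) (X1 k - X2 k) / (s k)\<^sup>2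
      - (\<Sum>i\<in>UNIV. (L1 k $ i - L2 k $ i) *
          (inner (grad_x (\<phi> i) (X1 k, P1 k) + grad_x (\<phi> i) (X2 k, P2 k)) (X1 k - X2 k) / 2 / (s k)\<^sup>2)))
    \<longlonglongrightarrow> lagrangian_quadratic ((l1 + l2) /\<^sub>R 2) u"
proof -
  let ?G1 = "\<lambda>i k. grad_x (\<phi> i) (X1 k, P1 k)" and ?G2 = "\<lambda>i k. grad_x (\<phi> i) (X2 k, P2 k)"
  let ?\<Delta> = "\<lambda>k. (X1 k - X2 k) /\<^sub>R s k"
  let ?F = "\<lambda>k. (f (X1 k, P1 k, Q1 k) - f (X2 k, P2 k, Q2 k)) /\<^sub>R s k"
  have id: "inner (V1 k - V2 k) (X1 k - X2 k) / (s k)\<^sup>2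
      - (\<Sum>i\<in>UNIV. (L1 k $ i - L2 k $ i) * (inner (?G1 i k + ?G2 i k) (X1 k - X2 k) / 2 / (s k)\<^sup>2))
    = inner (?\<Delta> k) (?F k + (\<Sum>i\<in>UNIV. ((L1 k + L2 k) /\<^sub>R 2) $ i *\<^sub>R ((?G1 i k - ?G2 i k)
        /\<^sub>R s k)))" for k
  proof -
    have "V1 k - V2 k = (f (X1 k, P1 k, Q1 k) - f (X2 k, P2 k, Q2 k)) +
        (\<Sum>i\<in>UNIV. (L1 k $ i *\<^sub>R ?G1 i k - L2 k $ i *\<^sub>R ?G2 i k))"
      by (simp add: V lagrangian_def sum_subtractf)
    also have "(\<Sum>i\<in>UNIV. (L1 k $ i *\<^sub>R ?G1 i k - L2 k $ i *\<^sub>R ?G2 i k))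
      = (\<Sum>i\<in>UNIV. ((L1 k $ i - L2 k $ i) / 2) *\<^sub>R (?G1 i k + ?G2 i k) + ((L1 k + L2 k) /\<^sub>R 2) $
          i *\<^sub>R (?G1 i k - ?G2 i k))"
      by (intro sum.cong refl) (simp add: vec_eq_iff field_simps)
    finally have eq: "V1 k - V2 k = (f (X1 k, P1 k, Q1 k) - f (X2 k, P2 k, Q2 k)) +
        (\<Sum>i\<in>UNIV. ((L1 k $ i - L2 k $ i) / 2) *\<^sub>R (?G1 i k + ?G2 i k) + ((L1 k + L2 k) /\<^sub>R 2) $
            i *\<^sub>R (?G1 i k - ?G2 i k))" .
    have gen: "inner (F + (\<Sum>i\<in>UNIV. (c i / 2) *\<^sub>R a i + m i *\<^sub>R b i)) D
        = inner F D + (\<Sum>i\<in>UNIV. c i * (inner (a i) D / 2)) + (\<Sum>i\<in>UNIV. m i * inner (b i) D)"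
      for F D :: "real^'n" and c m :: "'s \<Rightarrow> real" and a b
      by (simp add: inner_add_left inner_sum_left sum.distrib)
    have "inner (V1 k - V2 k) (X1 k - X2 k) = inner (f (X1 k, P1 k, Q1 k) - f (X2 k, P2 k, Q2 k)) (X1 k - X2 k)
       + (\<Sum>i\<in>UNIV. (L1 k $ i - L2 k $ i) * (inner (?G1 i k + ?G2 i k) (X1 k - X2 k) / 2))
       + (\<Sum>i\<in>UNIV. ((L1 k + L2 k) /\<^sub>R 2) $ i * inner (?G1 i k - ?G2 i k) (X1 k - X2 k))"
      unfolding eq by (rule gen)
    then have "inner (V1 k - V2 k) (X1 k - X2 k) / (s k)\<^sup>2
      - (\<Sum>i\<in>UNIV. (L1 k $ i - L2 k $ i) * (inner (?G1 i k + ?G2 i k) (X1 k - X2 k) / 2 / (s k)\<^sup>2))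
      = inner (f (X1 k, P1 k, Q1 k) - f (X2 k, P2 k, Q2 k)) (X1 k - X2 k) / (s k)\<^sup>2
       + (\<Sum>i\<in>UNIV. ((L1 k + L2 k) /\<^sub>R 2) $ i * (inner (?G1 i k - ?G2 i k) (X1 k - X2 k) / (s k)\<^sup>2))"
      by (simp only: add_divide_distrib sum_divide_distrib times_divide_eq_right)
    also have "\<dots> = inner (?\<Delta> k) (?F k) + (\<Sum>i\<in>UNIV. ((L1 k + L2 k) /\<^sub>R 2) $ i * inner
        (?\<Delta> k) ((?G1 i k - ?G2 i k) /\<^sub>R s k))"
      using s[of k] by (intro arg_cong2[of _ _ _ _ "(+)"] sum.cong refl) (simp_all add: inner_commute
          power2_eq_square divide_simps)
    finally show ?thesis by (simp only: inner_add_right inner_sum_right inner_scaleR_right)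
  qed
  note dq = difference_quotients_tendsto[OF lim(1-4) s u P]
  show ?thesis unfolding id lagrangian_quadratic_def
    by (intro tendsto_intros u dq(3)[OF lim(5,6) Q] dq(2) L)
qed

end

section \<open>Multipliers and the normal cone under MFCQ\<close>

context parametric_system
begin

lemma multipliers_zero_inactive:
  assumes "x \<in> ball xb r" "p \<in> ball pb r" "x \<in> feasible_set \<phi> p"
    and "lam \<in> multipliers f \<phi> x p q v" "i \<notin> active_set \<phi> xb pb"
  shows "lam $ i = 0"
  using assms inactive[of i x p] by (force simp: multipliers_iff)

text \<open>Each active constraint contributes at most its quadratic error, because \<open>\<phi> i\<close> vanishes at \<open>x\<close> and is
  nonpositive at \<open>y\<close>.\<close>

lemma multiplier_normal_inequality:
  assumes x: "x \<in> ball xb r" "p \<in> ball pb r" "x \<in> feasible_set \<phi> p"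
    and lam: "lam \<in> multipliers f \<phi> x p q v" and y: "y \<in> ball xb r" "y \<in> feasible_set \<phi> p"
  shows "inner (v - f (x, p, q)) (y - x) \<le> K * (\<Sum>i\<in>UNIV. lam $ i) * (norm (y - x))\<^sup>2"
proof -
  have l: "\<And>i. 0 \<le> lam $ i" "\<And>i. lam $ i * \<phi> i (x, p) = 0"
    and v: "v - f (x, p, q) = (\<Sum>i\<in>UNIV. lam $ i *\<^sub>R grad_x (\<phi> i) (x, p))"
    using lam x(3) by (auto simp: multipliers_iff)
  have "inner (v - f (x, p, q)) (y - x) = (\<Sum>i\<in>UNIV. lam $ i * inner (grad_x (\<phi> i) (x, p)) (y - x))"
    by (simp add: v inner_sum_left)
  also have "\<dots> \<le> (\<Sum>i\<in>UNIV. lam $ i * (K * (norm (y - x))\<^sup>2))"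
  proof (rule sum_mono)
    fix i
    have "lam $ i * (\<phi> i (x, p) + inner (grad_x (\<phi> i) (x, p)) (y - x)) \<le> lam $ i * (K * (norm (y - x))\<^sup>2)"
    proof (rule mult_left_mono[OF _ l(1)])
      have "\<phi> i (y, p) \<le> 0" using y by (simp add: feasible_set_def)
      then show "\<phi> i (x, p) + inner (grad_x (\<phi> i) (x, p)) (y - x) \<le> K * (norm (y - x))\<^sup>2"
        using phi_lower[OF x(1) y(1) x(2), of i] by linarith
    qed
    then show "lam $ i * inner (grad_x (\<phi> i) (x, p)) (y - x) \<le> lam $ i * (K * (norm (y - x))\<^sup>2)"
      using l(2)[of i] by (simp add: distrib_left)
  qed
  also have "\<dots> = K * (\<Sum>i\<in>UNIV. lam $ i) * (norm (y - x))\<^sup>2"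
    by (simp add: sum_distrib_left sum_distrib_right mult_ac)
  finally show ?thesis .
qed

lemma multipliers_imp_solution:
  assumes x: "x \<in> ball xb r" "p \<in> ball pb r" "x \<in> feasible_set \<phi> p"
    and lam: "lam \<in> multipliers f \<phi> x p q v"
  shows "x \<in> solution_map f \<phi> v p q"
proof -
  have "v - f (x, p, q) \<in> regular_normal_cone (feasible_set \<phi> p) x"
  proof (rule regular_normal_coneI_quadratic[OF x(3)])
    have "\<forall>\<^sub>F y in at x within feasible_set \<phi> p. y \<in> ball xb r"
      using x(1) by (meson eventually_at_topological open_ball)
    moreover have "\<forall>\<^sub>F y in at x within feasible_set \<phi> p. y \<in> feasible_set \<phi> p"
      by (simp add: eventually_at_filter)
    ultimately show "\<forall>\<^sub>F y in at x within feasible_set \<phi> p.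
        inner (v - f (x, p, q)) (y - x) \<le> (K * (\<Sum>i\<in>UNIV. lam $ i)) * (norm (y - x))\<^sup>2"
      by eventually_elim (rule multiplier_normal_inequality[OF x lam])
  qed
  then have "\<exists>xs vs. (\<forall>k::nat. xs k \<in> feasible_set \<phi> p \<and> vs k \<in> regular_normal_cone
      (feasible_set \<phi> p) (xs k))
      \<and> xs \<longlonglongrightarrow> x \<and> vs \<longlonglongrightarrow> v - f (x, p, q)"
    using x(3) by (intro exI[of _ "\<lambda>_. x"] exI[of _ "\<lambda>_. v - f (x, p, q)"]) simp
  then have "v - f (x, p, q) \<in> limiting_normal_cone (feasible_set \<phi> p) x"
    unfolding limiting_normal_cone_def using x(3) by simp
  then show ?thesis unfolding solution_map_def mem_Collect_eq
    by (intro image_eqI[of _ _ "v - f (x, p, q)"]) simp_all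
qed

end

locale parametric_mfcq_system = parametric_system f \<phi> xb pb qb A H r K
  for f :: "(real^'n) \<times> (real^'l) \<times> (real^'m) \<Rightarrow> real^'n"
    and \<phi> :: "'s::finite \<Rightarrow> (real^'n) \<times> (real^'l) \<Rightarrow> real"
    and xb :: "real^'n" and pb :: "real^'l" and qb :: "real^'m"
    and A :: "real^'n \<Rightarrow> real^'n" and H :: "'s \<Rightarrow> real^'n \<Rightarrow> real^'n"
    and r K :: real +
  fixes d :: "real^'n" and \<sigma> :: real
  assumes \<sigma>_pos: "0 < \<sigma>"
    and mfcq: "\<lbrakk>i \<in> active_set \<phi> xb pb; x \<in> ball xb r; p \<in> ball pb r\<rbrakk>
        \<Longrightarrow> inner (grad_x (\<phi> i) (x, p)) d \<le> - \<sigma>"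
begin

text \<open>Pairing with the MFCQ direction \<open>d\<close> sees every coefficient with the margin \<open>\<sigma>\<close>.\<close>

lemma conic_coefficients_bound:
  assumes "x \<in> ball xb r" "p \<in> ball pb r" "\<And>i. 0 \<le> lam $ i" "\<And>i. i \<notin> active_set \<phi>
      xb pb \<Longrightarrow> lam $ i = 0"
  shows "(\<Sum>i\<in>UNIV. lam $ i) \<le> norm (\<Sum>i\<in>UNIV. lam $ i *\<^sub>R grad_x (\<phi> i) (x, p)) *
      (norm d / \<sigma>)"
proof -
  let ?n = "\<Sum>i\<in>UNIV. lam $ i *\<^sub>R grad_x (\<phi> i) (x, p)"
  have "inner ?n d = (\<Sum>i\<in>UNIV. lam $ i * inner (grad_x (\<phi> i) (x, p)) d)" by (simp add: inner_sum_left)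
  also have "\<dots> \<le> (\<Sum>i\<in>UNIV. lam $ i * (- \<sigma>))"
  proof (rule sum_mono)
    fix i show "lam $ i * inner (grad_x (\<phi> i) (x, p)) d \<le> lam $ i * (- \<sigma>)"
      using mult_left_mono[OF mfcq[OF _ assms(1,2)] assms(3)[of i]] assms(4)[of i]
      by (cases "i \<in> active_set \<phi> xb pb") simp_all
  qed
  also have "\<dots> = - \<sigma> * (\<Sum>i\<in>UNIV. lam $ i)" by (simp add: sum_distrib_left mult.commute sum_negf)
  finally have "\<sigma> * (\<Sum>i\<in>UNIV. lam $ i) \<le> norm ?n * norm d"
    using Cauchy_Schwarz_ineq2[of ?n d] by linarith
  then show ?thesis using \<sigma>_pos by (simp add: field_simps)
qed

lemma multipliers_bound:
  assumes "x \<in> ball xb r" "p \<in> ball pb r" "x \<in> feasible_set \<phi> p" "lam \<in> multipliers f \<phi> x p q v"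
  shows "(\<Sum>i\<in>UNIV. lam $ i) \<le> norm (v - f (x, p, q)) * (norm d / \<sigma>)"
    and "norm lam \<le> norm (v - f (x, p, q)) * (norm d / \<sigma>)"
proof -
  have l: "\<And>i. 0 \<le> lam $ i" and v: "v - f (x, p, q) = (\<Sum>i\<in>UNIV. lam $ i *\<^sub>R grad_x (\<phi> i) (x, p))"
    using assms(3,4) by (auto simp: multipliers_iff)
  show 1: "(\<Sum>i\<in>UNIV. lam $ i) \<le> norm (v - f (x, p, q)) * (norm d / \<sigma>)"
    unfolding v by (rule conic_coefficients_bound[OF assms(1,2) l multipliers_zero_inactive[OF assms]])
  have "norm lam \<le> (\<Sum>i\<in>UNIV. \<bar>lam $ i\<bar>)" by (rule norm_le_l1_cart)
  also have "\<dots> = (\<Sum>i\<in>UNIV. lam $ i)" using l by simp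
  finally show "norm lam \<le> norm (v - f (x, p, q)) * (norm d / \<sigma>)" using 1 by simp
qed

text \<open>The cone generated by the active gradients, with activity written as a product condition because that
  passes to limits.\<close>

definition active_cone :: "real^'n \<Rightarrow> real^'l \<Rightarrow> (real^'n) set" where
  "active_cone x p = {\<Sum>i\<in>UNIV. lam $ i *\<^sub>R grad_x (\<phi> i) (x, p) |lam.
     (\<forall>i. 0 \<le> lam $ i) \<and> (\<forall>i. lam $ i * \<phi> i (x, p) = 0)}"

lemma active_coneI:
  "\<lbrakk>\<And>i. 0 \<le> lam $ i; \<And>i. lam $ i * \<phi> i (x, p) = 0\<rbrakk>
    \<Longrightarrow> (\<Sum>i\<in>UNIV. lam $ i *\<^sub>R grad_x (\<phi> i) (x, p)) \<in> active_cone x p"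
  unfolding active_cone_def mem_Collect_eq by (intro exI[of _ lam]) simp

lemma active_coneE:
  assumes "n \<in> active_cone x p"
  obtains lam where "n = (\<Sum>i\<in>UNIV. lam $ i *\<^sub>R grad_x (\<phi> i) (x, p))"
    "\<And>i. 0 \<le> lam $ i" "\<And>i. lam $ i * \<phi> i (x, p) = 0"
proof -
  have "\<exists>lam. n = (\<Sum>i\<in>UNIV. lam $ i *\<^sub>R grad_x (\<phi> i) (x, p)) \<and>
     (\<forall>i. 0 \<le> lam $ i) \<and> (\<forall>i. lam $ i * \<phi> i (x, p) = 0)"
    using assms unfolding active_cone_def by (rule CollectD)
  then obtain lam where lam: "n = (\<Sum>i\<in>UNIV. lam $ i *\<^sub>R grad_x (\<phi> i) (x, p)) \<and>
     (\<forall>i. 0 \<le> lam $ i) \<and> (\<forall>i. lam $ i * \<phi> i (x, p) = 0)" ..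
  show ?thesis by (rule that[of lam]) (use lam in \<open>simp_all del: mult_eq_0_iff\<close>)
qed

text \<open>The coefficients are bounded, hence have a convergent subsequence. For a constant sequence of points this
  says that the cone is closed; in general it passes from regular to limiting normals.\<close>

lemma active_cone_limit:
  assumes lim: "X \<longlonglongrightarrow> x" "N \<longlonglongrightarrow> n" and x: "x \<in> ball xb r" and p: "p
      \<in> ball pb r"
    and X: "\<And>k. X k \<in> ball xb r" "\<And>k. X k \<in> feasible_set \<phi> p"
    and N: "\<And>k. N k \<in> active_cone (X k) p"
  shows "n \<in> active_cone x p"
proof -
  have "\<forall>k. \<exists>lam. N k = (\<Sum>i\<in>UNIV. lam $ i *\<^sub>R grad_x (\<phi> i) (X k, p)) \<and>
     (\<forall>i. 0 \<le> lam $ i) \<and> (\<forall>i. lam $ i * \<phi> i (X k, p) = 0)"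
    using active_coneE[OF N] by blast
  from choice[OF this] obtain L where "\<forall>k. N k = (\<Sum>i\<in>UNIV. L k $ i *\<^sub>R grad_x (\<phi> i) (X k, p)) \<and>
     (\<forall>i. 0 \<le> L k $ i) \<and> (\<forall>i. L k $ i * \<phi> i (X k, p) = 0)" ..
  then have L: "\<And>k. N k = (\<Sum>i\<in>UNIV. L k $ i *\<^sub>R grad_x (\<phi> i) (X k, p))"
     "\<And>k i. 0 \<le> L k $ i" "\<And>k i. L k $ i * \<phi> i (X k, p) = 0"
    by (simp_all del: mult_eq_0_iff)
  obtain B where B: "\<And>k. norm (N k) \<le> B"
    using convergent_imp_Bseq[OF convergentI[OF lim(2)]] unfolding Bseq_def by blast
  have "L k \<in> cball 0 (B * (norm d / \<sigma>))" for k
  proof -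
    have "norm (L k) \<le> (\<Sum>i\<in>UNIV. \<bar>L k $ i\<bar>)" by (rule norm_le_l1_cart)
    also have "\<dots> = (\<Sum>i\<in>UNIV. L k $ i)" using L by simp
    also have "\<dots> \<le> norm (N k) * (norm d / \<sigma>)" unfolding L(1)
    proof (rule conic_coefficients_bound[OF X(1) p L(2)])
      fix i assume "i \<notin> active_set \<phi> xb pb"
      then show "L k $ i = 0" using inactive[OF _ X(1) p, of i k] L(3)[of k i] by auto
    qed
    also have "\<dots> \<le> B * (norm d / \<sigma>)" using B \<sigma>_pos by (intro mult_right_mono) auto
    finally show ?thesis by simp
  qed
  then obtain lam \<rho> where \<rho>: "strict_mono \<rho>" "(L \<circ> \<rho>) \<longlonglongrightarrow> lam"
    using compact_cball[of "0::real^'s" "B * (norm d / \<sigma>)"] unfolding compact_def by blast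
  have Xr: "(X \<circ> \<rho>) \<longlonglongrightarrow> x" "(N \<circ> \<rho>) \<longlonglongrightarrow> n" using
      lim \<rho>(1) by (auto intro: LIMSEQ_subseq_LIMSEQ)
  note bt = box_tendsto[OF Xr(1) tendsto_const[of p] x p]
  note Lt = tendsto_vec_nth[OF \<rho>(2)]
  have "\<And>i. 0 \<le> lam $ i" using L by (auto intro!: LIMSEQ_le_const[OF Lt])
  moreover have "lam $ i * \<phi> i (x, p) = 0" for i
  proof -
    have "(\<lambda>k. (L \<circ> \<rho>) k $ i * \<phi> i ((X \<circ> \<rho>) k, p)) \<longlonglongrightarrow> lam $
        i * \<phi> i (x, p)"
      by (intro tendsto_mult Lt bt(1))
    then show ?thesis using L(3) by (simp add: LIMSEQ_const_iff del: mult_eq_0_iff)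
  qed
  moreover have "n = (\<Sum>i\<in>UNIV. lam $ i *\<^sub>R grad_x (\<phi> i) (x, p))"
  proof (rule LIMSEQ_unique[OF Xr(2)])
    have "(\<lambda>k. \<Sum>i\<in>UNIV. (L \<circ> \<rho>) k $ i *\<^sub>R grad_x (\<phi> i) ((X \<circ> \<rho>) k,
        p)) \<longlonglongrightarrow> (\<Sum>i\<in>UNIV. lam $ i *\<^sub>R grad_x (\<phi> i) (x, p))"
      by (intro tendsto_intros Lt bt(2))
    then show "(N \<circ> \<rho>) \<longlonglongrightarrow> (\<Sum>i\<in>UNIV. lam $ i *\<^sub>R grad_x (\<phi> i) (x, p))"
      by (simp add: L(1) o_def)
  qed
  ultimately show ?thesis using active_coneI by simp
qed

text \<open>A regular normal outside the closed convex cone is separated from it by some direction; tilted slightly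
  towards \<open>d\<close>, the direction strictly decreases all active constraints and so is feasible, but it has a
  positive product with the normal.\<close>

lemma regular_normal_cone_subset:
  assumes x: "x \<in> ball xb r" and p: "p \<in> ball pb r"
  shows "regular_normal_cone (feasible_set \<phi> p) x \<subseteq> active_cone x p"
proof
  fix v assume v: "v \<in> regular_normal_cone (feasible_set \<phi> p) x"
  then have feas: "x \<in> feasible_set \<phi> p" by (auto simp: regular_normal_cone_def split: if_splits)
  let ?C = "active_cone x p"
  have zero: "0 \<in> ?C" using active_coneI[of 0 x p] by simp
  have cone: "t *\<^sub>R n \<in> ?C" if n: "n \<in> ?C" and t: "0 \<le> t" for n t
  proof -
    obtain lam where lam: "n = (\<Sum>i\<in>UNIV. lam $ i *\<^sub>R grad_x (\<phi> i) (x, p))"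
      "\<And>i. 0 \<le> lam $ i" "\<And>i. lam $ i * \<phi> i (x, p) = 0"
      by (rule active_coneE[OF n]) (rule that)
    have "(\<Sum>i\<in>UNIV. (t *\<^sub>R lam) $ i *\<^sub>R grad_x (\<phi> i) (x, p)) \<in> ?C"
      by (rule active_coneI) (use lam t in auto)
    then show ?thesis using lam(1) by (simp add: scaleR_sum_right)
  qed
  have add: "m + n \<in> ?C" if m: "m \<in> ?C" and n: "n \<in> ?C" for m n
  proof -
    obtain lam where lam: "n = (\<Sum>i\<in>UNIV. lam $ i *\<^sub>R grad_x (\<phi> i) (x, p))"
      "\<And>i. 0 \<le> lam $ i" "\<And>i. lam $ i * \<phi> i (x, p) = 0"
      by (rule active_coneE[OF n]) (rule that)
    obtain mu where mu: "m = (\<Sum>i\<in>UNIV. mu $ i *\<^sub>R grad_x (\<phi> i) (x, p))"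
      "\<And>i. 0 \<le> mu $ i" "\<And>i. mu $ i * \<phi> i (x, p) = 0"
      by (rule active_coneE[OF m]) (rule that)
    have "(\<Sum>i\<in>UNIV. (mu + lam) $ i *\<^sub>R grad_x (\<phi> i) (x, p)) \<in> ?C"
      by (rule active_coneI) (simp_all add: lam(2,3) mu(2,3) distrib_right del: mult_eq_0_iff)
    then show ?thesis using lam(1) mu(1) by (simp add: scaleR_add_left sum.distrib)
  qed
  have grad_in: "grad_x (\<phi> i) (x, p) \<in> ?C" if i: "\<phi> i (x, p) = 0" for i
  proof -
    have "(\<Sum>j\<in>UNIV. axis i 1 $ j *\<^sub>R grad_x (\<phi> j) (x, p)) = (\<Sum>j\<in>UNIV. if j = i then
        grad_x (\<phi> j) (x, p) else 0)"
      by (intro sum.cong) (auto simp: axis_def)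
    moreover have "(\<Sum>j\<in>UNIV. axis i 1 $ j *\<^sub>R grad_x (\<phi> j) (x, p)) \<in> ?C"
      by (rule active_coneI) (use i in \<open>auto simp: axis_def\<close>)
    ultimately show ?thesis by simp
  qed
  have C: "convex ?C"
    unfolding convex_def by (intro ballI allI impI add cone) auto
  have "closed ?C" unfolding closed_sequential_limits
    using active_cone_limit[OF tendsto_const[of x] _ x p x feas] by blast
  show "v \<in> ?C"
  proof (rule ccontr)
    assume "v \<notin> ?C"
    then obtain a b where a: "inner a v < b" "\<And>n. n \<in> ?C \<Longrightarrow> b < inner a n"
      using separating_hyperplane_closed_point[OF C \<open>closed ?C\<close>] by blast
    have b: "b < 0" using a(2)[OF zero] by simp
    have pos: "0 \<le> inner a n" if n: "n \<in> ?C" for n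
    proof (rule ccontr)
      assume neg: "\<not> 0 \<le> inner a n"
      then have "0 \<le> b / inner a n" using b by (simp add: zero_le_divide_iff)
      from a(2)[OF cone[OF n this]] neg show False by simp
    qed
    \<comment> \<open>tilt the separating direction towards the interior of the linearized cone\<close>
    define m where "m = \<bar>inner v d\<bar> + 1"
    have "m > 0" by (simp add: m_def)
    define \<epsilon> where "\<epsilon> = - inner a v / (2 * m)"
    have av: "inner a v < 0" using a(1) b by simp
    have \<epsilon>: "\<epsilon> > 0" using av \<open>m > 0\<close> by (simp add: \<epsilon>_def divide_neg_pos)
    define D where "D = \<epsilon> *\<^sub>R d - a"
    have "inner v D > 0"
    proof -
      have "\<epsilon> * \<bar>inner v d\<bar> \<le> \<epsilon> * m" using \<epsilon> by (simp add: m_def)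
      also have "\<dots> = - inner a v / 2" using \<open>m > 0\<close> by (simp add: \<epsilon>_def)
      finally have "\<epsilon> * inner v d \<ge> inner a v / 2"
        using \<epsilon> abs_le_D2[of "\<epsilon> * inner v d" "- inner a v / 2"] by (simp add: abs_mult)
      then show ?thesis using av by (simp add: D_def inner_diff_right inner_commute)
    qed
    moreover have "inner v D \<le> 0"
    proof (rule regular_normal_coneD_direction[OF v])
      have lim: "((\<lambda>t. x + t *\<^sub>R D) \<longlongrightarrow> x) (at_right 0)"
      proof -
        have "((\<lambda>t. x + t *\<^sub>R D) \<longlongrightarrow> x + 0 *\<^sub>R D) (at_right (0::real))" by
            (intro tendsto_intros)
        then show ?thesis by simp
      qed
      have "\<forall>\<^sub>F t in at_right (0::real). \<phi> i (x + t *\<^sub>R D, p) \<le> 0" for i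
      proof (cases "\<phi> i (x, p) = 0")
        case True
        have "i \<in> active_set \<phi> xb pb" by (rule active_subset_base[OF x p True])
        then have "inner (grad_x (\<phi> i) (x, p)) d \<le> - \<sigma>" using mfcq x p by blast
        then have "\<epsilon> * inner (grad_x (\<phi> i) (x, p)) d < 0" using \<epsilon> \<sigma>_pos by (simp add: mult_pos_neg)
        then have "inner (grad_x (\<phi> i) (x, p)) D < 0"
          using pos[OF grad_in[OF True]] by (simp add: D_def inner_diff_right inner_commute[of a])
        moreover have "((\<lambda>t. \<phi> i (x + t *\<^sub>R D, p)) has_real_derivative inner (grad_x (\<phi> i)
            (x, p)) D) (at 0)"
        proof -
          have "((\<lambda>t. x + t *\<^sub>R D) has_derivative (\<lambda>s. s *\<^sub>R D)) (at (0::real))" by (auto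
              intro!: derivative_eq_intros)
          moreover have "((\<lambda>y. \<phi> i (y, p)) has_derivative (\<lambda>h. inner (grad_x (\<phi> i) (x, p))
              h)) (at (x + 0 *\<^sub>R D))"
            using phi_deriv[OF x p] by simp
          ultimately have "((\<lambda>t. \<phi> i (x + t *\<^sub>R D, p)) has_derivative (\<lambda>s. inner (grad_x
              (\<phi> i) (x, p)) (s *\<^sub>R D))) (at 0)"
            by (rule has_derivative_compose)
          moreover have "(\<lambda>s. inner (grad_x (\<phi> i) (x, p)) (s *\<^sub>R D)) = (*) (inner (grad_x (\<phi>
              i) (x, p)) D)"
            by (simp add: fun_eq_iff)
          ultimately show ?thesis unfolding has_field_derivative_def by (simp only:)
        qed
        ultimately obtain e where "e > 0" "\<And>h. 0 < h \<Longrightarrow> h < e \<Longrightarrow> \<phi> i (x + (0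
            + h) *\<^sub>R D, p) < \<phi> i (x + 0 *\<^sub>R D, p)"
          using DERIV_neg_dec_right by blast
        then show ?thesis unfolding eventually_at_right_field using True
          by (intro exI[of _ e]) (auto intro: less_imp_le)
      next
        case False
        then have "\<phi> i (x, p) < 0" using feas by (auto simp: feasible_set_def less_le)
        moreover have "((\<lambda>t. \<phi> i (x + t *\<^sub>R D, p)) \<longlongrightarrow> \<phi> i (x, p)) (at_right 0)"
          using has_derivative_continuous[OF phi_deriv[OF x p]] lim by (rule isCont_tendsto_compose)
        ultimately have "\<forall>\<^sub>F t in at_right (0::real). \<phi> i (x + t *\<^sub>R D, p) < 0" by (simp
            add: order_tendstoD(2))
        then show ?thesis by eventually_elim simp
      qed
      then have "\<forall>\<^sub>F t in at_right (0::real). \<forall>i. \<phi> i (x + t *\<^sub>R D, p) \<le> 0" by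
          (rule eventually_all_finite)
      then show "\<forall>\<^sub>F t in at_right 0. x + t *\<^sub>R D \<in> feasible_set \<phi> p" by (simp add: feasible_set_def)
    qed
    ultimately show False by simp
  qed
qed

lemma solution_map_iff:
  assumes x: "x \<in> ball xb r" and p: "p \<in> ball pb r"
  shows "x \<in> solution_map f \<phi> v p q \<longleftrightarrow> x \<in> feasible_set \<phi> p \<and>
      (\<exists>lam. lam \<in> multipliers f \<phi> x p q v)"
proof
  assume "x \<in> feasible_set \<phi> p \<and> (\<exists>lam. lam \<in> multipliers f \<phi> x p q v)"
  then show "x \<in> solution_map f \<phi> v p q" using multipliers_imp_solution[OF x p] by blast
next
  assume "x \<in> solution_map f \<phi> v p q"
  then obtain n where n: "n \<in> limiting_normal_cone (feasible_set \<phi> p) x" "v = f (x, p, q) + n"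
    unfolding solution_map_def by blast
  then have feas: "x \<in> feasible_set \<phi> p" by (auto simp: limiting_normal_cone_def split: if_splits)
  then obtain X N where XN: "\<And>k. X k \<in> feasible_set \<phi> p" "\<And>k. N k \<in> regular_normal_cone
      (feasible_set \<phi> p) (X k)"
    "X \<longlonglongrightarrow> x" "N \<longlonglongrightarrow> n" using n(1) unfolding limiting_normal_cone_def by auto
  obtain k0 where k0: "\<And>k. k \<ge> k0 \<Longrightarrow> X k \<in> ball xb r"
    using topological_tendstoD[OF XN(3) open_ball x] unfolding eventually_sequentially by blast
  have "n \<in> active_cone x p"
  proof (rule active_cone_limit[OF _ _ x p])
    show "(\<lambda>k. X (k + k0)) \<longlonglongrightarrow> x" "(\<lambda>k. N (k + k0)) \<longlonglongrightarrow>
        n" using XN by (auto intro: LIMSEQ_ignore_initial_segment)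
    show "X (k + k0) \<in> ball xb r" "X (k + k0) \<in> feasible_set \<phi> p" "N (k + k0) \<in> active_cone (X (k + k0)) p" for k
      using k0[of "k + k0"] XN regular_normal_cone_subset[OF _ p, of "X (k + k0)"] by auto
  qed
  then obtain lam where "n = (\<Sum>i\<in>UNIV. lam $ i *\<^sub>R grad_x (\<phi> i) (x, p))"
      "\<And>i. 0 \<le> lam $ i" "\<And>i. lam $ i * \<phi> i (x, p) = 0" by (rule active_coneE) (rule that)
  then show "x \<in> feasible_set \<phi> p \<and> (\<exists>lam. lam \<in> multipliers f \<phi> x p q v)"
    using feas n(2) by (auto simp: multipliers_iff simp del: mult_eq_0_iff)
qed

end

section \<open>Strong monotonicity\<close>

lemma multipliers_midpoint:
  assumes x: "x \<in> feasible_set \<phi> p"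
    and l1: "l1 \<in> multipliers f \<phi> x p q v" and l2: "l2 \<in> multipliers f \<phi> x p q v"
  shows "(l1 + l2) /\<^sub>R 2 \<in> multipliers f \<phi> x p q v"
proof -
  let ?S = "\<lambda>l. \<Sum>i\<in>UNIV. l $ i *\<^sub>R grad_x (\<phi> i) (x, p)"
  have nn: "\<And>i. 0 \<le> l1 $ i" "\<And>i. 0 \<le> l2 $ i"
    and c: "\<And>i. l1 $ i * \<phi> i (x, p) = 0" "\<And>i. l2 $ i * \<phi> i (x, p) = 0"
    using l1 l2 unfolding multipliers_iff[OF x] by blast+
  have v: "v = f (x, p, q) + ?S l1" "v = f (x, p, q) + ?S l2"
    using l1 l2 unfolding multipliers_iff[OF x] by blast+
  have "a = b + c \<Longrightarrow> c = a - b" for a b c :: "real^'a" by simp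
  from this[OF v(1)] this[OF v(2)] have S: "?S l1 = v - f (x, p, q)" "?S l2 = v - f (x, p, q)" .
  have "?S ((l1 + l2) /\<^sub>R 2) = (1/2) *\<^sub>R (?S l1 + ?S l2)"
    by (simp add: scaleR_sum_right sum.distrib[symmetric] scaleR_add_left scaleR_add_right)
  also have "\<dots> = v - f (x, p, q)" unfolding S by (simp only: scaleR_half_double)
  finally have "v = f (x, p, q) + ?S ((l1 + l2) /\<^sub>R 2)" by simp
  moreover have "((l1 + l2) /\<^sub>R 2) $ i * \<phi> i (x, p) = 0" for i
  proof -
    have "((l1 + l2) /\<^sub>R 2) $ i * \<phi> i (x, p) = (l1 $ i * \<phi> i (x, p) + l2 $ i * \<phi> i (x, p)) / 2"
      by (simp add: field_simps)
    then show ?thesis unfolding c by simp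
  qed
  ultimately show ?thesis unfolding multipliers_iff[OF x] using nn by simp
qed

context parametric_mfcq_system
begin

definition local_kkt :: "real^'n \<Rightarrow> real \<Rightarrow> real^'n \<Rightarrow> real^'l \<Rightarrow> real^'m
    \<Rightarrow> real^'n \<Rightarrow> real^'s \<Rightarrow> bool" where
  "local_kkt vb \<delta> x p q v lam \<longleftrightarrow> x \<in> ball xb \<delta> \<and> p \<in> ball pb \<delta>
      \<and> q \<in> ball qb \<delta> \<and> v \<in> ball vb \<delta> \<and>
     x \<in> feasible_set \<phi> p \<and> lam \<in> multipliers f \<phi> x p q v"

lemma local_kkt_tendsto:
  assumes kkt: "\<And>k. local_kkt vb (\<delta> k) (X k) (P k) (Q k) (V k) (L k)" and \<delta>: "\<delta>
      \<longlonglongrightarrow> 0"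
  shows "X \<longlonglongrightarrow> xb" "P \<longlonglongrightarrow> pb" "Q \<longlonglongrightarrow> qb" "V
      \<longlonglongrightarrow> vb"
proof -
  have *: "Z \<longlonglongrightarrow> z" if "\<And>k. Z k \<in> ball z (\<delta> k)" for Z :: "nat \<Rightarrow>
      'z::metric_space" and z
  proof (rule metric_tendsto_imp_tendsto[OF \<delta>])
    show "\<forall>\<^sub>F k in sequentially. dist (Z k) z \<le> dist (\<delta> k) 0"
    proof (rule always_eventually, rule allI)
      fix k have "dist (Z k) z < \<delta> k" using that[of k] by (simp add: dist_commute)
      then show "dist (Z k) z \<le> dist (\<delta> k) 0" by (simp add: dist_real_def)
    qed
  qed
  show "X \<longlonglongrightarrow> xb" by (rule *) (use kkt in \<open>simp add: local_kkt_def\<close>)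
  show "P \<longlonglongrightarrow> pb" by (rule *) (use kkt in \<open>simp add: local_kkt_def\<close>)
  show "Q \<longlonglongrightarrow> qb" by (rule *) (use kkt in \<open>simp add: local_kkt_def\<close>)
  show "V \<longlonglongrightarrow> vb" by (rule *) (use kkt in \<open>simp add: local_kkt_def\<close>)
qed

lemma local_kkt_multiplier_bound:
  obtains B where "\<And>\<delta> x p q v lam. local_kkt vb \<delta> x p q v lam \<Longrightarrow> \<delta> \<le> r
      \<Longrightarrow> norm lam \<le> B"
proof (rule that)
  fix \<delta> x p q v lam assume kkt: "local_kkt vb \<delta> x p q v lam" and "\<delta> \<le> r"
  then have box: "x \<in> ball xb r" "p \<in> ball pb r" "q \<in> ball qb r" "v \<in> ball vb r"
    and feas: "x \<in> feasible_set \<phi> p" and lam: "lam \<in> multipliers f \<phi> x p q v"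
    unfolding local_kkt_def by auto
  have n: "norm (x - xb) \<le> r" "norm (p - pb) \<le> r" "norm (q - qb) \<le> r" "norm (v - vb) \<le> r"
    using box by (auto simp: dist_norm norm_minus_commute)
  have "norm (f (x, p, q) - f (xb, pb, qb)) \<le> K * (norm (x - xb) + norm (p - pb) + norm (q - qb))"
    by (rule f_lip) (use box r_pos in auto)
  also have "\<dots> \<le> K * (r + r + r)" using n K_nonneg by (intro mult_left_mono) auto
  finally have f: "norm (f (x, p, q) - f (xb, pb, qb)) \<le> K * (r + r + r)" .
  have "norm (v - f (x, p, q)) = norm ((v - vb) + (vb - f (xb, pb, qb)) - (f (x, p, q) - f (xb, pb, qb)))" by simp
  then have "norm (v - f (x, p, q)) \<le> norm (v - vb) + norm (vb - f (xb, pb, qb)) + norm (f (x, p, q) - f (xb, pb, qb))"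
    using norm_triangle_ineq4[of "(v - vb) + (vb - f (xb, pb, qb))" "f (x, p, q) - f (xb, pb, qb)"]
      norm_triangle_ineq[of "v - vb" "vb - f (xb, pb, qb)"] by linarith
  then have "norm (v - f (x, p, q)) \<le> r + norm (vb - f (xb, pb, qb)) + K * (r + r + r)" using f n by linarith
  then have "norm (v - f (x, p, q)) * (norm d / \<sigma>) \<le> (r + norm (vb - f (xb, pb, qb)) + K * (r + r + r)) *
      (norm d / \<sigma>)"
    using \<sigma>_pos by (intro mult_right_mono) auto
  then show "norm lam \<le> (r + norm (vb - f (xb, pb, qb)) + K * (r + r + r)) * (norm d / \<sigma>)"
    using multipliers_bound(2)[OF box(1,2) feas lam] by linarith
qed

lemma local_kkt_mono: "local_kkt vb \<delta> x p q v lam \<Longrightarrow> \<delta> \<le> \<delta>' \<Longrightarrow>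
    local_kkt vb \<delta>' x p q v lam"
  unfolding local_kkt_def by auto

text \<open>Estimates for pairs of KKT points are proved by contradiction. Multipliers are bounded, so violations
  of an estimate at smaller and smaller scales yield, after normalization, convergent sequences; the limits of
  the multipliers are multipliers of the reference point, and so is their average.\<close>

lemma local_kkt_violation_limit:
  assumes bad: "\<And>e. 0 < e \<Longrightarrow> \<exists>x1 p1 q1 v1 lam1 x2 p2 q2 v2 lam2. local_kkt vb (min r e)
      x1 p1 q1 v1 lam1 \<and>
      local_kkt vb (min r e) x2 p2 q2 v2 lam2 \<and> x1 \<noteq> x2 \<and> R e x1 p1 q1 v1 lam1 x2 p2 q2 v2 lam2"
  obtains X1 P1 Q1 V1 L1 X2 P2 Q2 V2 L2 e u l1 l2 where
    "\<And>k. local_kkt vb r (X1 k) (P1 k) (Q1 k) (V1 k) (L1 k)" "\<And>k. local_kkt vb r (X2 k) (P2 k) (Q2 k) (V2 k) (L2 k)"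
    "\<And>k. 0 < norm (X1 k - X2 k)" "\<And>k. R (e k) (X1 k) (P1 k) (Q1 k) (V1 k) (L1 k) (X2 k) (P2 k) (Q2 k) (V2 k) (L2 k)"
    "\<And>k. 0 < e k" "e \<longlonglongrightarrow> 0" "X1 \<longlonglongrightarrow> xb" "P1
        \<longlonglongrightarrow> pb" "Q1 \<longlonglongrightarrow> qb" "X2 \<longlonglongrightarrow> xb" "P2
            \<longlonglongrightarrow> pb" "Q2 \<longlonglongrightarrow> qb"
    "(\<lambda>k. (X1 k - X2 k) /\<^sub>R norm (X1 k - X2 k)) \<longlonglongrightarrow> u" "u \<noteq> 0" "L1
        \<longlonglongrightarrow> l1" "L2 \<longlonglongrightarrow> l2"
    "(l1 + l2) /\<^sub>R 2 \<in> multipliers f \<phi> xb pb qb vb"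
proof -
  define \<epsilon> where "\<epsilon> k = inverse (real (Suc k))" for k
  have \<epsilon>: "0 < \<epsilon> k" for k by (simp add: \<epsilon>_def)
  have \<epsilon>0: "\<epsilon> \<longlonglongrightarrow> 0" unfolding \<epsilon>_def[abs_def] by (rule
      LIMSEQ_inverse_real_of_nat)
  have "\<forall>k. \<exists>x1 p1 q1 v1 lam1 x2 p2 q2 v2 lam2. local_kkt vb (min r (\<epsilon> k)) x1 p1 q1 v1 lam1 \<and>
      local_kkt vb (min r (\<epsilon> k)) x2 p2 q2 v2 lam2 \<and> x1 \<noteq> x2 \<and> R (\<epsilon> k) x1 p1 q1 v1
          lam1 x2 p2 q2 v2 lam2"
    using bad[OF \<epsilon>] ..
  then obtain X1 P1 Q1 V1 L1 X2 P2 Q2 V2 L2 where data: "\<forall>k. local_kkt vb (min r (\<epsilon> k)) (X1 k) (P1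
      k) (Q1 k) (V1 k) (L1 k) \<and>
      local_kkt vb (min r (\<epsilon> k)) (X2 k) (P2 k) (Q2 k) (V2 k) (L2 k) \<and> X1 k \<noteq> X2 k \<and>
      R (\<epsilon> k) (X1 k) (P1 k) (Q1 k) (V1 k) (L1 k) (X2 k) (P2 k) (Q2 k) (V2 k) (L2 k)"
    by (elim choice[THEN exE]) (rule that)
  then have kkt: "\<And>k. local_kkt vb (min r (\<epsilon> k)) (X1 k) (P1 k) (Q1 k) (V1 k) (L1 k)"
      "\<And>k. local_kkt vb (min r (\<epsilon> k)) (X2 k) (P2 k) (Q2 k) (V2 k) (L2 k)" and ne: "\<And>k. X1 k \<noteq> X2 k"
    by blast+
  obtain B where B: "\<And>\<delta> x p q v lam. local_kkt vb \<delta> x p q v lam \<Longrightarrow> \<delta> \<le> r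
      \<Longrightarrow> norm lam \<le> B"
    by (rule local_kkt_multiplier_bound[of vb]) (rule that)
  let ?S = "cball (0::real^'s) B \<times> cball (0::real^'s) B \<times> sphere (0::real^'n) 1"
  let ?T = "\<lambda>k. (L1 k, L2 k, (X1 k - X2 k) /\<^sub>R norm (X1 k - X2 k))"
  have cS: "compact ?S" by (intro compact_Times compact_cball compact_sphere)
  have TS: "\<forall>k. ?T k \<in> ?S" using B[OF kkt(1)] B[OF kkt(2)] ne by simp
  obtain l \<rho> where l: "l \<in> ?S" "strict_mono \<rho>" "(?T \<circ> \<rho>) \<longlonglongrightarrow> l"
    by (rule seq_compactE[OF compact_imp_seq_compact[OF cS] TS]) (rule that)
  obtain l1 l2 u where luu: "l = (l1, l2, u)" by (cases l)
  have lim: "(\<lambda>k. L1 (\<rho> k)) \<longlonglongrightarrow> l1" "(\<lambda>k. L2 (\<rho> k)) \<longlonglongrightarrow> l2"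
    "(\<lambda>k. (X1 (\<rho> k) - X2 (\<rho> k)) /\<^sub>R norm (X1 (\<rho> k) - X2 (\<rho> k))) \<longlonglongrightarrow> u"
    using tendsto_fst[OF l(3)] tendsto_fst[OF tendsto_snd[OF l(3)]] tendsto_snd[OF tendsto_snd[OF l(3)]]
    by (simp_all add: luu o_def)
  have \<epsilon>\<rho>: "(\<lambda>k. \<epsilon> (\<rho> k)) \<longlonglongrightarrow> 0" using
      LIMSEQ_subseq_LIMSEQ[OF \<epsilon>0 l(2)] by (simp add: o_def)
  have kkt\<rho>: "local_kkt vb (\<epsilon> (\<rho> k)) (X1 (\<rho> k)) (P1 (\<rho> k)) (Q1 (\<rho> k)) (V1 (\<rho>
      k)) (L1 (\<rho> k))"
    "local_kkt vb (\<epsilon> (\<rho> k)) (X2 (\<rho> k)) (P2 (\<rho> k)) (Q2 (\<rho> k)) (V2 (\<rho> k)) (L2 (\<rho> k))"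
    "local_kkt vb r (X1 k) (P1 k) (Q1 k) (V1 k) (L1 k)" "local_kkt vb r (X2 k) (P2 k) (Q2 k) (V2 k) (L2 k)" for k
    by (rule local_kkt_mono[OF kkt(1)] local_kkt_mono[OF kkt(2)], simp)+
  note t1 = local_kkt_tendsto[OF kkt\<rho>(1) \<epsilon>\<rho>] and t2 = local_kkt_tendsto[OF kkt\<rho>(2) \<epsilon>\<rho>]
  have "l1 \<in> multipliers f \<phi> xb pb qb vb"
    by (rule multipliers_closed_graph(2)[OF t1 lim(1) base_in_box]) (use kkt(1) in \<open>auto simp: local_kkt_def\<close>)
  moreover have "l2 \<in> multipliers f \<phi> xb pb qb vb"
    by (rule multipliers_closed_graph(2)[OF t2 lim(2) base_in_box]) (use kkt(2) in \<open>auto simp: local_kkt_def\<close>)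
  ultimately have mid: "(l1 + l2) /\<^sub>R 2 \<in> multipliers f \<phi> xb pb qb vb" by (rule
      multipliers_midpoint[OF base_feasible])
  show ?thesis
  proof (rule that[OF kkt\<rho>(3,4) _ _ _ \<epsilon>\<rho> t1(1-3) t2(1-3) lim(3) _ lim(1,2) mid])
    show "0 < norm (X1 (\<rho> k) - X2 (\<rho> k))" for k using ne by simp
    show "R (\<epsilon> (\<rho> k)) (X1 (\<rho> k)) (P1 (\<rho> k)) (Q1 (\<rho> k)) (V1 (\<rho> k)) (L1 (\<rho> k))
        (X2 (\<rho> k)) (P2 (\<rho> k)) (Q2 (\<rho> k)) (V2 (\<rho> k)) (L2 (\<rho> k))" for k
      using data by blast
    show "0 < \<epsilon> (\<rho> k)" for k by (rule \<epsilon>)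
    show "u \<noteq> 0" using l(1) luu by auto
  qed
qed

text \<open>Dividing by the squared distance \<open>s\<^sup>2\<close>, the trapezoidal rule replaces the term with averaged gradients
  by \<open>S\<close>, a sum of nonnegative complementarity products. A violation bounds \<open>S\<close> and forces the
  quadratic form to be nonpositive at the limit direction \<open>u\<close>. Boundedness of \<open>S\<close> puts \<open>u\<close> into the
  subspace on which GSSOSC makes the form positive.\<close>

lemma strong_monotonicity:
  assumes G: "GSSOSC f \<phi> xb pb qb vb"
  obtains \<kappa> \<delta> where "0 < \<kappa>" "0 < \<delta>" "\<delta> \<le> r"
    "\<And>p q x1 v1 lam1 x2 v2 lam2. \<lbrakk>local_kkt vb \<delta> x1 p q v1 lam1; local_kkt vb \<delta> x2 p q v2 lam2\<rbrakk>
      \<Longrightarrow> \<kappa> * (norm (x1 - x2))\<^sup>2 \<le> inner (v1 - v2) (x1 - x2)"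
proof (rule ccontr)
  assume contra: "\<not> thesis"
  note result = that
  have bad: "\<exists>x1 p1 q1 v1 lam1 x2 p2 q2 v2 lam2. local_kkt vb (min r e) x1 p1 q1 v1 lam1 \<and>
      local_kkt vb (min r e) x2 p2 q2 v2 lam2 \<and> x1 \<noteq> x2 \<and>
      (p2 = p1 \<and> q2 = q1 \<and> inner (v1 - v2) (x1 - x2) < e * (norm (x1 - x2))\<^sup>2)" (is ?P) if e: "0 < e" for e
  proof (rule ccontr)
    assume neg: "\<not> ?P"
    have "e * (norm (x1 - x2))\<^sup>2 \<le> inner (v1 - v2) (x1 - x2)"
      if "local_kkt vb (min r e) x1 p q v1 lam1" "local_kkt vb (min r e) x2 p q v2 lam2" for p q x1 v1 lam1 x2 v2 lam2
    proof (rule leI, rule notI, rule notE[OF neg], intro exI conjI)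
      assume "inner (v1 - v2) (x1 - x2) < e * (norm (x1 - x2))\<^sup>2"
      then show "inner (v1 - v2) (x1 - x2) < e * (norm (x1 - x2))\<^sup>2" "x1 \<noteq> x2" by auto
    qed (rule that refl)+
    moreover have "0 < min r e" "min r e \<le> r" using e r_pos by auto
    ultimately have thesis by (intro result[OF e])
    with contra show False ..
  qed
  obtain X1 P Q V1 L1 X2 P2 Q2 V2 L2 e u l1 l2 where
    kkt1: "\<And>k. local_kkt vb r (X1 k) (P k) (Q k) (V1 k) (L1 k)" and kkt2': "\<And>k. local_kkt vb r (X2 k) (P2
        k) (Q2 k) (V2 k) (L2 k)"
    and s': "\<And>k. 0 < norm (X1 k - X2 k)"
    and R: "\<And>k. P2 k = P k \<and> Q2 k = Q k \<and> inner (V1 k - V2 k) (X1 k - X2 k) < e k * (norm (X1 k - X2 k))\<^sup>2"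
    and e: "\<And>k. 0 < e k" "e \<longlonglongrightarrow> 0" and t: "X1 \<longlonglongrightarrow> xb" "P
        \<longlonglongrightarrow> pb" "Q \<longlonglongrightarrow> qb" and t2: "X2 \<longlonglongrightarrow> xb" "P2
            \<longlonglongrightarrow> pb" "Q2 \<longlonglongrightarrow> qb"
    and u': "(\<lambda>k. (X1 k - X2 k) /\<^sub>R norm (X1 k - X2 k)) \<longlonglongrightarrow> u" and u0: "u \<noteq> 0"
    and L: "L1 \<longlonglongrightarrow> l1" "L2 \<longlonglongrightarrow> l2" and mid: "(l1 + l2) /\<^sub>R 2 \<in>
        multipliers f \<phi> xb pb qb vb"
    by (rule local_kkt_violation_limit[of vb, OF bad]) (assumption, rule that)
  have P2: "P2 = P" "Q2 = Q" using R by auto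
  have kkt2: "local_kkt vb r (X2 k) (P k) (Q k) (V2 k) (L2 k)" for k using kkt2'[of k] unfolding P2 .
  define s where "s k = norm (X1 k - X2 k)" for k
  have s: "0 < s k" for k using s' by (simp add: s_def)
  have s0: "s \<longlonglongrightarrow> 0" using tendsto_norm[OF tendsto_diff[OF t(1) t2(1)]] by (simp add: s_def[abs_def])
  have u: "(\<lambda>k. (X1 k - X2 k) /\<^sub>R s k) \<longlonglongrightarrow> u" using u' by (simp add: s_def)
  have z: "(\<lambda>k. norm (P k - P k) / s k) \<longlonglongrightarrow> 0" "(\<lambda>k. norm (Q k - Q k) / s k)
      \<longlonglongrightarrow> 0" by simp_all
  let ?a = "\<lambda>k. inner (V1 k - V2 k) (X1 k - X2 k) / (s k)\<^sup>2"
  let ?\<phi>1 = "\<lambda>i k. \<phi> i (X1 k, P k)" and ?\<phi>2 = "\<lambda>i k. \<phi> i (X2 k, P k)"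
  let ?g = "\<lambda>i k. inner (grad_x (\<phi> i) (X1 k, P k) + grad_x (\<phi> i) (X2 k, P k)) (X1 k - X2 k) / 2"
  let ?\<Delta> = "\<lambda>i k. L1 k $ i - L2 k $ i"
  have F: "X1 k \<in> feasible_set \<phi> (P k)" "X2 k \<in> feasible_set \<phi> (P k)" for k
    using kkt1[of k] kkt2[of k] by (simp_all add: local_kkt_def)
  have M: "L1 k \<in> multipliers f \<phi> (X1 k) (P k) (Q k) (V1 k)" "L2 k \<in> multipliers f \<phi> (X2 k) (P k)
      (Q k) (V2 k)" for k
    using kkt1[of k] kkt2[of k] by (simp_all add: local_kkt_def)
  note M' = M(1)[unfolded multipliers_iff[OF F(1)]] M(2)[unfolded multipliers_iff[OF F(2)]]
  have mult: "0 \<le> L1 k $ i" "L1 k $ i * \<phi> i (X1 k, P k) = 0" "\<phi> i (X1 k, P k) \<le> 0"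
    "0 \<le> L2 k $ i" "L2 k $ i * \<phi> i (X2 k, P k) = 0" "\<phi> i (X2 k, P k) \<le> 0" for i k
    using M'[of k] F[of k] unfolding feasible_set_def by blast+
  have V: "V1 k = lagrangian f \<phi> (L1 k) (X1 k, P k, Q k)" "V2 k = lagrangian f \<phi> (L2 k) (X2 k, P k, Q k)" for k
    using M[of k] by (simp_all add: multipliers_def)
  have lim1: "(\<lambda>k. ?a k - (\<Sum>i\<in>UNIV. ?\<Delta> i k * (?g i k / (s k)\<^sup>2)))
      \<longlonglongrightarrow> lagrangian_quadratic ((l1 + l2) /\<^sub>R 2) u"
    by (rule lagrangian_difference_tendsto[OF t(1) t2(1) t(2) t(2) t(3) t(3) s u z L V])
  define S where "S k = (\<Sum>i\<in>UNIV. ?\<Delta> i k * (?\<phi>1 i k - ?\<phi>2 i k) / (s k)\<^sup>2)" for k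
  have trap: "(\<lambda>k. (?\<phi>1 i k - ?\<phi>2 i k - ?g i k) / (s k)\<^sup>2) \<longlonglongrightarrow> 0" for i
  proof (rule tendstoI)
    fix \<epsilon> :: real assume "\<epsilon> > 0"
    then have "\<epsilon> / 2 > 0" by simp
    from trapezoid_estimate[OF r_pos phi_deriv grad_strict this, of i] obtain d' where d': "0 < d'"
      "\<And>x y p. x \<in> ball xb d' \<Longrightarrow> y \<in> ball xb d' \<Longrightarrow> p \<in> ball pb d' \<Longrightarrow>
      \<bar>\<phi> i (x, p) - \<phi> i (y, p) - inner (grad_x (\<phi> i) (x, p) + grad_x (\<phi> i) (y, p)) (x - y) /
          2\<bar> \<le> \<epsilon> / 2 * (norm (x - y))\<^sup>2"
      by blast
    have "\<forall>\<^sub>F k in sequentially. X1 k \<in> ball xb d'" "\<forall>\<^sub>F k in sequentially. X2 k \<in> ball xb d'"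
      "\<forall>\<^sub>F k in sequentially. P k \<in> ball pb d'"
      using topological_tendstoD[OF t(1) open_ball] topological_tendstoD[OF t2(1) open_ball]
        topological_tendstoD[OF t(2) open_ball] d'(1) by simp_all
    then show "\<forall>\<^sub>F k in sequentially. dist ((?\<phi>1 i k - ?\<phi>2 i k - ?g i k) / (s k)\<^sup>2) 0 < \<epsilon>"
    proof eventually_elim
      case (elim k)
      have "\<bar>?\<phi>1 i k - ?\<phi>2 i k - ?g i k\<bar> \<le> \<epsilon> / 2 * (s k)\<^sup>2" using d'(2)[OF
          elim] by (simp add: s_def)
      then have "\<bar>?\<phi>1 i k - ?\<phi>2 i k - ?g i k\<bar> / (s k)\<^sup>2 \<le> \<epsilon> / 2" using s[of k]
          by (simp add: pos_divide_le_eq)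
      also have "\<dots> < \<epsilon>" using \<open>\<epsilon> > 0\<close> by simp
      finally show ?case by simp
    qed
  qed
  have "(\<lambda>k. \<Sum>i\<in>UNIV. ?\<Delta> i k * ((?\<phi>1 i k - ?\<phi>2 i k - ?g i k) / (s k)\<^sup>2))
      \<longlonglongrightarrow> (\<Sum>i\<in>UNIV. (l1 $ i - l2 $ i) * 0)"
    by (intro tendsto_intros trap tendsto_vec_nth[OF L(1)] tendsto_vec_nth[OF L(2)])
  then have lim2: "(\<lambda>k. \<Sum>i\<in>UNIV. ?\<Delta> i k * ((?\<phi>1 i k - ?\<phi>2 i k - ?g i k) / (s
      k)\<^sup>2)) \<longlonglongrightarrow> 0" by simp
  have lim3: "(\<lambda>k. ?a k - S k) \<longlonglongrightarrow> lagrangian_quadratic ((l1 + l2) /\<^sub>R 2) u"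
  proof -
    have eq: "?a k - S k = (?a k - (\<Sum>i\<in>UNIV. ?\<Delta> i k * (?g i k / (s k)\<^sup>2))) -
        (\<Sum>i\<in>UNIV. ?\<Delta> i k * ((?\<phi>1 i k - ?\<phi>2 i k - ?g i k) / (s k)\<^sup>2))" for k
    proof -
      have tm: "c * D / t = c * (g / t) + c * ((D - g) / t)" for c D g t :: real
        by (simp add: diff_divide_distrib algebra_simps)
      have "S k = (\<Sum>i\<in>UNIV. ?\<Delta> i k * (?g i k / (s k)\<^sup>2) + ?\<Delta> i k * ((?\<phi>1 i k -
          ?\<phi>2 i k - ?g i k) / (s k)\<^sup>2))"
        unfolding S_def by (intro sum.cong refl) (rule tm)
      then show ?thesis unfolding sum.distrib by linarith
    qed
    show ?thesis unfolding eq using tendsto_diff[OF lim1 lim2] unfolding diff_zero .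
  qed
  have compl: "?\<Delta> i k * (?\<phi>1 i k - ?\<phi>2 i k) = L1 k $ i * (- ?\<phi>2 i k) + L2 k $ i * (- ?\<phi>1 i k)" for i k
    using mult(2)[where k = k and i = i] mult(5)[where k = k and i = i] by (auto simp: algebra_simps)
  have pos1: "0 \<le> L1 k $ i * (- ?\<phi>2 i k)" and pos2: "0 \<le> L2 k $ i * (- ?\<phi>1 i k)" for i k
    using mult_nonneg_nonpos[OF mult(1) mult(6)] mult_nonneg_nonpos[OF mult(4) mult(3)] by simp_all
  have S0: "0 \<le> S k" for k unfolding S_def compl by (intro sum_nonneg divide_nonneg_nonneg add_nonneg_nonneg pos1 pos2) auto
  have a0: "?a k \<le> e k" for k
    using R[of k] s[of k] by (simp add: pos_divide_le_eq s_def less_imp_le)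
  have "lagrangian_quadratic ((l1 + l2) /\<^sub>R 2) u \<le> 0"
  proof (rule LIMSEQ_le[OF lim3 e(2)])
    have "?a k - S k \<le> e k" for k using S0[of k] a0[of k] by linarith
    then show "\<exists>N. \<forall>k\<ge>N. ?a k - S k \<le> e k" by blast
  qed
  moreover have "lagrangian_quadratic ((l1 + l2) /\<^sub>R 2) u > 0"
  proof -
    \<comment> \<open>The scaled complementarity products stay bounded, hence they vanish after one more factor \<open>s\<close>.\<close>
    have Sle: "S k \<le> e k - (?a k - S k)" for k using a0[of k] by linarith
    have Ss: "(\<lambda>k. S k * s k) \<longlonglongrightarrow> 0"
    proof (rule tendsto_sandwich[OF _ _ tendsto_const[of 0]])
      show "\<forall>\<^sub>F k in sequentially. 0 \<le> S k * s k" 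
        by (intro always_eventually allI mult_nonneg_nonneg S0 less_imp_le[OF s])
      show "\<forall>\<^sub>F k in sequentially. S k * s k \<le> (e k - (?a k - S k)) * s k"
        by (intro always_eventually allI mult_right_mono Sle less_imp_le[OF s])
      show "(\<lambda>k. (e k - (?a k - S k)) * s k) \<longlonglongrightarrow> 0"
        using tendsto_mult[OF tendsto_diff[OF e(2) lim3] s0] by simp
    qed
    have q: "(\<lambda>k. (?\<phi>1 i k - ?\<phi>2 i k) / s k) \<longlonglongrightarrow> inner (grad_x (\<phi> i)
        (xb, pb)) u" for i
      by (rule difference_quotients_tendsto(1)[OF t(1) t2(1) t(2) t(2) s u z(1)])
    have up: "L1 k $ i * (- ?\<phi>2 i k) / s k \<le> S k * s k" "L2 k $ i * (- ?\<phi>1 i k) / s k \<le> S k * s k" for i k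
    proof -
      have bound: "(L1 k $ i * (- ?\<phi>2 i k) + L2 k $ i * (- ?\<phi>1 i k)) / (s k)\<^sup>2 \<le> S k"
        unfolding S_def compl
      proof (rule member_le_sum)
        fix j show "0 \<le> (L1 k $ j * (- ?\<phi>2 j k) + L2 k $ j * (- ?\<phi>1 j k)) / (s k)\<^sup>2"
          by (intro divide_nonneg_nonneg add_nonneg_nonneg pos1 pos2 zero_le_power2)
      qed auto
      have gen: "a / t + b / t \<le> c" if "(a + b) / t\<^sup>2 * t \<le> c" "0 < t" for a b c t :: real
      proof -
        have "(a + b) / t\<^sup>2 * t = a / t + b / t" using that(2) by (simp add: field_simps power2_eq_square)
        then show ?thesis using that(1) by simp
      qed
      from bound have "(L1 k $ i * (- ?\<phi>2 i k) + L2 k $ i * (- ?\<phi>1 i k)) / (s k)\<^sup>2 * s k \<le> S k * s k"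
        using s[of k] by (intro mult_right_mono) auto
      then have "(L1 k $ i * (- ?\<phi>2 i k)) / s k + (L2 k $ i * (- ?\<phi>1 i k)) / s k \<le> S k * s k"
        by (rule gen[OF _ s])
      moreover have "0 \<le> (L1 k $ i * (- ?\<phi>2 i k)) / s k" "0 \<le> (L2 k $ i * (- ?\<phi>1 i k)) / s k"
        by (rule divide_nonneg_pos[OF pos1 s] divide_nonneg_pos[OF pos2 s])+
      ultimately show "L1 k $ i * (- ?\<phi>2 i k) / s k \<le> S k * s k" "L2 k $ i * (- ?\<phi>1 i k) / s k \<le> S
          k * s k" by linarith+
    qed
    have c1: "l1 $ i * inner (grad_x (\<phi> i) (xb, pb)) u = 0" for i
    proof -
      have "(\<lambda>k. L1 k $ i * ((?\<phi>1 i k - ?\<phi>2 i k) / s k)) \<longlonglongrightarrow> l1 $ i * inner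
          (grad_x (\<phi> i) (xb, pb)) u"
        by (intro tendsto_mult q tendsto_vec_nth[OF L(1)])
      moreover have "(\<lambda>k. L1 k $ i * ((?\<phi>1 i k - ?\<phi>2 i k) / s k)) \<longlonglongrightarrow> 0"
      proof (rule tendsto_sandwich[OF _ _ tendsto_const[of 0] Ss])
        have e: "L1 k $ i * ((?\<phi>1 i k - ?\<phi>2 i k) / s k) = L1 k $ i * (- ?\<phi>2 i k) / s k" for k
          using mult(2)[where k = k and i = i] by (auto simp: algebra_simps)
        show "\<forall>\<^sub>F k in sequentially. L1 k $ i * ((?\<phi>1 i k - ?\<phi>2 i k) / s k) \<le> S k * s k"
          unfolding e using up by (intro always_eventually) blast
        show "\<forall>\<^sub>F k in sequentially. 0 \<le> L1 k $ i * ((?\<phi>1 i k - ?\<phi>2 i k) / s k)"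
          unfolding e using pos1 s by (intro always_eventually allI divide_nonneg_pos)
      qed
      ultimately show ?thesis by (rule LIMSEQ_unique)
    qed
    have c2: "l2 $ i * inner (grad_x (\<phi> i) (xb, pb)) u = 0" for i
    proof -
      have "(\<lambda>k. - (L2 k $ i * ((?\<phi>1 i k - ?\<phi>2 i k) / s k))) \<longlonglongrightarrow> - (l2 $ i *
          inner (grad_x (\<phi> i) (xb, pb)) u)"
        by (intro tendsto_minus tendsto_mult q tendsto_vec_nth[OF L(2)])
      moreover have "(\<lambda>k. - (L2 k $ i * ((?\<phi>1 i k - ?\<phi>2 i k) / s k))) \<longlonglongrightarrow> 0"
      proof (rule tendsto_sandwich[OF _ _ tendsto_const[of 0] Ss])
        have e: "- (L2 k $ i * ((?\<phi>1 i k - ?\<phi>2 i k) / s k)) = L2 k $ i * (- ?\<phi>1 i k) / s k" for k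
          using mult(5)[where k = k and i = i] by (auto simp: algebra_simps)
        show "\<forall>\<^sub>F k in sequentially. - (L2 k $ i * ((?\<phi>1 i k - ?\<phi>2 i k) / s k)) \<le> S k * s k"
          unfolding e using up by (intro always_eventually) blast
        show "\<forall>\<^sub>F k in sequentially. 0 \<le> - (L2 k $ i * ((?\<phi>1 i k - ?\<phi>2 i k) / s k))"
          unfolding e using pos2 s by (intro always_eventually allI divide_nonneg_pos)
      qed
      ultimately have "- (l2 $ i * inner (grad_x (\<phi> i) (xb, pb)) u) = 0" by (rule LIMSEQ_unique)
      then show ?thesis by simp
    qed
    have "inner (grad_x (\<phi> i) (xb, pb)) u = 0" if "((l1 + l2) /\<^sub>R 2) $ i > 0" for i
    proof -
      have "l1 $ i \<noteq> 0 \<or> l2 $ i \<noteq> 0" using that by auto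
      then show ?thesis using c1[of i] c2[of i] by auto
    qed
    then show ?thesis
      using G[unfolded GSSOSC_iff, rule_format, OF mid, of u] u0 by blast
  qed
  ultimately show False by simp
qed

end

section \<open>Solutions with a common support\<close>

context parametric_mfcq_system
begin

definition supported_on :: "'s set \<Rightarrow> real^'n \<Rightarrow> real^'l \<Rightarrow> real^'s \<Rightarrow> bool" where
  "supported_on J x p lam \<longleftrightarrow> (\<forall>i. i \<notin> J \<longrightarrow> lam $ i = 0) \<and>
      (\<forall>i\<in>J. \<phi> i (x, p) = 0)"

text \<open>On a common support the constraints with index in \<open>J\<close> are equations at both points, so the limit direction
  is orthogonal to their gradients. By independence, the multipliers differ by \<open>O(s)\<close>, \<open>s\<close> being the distance
  of the points; hence the term with averaged gradients disappears in the limit and the quadratic form vanishes at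
  the limit direction, against GSSOSC.\<close>

lemma common_support_lipschitz:
  assumes G: "GSSOSC f \<phi> xb pb qb vb"
    and J: "independent_family J (\<lambda>i. grad_x (\<phi> i) (xb, pb))"
  obtains M \<delta> where "0 \<le> M" "0 < \<delta>" "\<delta> \<le> r"
    "\<And>x1 p1 q1 v1 lam1 x2 p2 q2 v2 lam2. \<lbrakk>local_kkt vb \<delta> x1 p1 q1 v1 lam1; local_kkt vb \<delta>
        x2 p2 q2 v2 lam2;
        supported_on J x1 p1 lam1; supported_on J x2 p2 lam2\<rbrakk>
      \<Longrightarrow> norm (x1 - x2) \<le> M * (norm (p1 - p2) + norm (q1 - q2) + norm (v1 - v2))"
proof (rule ccontr)
  assume contra: "\<not> thesis"
  note result = that
  have bad: "\<exists>x1 p1 q1 v1 lam1 x2 p2 q2 v2 lam2. local_kkt vb (min r e) x1 p1 q1 v1 lam1 \<and>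
      local_kkt vb (min r e) x2 p2 q2 v2 lam2 \<and> x1 \<noteq> x2 \<and>
      (supported_on J x1 p1 lam1 \<and> supported_on J x2 p2 lam2 \<and>
       norm (p1 - p2) + norm (q1 - q2) + norm (v1 - v2) < e * norm (x1 - x2))" (is ?P) if e: "0 < e" for e
  proof (rule ccontr)
    assume neg: "\<not> ?P"
    have "norm (x1 - x2) \<le> 1 / e * (norm (p1 - p2) + norm (q1 - q2) + norm (v1 - v2))"
      if "local_kkt vb (min r e) x1 p1 q1 v1 lam1" "local_kkt vb (min r e) x2 p2 q2 v2 lam2"
        "supported_on J x1 p1 lam1" "supported_on J x2 p2 lam2" for x1 p1 q1 v1 lam1 x2 p2 q2 v2 lam2
    proof (rule leI, rule notI, rule notE[OF neg], intro exI conjI)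
      assume less: "1 / e * (norm (p1 - p2) + norm (q1 - q2) + norm (v1 - v2)) < norm (x1 - x2)"
      then show "norm (p1 - p2) + norm (q1 - q2) + norm (v1 - v2) < e * norm (x1 - x2)"
        using e by (simp add: field_simps)
      have "0 \<le> 1 / e * (norm (p1 - p2) + norm (q1 - q2) + norm (v1 - v2))"
        using e by (intro mult_nonneg_nonneg add_nonneg_nonneg) auto
      with less show "x1 \<noteq> x2" by auto
    qed (rule that)+
    moreover have "0 < min r e" "min r e \<le> r" "0 \<le> 1 / e" using e r_pos by auto
    ultimately have thesis by (intro result[of "1 / e"])
    with contra show False ..
  qed
  obtain X1 P1 Q1 V1 L1 X2 P2 Q2 V2 L2 e u l1 l2 where
    kkt: "\<And>k. local_kkt vb r (X1 k) (P1 k) (Q1 k) (V1 k) (L1 k)" "\<And>k. local_kkt vb r (X2 k) (P2 k) (Q2 k) (V2 k) (L2 k)"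
    and s': "\<And>k. 0 < norm (X1 k - X2 k)"
    and R: "\<And>k. supported_on J (X1 k) (P1 k) (L1 k) \<and> supported_on J (X2 k) (P2 k) (L2 k) \<and>
      norm (P1 k - P2 k) + norm (Q1 k - Q2 k) + norm (V1 k - V2 k) < e k * norm (X1 k - X2 k)"
    and "\<And>k. 0 < e k" and e: "e \<longlonglongrightarrow> 0"
    and t1: "X1 \<longlonglongrightarrow> xb" "P1 \<longlonglongrightarrow> pb" "Q1 \<longlonglongrightarrow> qb" and
        t2: "X2 \<longlonglongrightarrow> xb" "P2 \<longlonglongrightarrow> pb" "Q2 \<longlonglongrightarrow> qb"
    and u: "(\<lambda>k. (X1 k - X2 k) /\<^sub>R norm (X1 k - X2 k)) \<longlonglongrightarrow> u" and u0: "u \<noteq> 0"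
    and L: "L1 \<longlonglongrightarrow> l1" "L2 \<longlonglongrightarrow> l2" and mid: "(l1 + l2) /\<^sub>R 2 \<in>
        multipliers f \<phi> xb pb qb vb"
    by (rule local_kkt_violation_limit[of vb, OF bad]) (assumption, rule that)
  have supp: "\<And>k. supported_on J (X1 k) (P1 k) (L1 k)" "\<And>k. supported_on J (X2 k) (P2 k) (L2 k)"
    using R by blast+
  define s where "s k = norm (X1 k - X2 k)" for k
  have s: "0 < s k" for k using s' by (simp add: s_def)
  have u': "(\<lambda>k. (X1 k - X2 k) /\<^sub>R s k) \<longlonglongrightarrow> u" using u by (simp add: s_def)
  have ratio: "(norm (P1 k - P2 k) + norm (Q1 k - Q2 k) + norm (V1 k - V2 k)) / s k \<le> e k" for k
    using R[of k] s[of k] by (simp add: s_def pos_divide_le_eq)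
  have z: "(\<lambda>k. norm (P1 k - P2 k) / s k) \<longlonglongrightarrow> 0" "(\<lambda>k. norm (Q1 k - Q2 k) / s
      k) \<longlonglongrightarrow> 0"
    "(\<lambda>k. norm (V1 k - V2 k) / s k) \<longlonglongrightarrow> 0"
  proof -
    have *: "(\<lambda>k. a k / s k) \<longlonglongrightarrow> 0" if a: "\<And>k. 0 \<le> a k"
      "\<And>k. a k \<le> norm (P1 k - P2 k) + norm (Q1 k - Q2 k) + norm (V1 k - V2 k)" for a
    proof (rule tendsto_sandwich[OF _ _ tendsto_const[of 0] e])
      show "\<forall>\<^sub>F k in sequentially. 0 \<le> a k / s k"
        by (intro always_eventually allI divide_nonneg_pos a(1) s)
      show "\<forall>\<^sub>F k in sequentially. a k / s k \<le> e k"
        by (intro always_eventually allI order_trans[OF divide_right_mono[OF a(2)] ratio] less_imp_le[OF s])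
    qed
    show "(\<lambda>k. norm (P1 k - P2 k) / s k) \<longlonglongrightarrow> 0" by (rule *) auto
    show "(\<lambda>k. norm (Q1 k - Q2 k) / s k) \<longlonglongrightarrow> 0" by (rule *) auto
    show "(\<lambda>k. norm (V1 k - V2 k) / s k) \<longlonglongrightarrow> 0" by (rule *) auto
  qed
  have V: "V1 k = lagrangian f \<phi> (L1 k) (X1 k, P1 k, Q1 k)"
    "V2 k = lagrangian f \<phi> (L2 k) (X2 k, P2 k, Q2 k)" for k
    using kkt[of k] by (simp_all add: local_kkt_def multipliers_def)
  let ?a = "\<lambda>k. inner (V1 k - V2 k) (X1 k - X2 k) / (s k)\<^sup>2"
  let ?G1 = "\<lambda>i k. grad_x (\<phi> i) (X1 k, P1 k)" and ?G2 = "\<lambda>i k. grad_x (\<phi> i) (X2 k, P2 k)"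
  let ?F = "\<lambda>k. f (X1 k, P1 k, Q1 k) - f (X2 k, P2 k, Q2 k)"
  let ?\<Delta> = "\<lambda>i k. L1 k $ i - L2 k $ i"
  have lim1: "(\<lambda>k. ?a k - (\<Sum>i\<in>UNIV. ?\<Delta> i k * (inner (?G1 i k + ?G2 i k) (X1 k - X2 k) / 2 /
      (s k)\<^sup>2)))
      \<longlonglongrightarrow> lagrangian_quadratic ((l1 + l2) /\<^sub>R 2) u"
    by (rule lagrangian_difference_tendsto[OF t1(1) t2(1) t1(2) t2(2) t1(3) t2(3) s u' z(1,2) L V])
  note dq = difference_quotients_tendsto[OF t1(1) t2(1) t1(2) t2(2) s u' z(1)]
  note g1 = box_tendsto(2)[OF t1(1,2) base_in_box(1,2)]
  note g2 = box_tendsto(2)[OF t2(1,2) base_in_box(1,2)]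
  have off: "?\<Delta> i k = 0" if "i \<notin> J" for i k using supp that unfolding supported_on_def by simp
  have orth: "inner (grad_x (\<phi> i) (xb, pb)) u = 0" if i: "i \<in> J" for i
  proof -
    have "(\<lambda>k. (\<phi> i (X1 k, P1 k) - \<phi> i (X2 k, P2 k)) / s k) = (\<lambda>k. 0)"
      using supp i unfolding supported_on_def by simp
    then show ?thesis using dq(1)[of i] by (simp add: LIMSEQ_const_iff)
  qed
  \<comment> \<open>independence makes the multiplier difference of the order of the distance of the solutions\<close>
  obtain \<eta> M where \<eta>: "0 < \<eta>" and M: "0 \<le> M" and coeff: "\<And>g' c. \<forall>j\<in>J. norm (g' j
      - grad_x (\<phi> j) (xb, pb)) \<le> \<eta>
       \<Longrightarrow> (\<Sum>j\<in>J. \<bar>c j\<bar>) \<le> M * norm (\<Sum>j\<in>J. c j *\<^sub>R g' j)"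
    by (rule independent_family_coefficient_bound[OF finite J]) (rule that)
  define W where "W k = (V1 k - V2 k) /\<^sub>R s k - (?F k /\<^sub>R s k + (\<Sum>i\<in>UNIV. L2 k $ i *\<^sub>R
      ((?G1 i k - ?G2 i k) /\<^sub>R s k)))" for k
  have W: "(\<Sum>j\<in>J. (?\<Delta> j k / s k) *\<^sub>R ?G1 j k) = W k" for k
  proof -
    have "(\<Sum>j\<in>J. (?\<Delta> j k / s k) *\<^sub>R ?G1 j k) = (\<Sum>j\<in>UNIV. (?\<Delta> j k / s k) *\<^sub>R ?G1 j k)"
      by (rule sum.mono_neutral_left) (use off in auto)
    also have "\<dots> = (\<Sum>j\<in>UNIV. (L1 k $ j *\<^sub>R ?G1 j k - L2 k $ j *\<^sub>R ?G2 j k) /\<^sub>R s k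
        - L2 k $ j *\<^sub>R ((?G1 j k - ?G2 j k) /\<^sub>R s k))"
      by (intro sum.cong refl) (simp add: algebra_simps divide_inverse)
    also have "\<dots> = (\<Sum>j\<in>UNIV. L1 k $ j *\<^sub>R ?G1 j k - L2 k $ j *\<^sub>R ?G2 j k) /\<^sub>R s k
        - (\<Sum>j\<in>UNIV. L2 k $ j *\<^sub>R ((?G1 j k - ?G2 j k) /\<^sub>R s k))"
      by (simp only: sum_subtractf flip: scaleR_sum_right)
    also have "(\<Sum>j\<in>UNIV. L1 k $ j *\<^sub>R ?G1 j k - L2 k $ j *\<^sub>R ?G2 j k) = (V1 k - V2 k) - ?F k"
      unfolding V lagrangian_def by (simp add: sum_subtractf)
    finally show ?thesis by (simp add: W_def scaleR_diff_right)
  qed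
  have "(\<lambda>k. (V1 k - V2 k) /\<^sub>R s k) \<longlonglongrightarrow> 0"
    by (rule Lim_null_comparison[OF always_eventually z(3)]) (use s in \<open>simp add: divide_inverse_commute
        less_imp_le\<close>)
  then have "W \<longlonglongrightarrow> 0 - (A u + (\<Sum>i\<in>UNIV. l2 $ i *\<^sub>R H i u))"
    unfolding W_def[abs_def] by (intro tendsto_intros dq(3)[OF t1(3) t2(3) z(2)] dq(2) tendsto_vec_nth[OF L(2)])
  then have nW: "(\<lambda>k. M * norm (W k)) \<longlonglongrightarrow> M * norm (0 - (A u + (\<Sum>i\<in>UNIV. l2 $
      i *\<^sub>R H i u)))"
    by (intro tendsto_intros)
  have cbound: "\<forall>\<^sub>F k in sequentially. \<forall>i\<in>J. \<bar>?\<Delta> i k / s k\<bar> \<le> M * norm (W k)"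
  proof -
    have "\<forall>\<^sub>F k in sequentially. \<forall>j. norm (?G1 j k - grad_x (\<phi> j) (xb, pb)) \<le> \<eta>"
    proof (rule eventually_all_finite)
      fix j
      have "\<forall>\<^sub>F k in sequentially. dist (?G1 j k) (grad_x (\<phi> j) (xb, pb)) < \<eta>" using
          tendstoD[OF g1 \<eta>] .
      then show "\<forall>\<^sub>F k in sequentially. norm (?G1 j k - grad_x (\<phi> j) (xb, pb)) \<le> \<eta>"
        by eventually_elim (simp add: dist_norm)
    qed
    then show ?thesis
    proof eventually_elim
      case (elim k)
      have "(\<Sum>j\<in>J. \<bar>?\<Delta> j k / s k\<bar>) \<le> M * norm (\<Sum>j\<in>J. (?\<Delta> j k / s k)
          *\<^sub>R ?G1 j k)"
        by (rule coeff) (use elim in blast)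
      then have le: "(\<Sum>j\<in>J. \<bar>?\<Delta> j k / s k\<bar>) \<le> M * norm (W k)" unfolding W .
      show ?case
      proof
        fix i assume "i \<in> J"
        then have "\<bar>?\<Delta> i k / s k\<bar> \<le> (\<Sum>j\<in>J. \<bar>?\<Delta> j k / s k\<bar>)" by (rule
            member_le_sum) auto
        with le show "\<bar>?\<Delta> i k / s k\<bar> \<le> M * norm (W k)" by linarith
      qed
    qed
  qed
  have "(\<lambda>k. ?\<Delta> i k * (inner (?G1 i k + ?G2 i k) (X1 k - X2 k) / 2 / (s k)\<^sup>2))
      \<longlonglongrightarrow> 0" for i
  proof (cases "i \<in> J")
    case False
    then show ?thesis by (simp add: off)
  next
    case True
    define w where "w k = inner ((?G1 i k + ?G2 i k) /\<^sub>R 2) ((X1 k - X2 k) /\<^sub>R s k)" for k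
    have "w \<longlonglongrightarrow> inner ((grad_x (\<phi> i) (xb, pb) + grad_x (\<phi> i) (xb, pb)) /\<^sub>R 2) u"
      unfolding w_def[abs_def] by (intro tendsto_intros g1 g2 u')
    then have "w \<longlonglongrightarrow> 0" using orth[OF True] by (simp add: inner_add_left)
    then have null: "(\<lambda>k. M * norm (W k) * \<bar>w k\<bar>) \<longlonglongrightarrow> 0"
      using tendsto_mult[OF nW tendsto_rabs[of w 0 sequentially]] by simp
    have gen: "c * (a / 2 / t\<^sup>2) = c / t * (inverse t * (inverse 2 * a))" for c a t :: real
      by (simp add: power2_eq_square divide_simps)
    have eq: "?\<Delta> i k * (inner (?G1 i k + ?G2 i k) (X1 k - X2 k) / 2 / (s k)\<^sup>2) = (?\<Delta> i k / s k) * w k" for k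
      unfolding w_def inner_scaleR_left inner_scaleR_right by (rule gen)
    show ?thesis unfolding eq
    proof (rule Lim_null_comparison[OF _ null])
      show "\<forall>\<^sub>F k in sequentially. norm (?\<Delta> i k / s k * w k) \<le> M * norm (W k) * \<bar>w k\<bar>"
        using cbound
      proof eventually_elim
        case (elim k)
        then have "\<bar>?\<Delta> i k / s k\<bar> * \<bar>w k\<bar> \<le> M * norm (W k) * \<bar>w k\<bar>" using
            True by (intro mult_right_mono) auto
        then show ?case by (simp only: real_norm_def abs_mult)
      qed
    qed
  qed
  then have "(\<lambda>k. \<Sum>i\<in>UNIV. ?\<Delta> i k * (inner (?G1 i k + ?G2 i k) (X1 k - X2 k) / 2 / (s
      k)\<^sup>2)) \<longlonglongrightarrow> 0"
    by (rule tendsto_null_sum)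
  moreover have "?a \<longlonglongrightarrow> 0"
  proof (rule Lim_null_comparison[OF always_eventually z(3)], rule allI)
    fix k
    have "\<bar>inner (V1 k - V2 k) (X1 k - X2 k)\<bar> \<le> norm (V1 k - V2 k) * s k"
      unfolding s_def by (rule Cauchy_Schwarz_ineq2)
    then have "\<bar>inner (V1 k - V2 k) (X1 k - X2 k)\<bar> / (s k)\<^sup>2 \<le> norm (V1 k - V2 k) * s k / (s k)\<^sup>2"
      by (rule divide_right_mono) simp
    then show "norm (?a k) \<le> norm (V1 k - V2 k) / s k"
      using s[of k] by (simp add: power2_eq_square)
  qed
  ultimately have "lagrangian_quadratic ((l1 + l2) /\<^sub>R 2) u = 0 - 0"
    by (intro LIMSEQ_unique[OF lim1] tendsto_diff)
  moreover have "inner (grad_x (\<phi> i) (xb, pb)) u = 0" if pos: "((l1 + l2) /\<^sub>R 2) $ i > 0" for i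
  proof (cases "i \<in> J")
    case True then show ?thesis by (rule orth)
  next
    case False
    have "l1 $ i = 0" "l2 $ i = 0"
      using tendsto_vec_nth[OF L(1), of i] tendsto_vec_nth[OF L(2), of i] supp False
      unfolding supported_on_def by (simp_all add: LIMSEQ_const_iff)
    then show ?thesis using pos by simp
  qed
  ultimately show False
    using G[unfolded GSSOSC_iff, rule_format, OF mid, of u] u0 by simp
qed

end

section \<open>Existence of nearby solutions\<close>

lemma norm_le_of_strongly_monotone:
  fixes x y :: "'a::real_inner"
  assumes "0 < c" "c * (norm x)\<^sup>2 \<le> inner y x"
  shows "norm x \<le> 1 / c * norm y"
proof (cases "x = 0")
  case False
  have "c * norm x * norm x \<le> norm y * norm x"
    using assms(2) norm_cauchy_schwarz[of y x] by (simp add: power2_eq_square mult.assoc)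
  then have "c * norm x \<le> norm y" using False by simp
  then show ?thesis using assms(1) by (simp add: field_simps)
qed (use assms in auto)

context parametric_mfcq_system
begin

lemma multipliers_iff_active_cone:
  assumes "x \<in> feasible_set \<phi> p"
  shows "(\<exists>lam. lam \<in> multipliers f \<phi> x p q v) \<longleftrightarrow> v - f (x, p, q) \<in> active_cone x p"
proof
  assume "\<exists>lam. lam \<in> multipliers f \<phi> x p q v"
  then obtain lam where lam: "lam \<in> multipliers f \<phi> x p q v" ..
  note l = lam[unfolded multipliers_iff[OF assms]]
  have "(\<Sum>i\<in>UNIV. lam $ i *\<^sub>R grad_x (\<phi> i) (x, p)) \<in> active_cone x p"
    by (rule active_coneI) (use l in blast)+
  moreover have "v - f (x, p, q) = (\<Sum>i\<in>UNIV. lam $ i *\<^sub>R grad_x (\<phi> i) (x, p))" using l by auto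
  ultimately show "v - f (x, p, q) \<in> active_cone x p" by simp
next
  assume "v - f (x, p, q) \<in> active_cone x p"
  then obtain lam where lam: "v - f (x, p, q) = (\<Sum>i\<in>UNIV. lam $ i *\<^sub>R grad_x (\<phi> i) (x, p))"
      "\<And>i. 0 \<le> lam $ i" "\<And>i. lam $ i * \<phi> i (x, p) = 0" by (rule active_coneE) (rule that)
  have "v = f (x, p, q) + (\<Sum>i\<in>UNIV. lam $ i *\<^sub>R grad_x (\<phi> i) (x, p))" using lam(1) by (simp add:
      algebra_simps)
  then show "\<exists>lam. lam \<in> multipliers f \<phi> x p q v" unfolding multipliers_iff[OF assms] using lam(2,3) by blast
qed

lemma active_cone_normal_inequality:
  assumes x: "x \<in> ball xb r" "p \<in> ball pb r" "x \<in> feasible_set \<phi> p"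
    and n: "n \<in> active_cone x p" and y: "y \<in> ball xb r" "y \<in> feasible_set \<phi> p"
  shows "inner n (y - x) \<le> K * (norm d / \<sigma>) * norm n * (norm (y - x))\<^sup>2"
proof -
  have "n + f (x, p, qb) - f (x, p, qb) \<in> active_cone x p" using n by simp
  then obtain lam where lam: "lam \<in> multipliers f \<phi> x p qb (n + f (x, p, qb))"
    unfolding multipliers_iff_active_cone[OF x(3), symmetric] ..
  have "inner n (y - x) \<le> K * (\<Sum>i\<in>UNIV. lam $ i) * (norm (y - x))\<^sup>2"
    using multiplier_normal_inequality[OF x lam y] by simp
  also have "\<dots> \<le> K * (norm n * (norm d / \<sigma>)) * (norm (y - x))\<^sup>2"
    using multipliers_bound(1)[OF x lam] K_nonneg by (intro mult_right_mono mult_left_mono) auto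
  finally show ?thesis by (simp add: mult_ac)
qed

lemma active_cone_hypomonotone:
  assumes p: "p \<in> ball pb r"
    and x1: "x1 \<in> ball xb r" "x1 \<in> feasible_set \<phi> p" "n1 \<in> active_cone x1 p" "norm n1 \<le> N"
    and x2: "x2 \<in> ball xb r" "x2 \<in> feasible_set \<phi> p" "n2 \<in> active_cone x2 p" "norm n2 \<le> N"
  shows "- (2 * K * (norm d / \<sigma>) * N) * (norm (x1 - x2))\<^sup>2 \<le> inner (n1 - n2) (x1 - x2)"
proof -
  have c: "0 \<le> K * (norm d / \<sigma>)" using K_nonneg \<sigma>_pos by simp
  define m where "m = K * (norm d / \<sigma>) * N * (norm (x1 - x2))\<^sup>2"
  have "inner n1 (x2 - x1) \<le> K * (norm d / \<sigma>) * norm n1 * (norm (x2 - x1))\<^sup>2"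
    by (rule active_cone_normal_inequality[OF x1(1) p x1(2,3) x2(1,2)])
  also have "\<dots> \<le> K * (norm d / \<sigma>) * N * (norm (x2 - x1))\<^sup>2"
    using c x1(4) by (intro mult_right_mono mult_left_mono) auto
  finally have 1: "inner n1 (x2 - x1) \<le> m" by (simp add: norm_minus_commute m_def)
  have "inner n2 (x1 - x2) \<le> K * (norm d / \<sigma>) * norm n2 * (norm (x1 - x2))\<^sup>2"
    by (rule active_cone_normal_inequality[OF x2(1) p x2(2,3) x1(1,2)])
  also have "\<dots> \<le> K * (norm d / \<sigma>) * N * (norm (x1 - x2))\<^sup>2"
    using c x2(4) by (intro mult_right_mono mult_left_mono) auto
  finally have 2: "inner n2 (x1 - x2) \<le> m" by (simp only: m_def)
  have "inner (n1 - n2) (x1 - x2) = - inner n1 (x2 - x1) - inner n2 (x1 - x2)"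
    by (simp add: inner_diff_left inner_diff_right)
  then have "- 2 * m \<le> inner (n1 - n2) (x1 - x2)" using 1 2 by linarith
  moreover have "- (2 * K * (norm d / \<sigma>) * N) * (norm (x1 - x2))\<^sup>2 = - 2 * m"
    by (simp add: m_def)
  ultimately show ?thesis by (simp only:)
qed

text \<open>The comparison point may be feasible for a perturbed parameter, at a cost linear in the
  perturbation.\<close>

lemma base_normal_inequality:
  assumes lam: "lam \<in> multipliers f \<phi> xb pb qb vb"
    and y: "y \<in> ball xb r" "p \<in> ball pb r" "y \<in> feasible_set \<phi> p"
  shows "inner (vb - f (xb, pb, qb)) (y - xb)
    \<le> (\<Sum>i\<in>UNIV. lam $ i) * (K * (norm (y - xb))\<^sup>2 + K * (1 + r) * norm (p - pb))"
proof -
  have l: "\<And>i. 0 \<le> lam $ i" "\<And>i. lam $ i * \<phi> i (xb, pb) = 0"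
    and v: "vb - f (xb, pb, qb) = (\<Sum>i\<in>UNIV. lam $ i *\<^sub>R grad_x (\<phi> i) (xb, pb))"
    using lam base_feasible by (auto simp: multipliers_iff)
  have "inner (vb - f (xb, pb, qb)) (y - xb) = (\<Sum>i\<in>UNIV. lam $ i * inner (grad_x (\<phi> i) (xb, pb)) (y - xb))"
    by (simp add: v inner_sum_left)
  also have "\<dots> \<le> (\<Sum>i\<in>UNIV. lam $ i * (K * (norm (y - xb))\<^sup>2 + K * (1 + r) * norm (p - pb)))"
  proof (rule sum_mono)
    fix i
    have yr: "norm (y - xb) \<le> r" using y(1) by (simp add: dist_norm norm_minus_commute)
    have "\<phi> i (y, p) \<le> 0" using y(3) by (simp add: feasible_set_def)
    moreover have "\<phi> i (xb, p) + inner (grad_x (\<phi> i) (xb, p)) (y - xb) - K * (norm (y - xb))\<^sup>2 \<le>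
        \<phi> i (y, p)"
      by (rule phi_lower) (use y r_pos in auto)
    moreover have "\<bar>\<phi> i (xb, p) - \<phi> i (xb, pb)\<bar> \<le> K * norm (p - pb)"
      using phi_lip[of xb xb p pb i] y r_pos by simp
    moreover have "\<bar>inner (grad_x (\<phi> i) (xb, p) - grad_x (\<phi> i) (xb, pb)) (y - xb)\<bar> \<le> K * norm
        (p - pb) * r"
    proof -
      have "\<bar>inner (grad_x (\<phi> i) (xb, p) - grad_x (\<phi> i) (xb, pb)) (y - xb)\<bar>
          \<le> norm (grad_x (\<phi> i) (xb, p) - grad_x (\<phi> i) (xb, pb)) * norm (y - xb)" by (rule Cauchy_Schwarz_ineq2)
      also have "\<dots> \<le> (K * norm (p - pb)) * r"
        using grad_lip[of xb xb p pb i] y yr r_pos by (intro mult_mono) (auto intro: mult_nonneg_nonneg K_nonneg)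
      finally show ?thesis .
    qed
    ultimately have "\<phi> i (xb, pb) + inner (grad_x (\<phi> i) (xb, pb)) (y - xb) \<le> K * (norm (y -
        xb))\<^sup>2 + K * (1 + r) * norm (p - pb)"
      by (simp add: inner_diff_left abs_le_iff algebra_simps)
    from mult_left_mono[OF this l(1)[of i]]
    show "lam $ i * inner (grad_x (\<phi> i) (xb, pb)) (y - xb) \<le> lam $ i * (K * (norm (y - xb))\<^sup>2 + K * (1
        + r) * norm (p - pb))"
      using l(2)[of i] by (simp only: distrib_left)
  qed
  also have "\<dots> = (\<Sum>i\<in>UNIV. lam $ i) * (K * (norm (y - xb))\<^sup>2 + K * (1 + r) * norm (p - pb))"
    by (simp only: sum_distrib_right)
  finally show ?thesis .
qed

text \<open>A step \<open>t\<close> along \<open>d\<close> decreases the active constraints by \<open>t * \<sigma>\<close>, up to an error quadratic in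
  \<open>t\<close>; what remains covers the effect of a small change of the parameter.\<close>

lemma feasible_point_nearby:
  assumes "0 < \<tau>"
  obtains \<delta> y where "0 < \<delta>" "norm (y - xb) \<le> \<tau>" "\<And>p. p \<in> ball pb \<delta>
      \<Longrightarrow> y \<in> feasible_set \<phi> p"
proof -
  define D where "D = norm d + 1"
  have D: "D > 0" "norm d \<le> D" by (auto simp: D_def add_nonneg_pos)
  define t where "t = Min {\<tau> / D, r / (2 * D), \<sigma> / (2 * (K + 1) * D\<^sup>2)}"
  have pos: "0 < \<tau> / D" "0 < r / (2 * D)" "0 < \<sigma> / (2 * (K + 1) * D\<^sup>2)"
    using assms r_pos \<sigma>_pos K_nonneg D by simp_all
  have t: "0 < t" "t \<le> \<tau> / D" "t \<le> r / (2 * D)" "t \<le> \<sigma> / (2 * (K + 1) * D\<^sup>2)"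
    using pos by (auto simp: t_def)
  have t1: "t * D \<le> \<tau>" "t * D \<le> r / 2" using t(2,3) D by (simp_all add: field_simps)
  have t2: "(K + 1) * (t * D\<^sup>2) \<le> \<sigma> / 2"
  proof -
    have c: "0 < 2 * (K + 1) * D\<^sup>2" using D K_nonneg by simp
    have "t * (2 * (K + 1) * D\<^sup>2) \<le> \<sigma>" using t(4) unfolding pos_le_divide_eq[OF c] .
    then show ?thesis by (simp add: algebra_simps)
  qed
  define y where "y = xb + t *\<^sub>R d"
  have ny: "norm (y - xb) \<le> t * D" using t D by (simp add: y_def)
  then have yr: "y \<in> ball xb r" using t1 r_pos by (simp add: dist_norm norm_minus_commute)
  define \<delta> where "\<delta> = min r (t * \<sigma> / (2 * (K + 1)))"
  have \<delta>: "0 < \<delta>" using r_pos t \<sigma>_pos K_nonneg by (simp add: \<delta>_def)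
  show ?thesis
  proof (rule that[OF \<delta>, of y])
    show "norm (y - xb) \<le> \<tau>" using ny t1 by linarith
    fix p assume p: "p \<in> ball pb \<delta>"
    then have pr: "p \<in> ball pb r" by (simp add: \<delta>_def)
    have np: "(K + 1) * norm (p - pb) \<le> t * \<sigma> / 2"
    proof -
      have "norm (p - pb) \<le> t * \<sigma> / (2 * (K + 1))" using p by (simp add: \<delta>_def dist_norm norm_minus_commute)
      then show ?thesis using K_nonneg by (simp add: field_simps)
    qed
    have "\<phi> i (y, p) \<le> 0" for i
    proof (cases "i \<in> active_set \<phi> xb pb")
      case False
      then show ?thesis using inactive[OF False yr pr] by simp
    next
      case True
      then have z: "\<phi> i (xb, pb) = 0" by (simp add: active_set_def)
      have "\<phi> i (y, p) + inner (grad_x (\<phi> i) (y, p)) (xb - y) - K * (norm (xb - y))\<^sup>2 \<le> \<phi> i (xb, p)"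
        by (rule phi_lower) (use yr pr r_pos in auto)
      moreover have "inner (grad_x (\<phi> i) (y, p)) (xb - y) = - (t * inner (grad_x (\<phi> i) (y, p)) d)" by (simp add: y_def)
      moreover have "t * inner (grad_x (\<phi> i) (y, p)) d \<le> t * (- \<sigma>)"
        using mfcq[OF True yr pr] t(1) by (intro mult_left_mono) auto
      moreover have "K * (norm (xb - y))\<^sup>2 \<le> t * (\<sigma> / 2)"
      proof -
        have "K * (norm (xb - y))\<^sup>2 \<le> (K + 1) * (t * D)\<^sup>2"
          using ny K_nonneg by (intro mult_mono power_mono) (auto simp: norm_minus_commute)
        also have "\<dots> = t * ((K + 1) * (t * D\<^sup>2))" by (simp add: power2_eq_square)
        also have "\<dots> \<le> t * (\<sigma> / 2)" using t2 t(1) by (intro mult_left_mono) auto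
        finally show ?thesis .
      qed
      moreover have "\<phi> i (xb, p) \<le> t * \<sigma> / 2"
      proof -
        have "\<bar>\<phi> i (xb, p) - \<phi> i (xb, pb)\<bar> \<le> K * norm (p - pb)" using phi_lip[of xb xb p pb
            i] pr r_pos by simp
        moreover have "K * norm (p - pb) \<le> (K + 1) * norm (p - pb)" by (intro mult_right_mono) auto
        ultimately show ?thesis using np z by linarith
      qed
      ultimately show ?thesis by simp
    qed
    then show "y \<in> feasible_set \<phi> p" by (simp add: feasible_set_def)
  qed
qed

lemma nearest_point_normal:
  assumes p: "p \<in> ball pb r" and \<epsilon>: "\<epsilon> < r" and c: "0 < c"
    and x: "x \<in> feasible_set \<phi> p" "norm (x - xb) < \<epsilon>"
    and nearest: "\<And>u. u \<in> feasible_set \<phi> p \<inter> cball xb \<epsilon> \<Longrightarrow> norm (z - x)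
        \<le> norm (z - u)"
  shows "c *\<^sub>R (z - x) \<in> active_cone x p"
proof -
  have xr: "x \<in> ball xb r" "x \<in> ball xb \<epsilon>" using x(2) \<epsilon> by (auto simp: dist_norm norm_minus_commute)
  have "c *\<^sub>R (z - x) \<in> regular_normal_cone (feasible_set \<phi> p) x"
  proof (rule regular_normal_coneI_quadratic[OF x(1)])
    have "\<forall>\<^sub>F u in at x within feasible_set \<phi> p. u \<in> ball xb \<epsilon>"
      using xr(2) by (meson eventually_at_topological open_ball)
    moreover have "\<forall>\<^sub>F u in at x within feasible_set \<phi> p. u \<in> feasible_set \<phi> p"
      by (simp add: eventually_at_filter)
    ultimately show "\<forall>\<^sub>F u in at x within feasible_set \<phi> p. inner (c *\<^sub>R (z - x)) (u - x)
        \<le> c / 2 * (norm (u - x))\<^sup>2"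
    proof eventually_elim
      case (elim u)
      then have "norm (z - x) \<le> norm (z - u)" by (intro nearest) auto
      then have "(norm (z - x))\<^sup>2 \<le> (norm ((z - x) - (u - x)))\<^sup>2" by (intro power_mono) auto
      also have "\<dots> = (norm (z - x))\<^sup>2 - 2 * inner (z - x) (u - x) + (norm (u - x))\<^sup>2"
        unfolding power2_norm_eq_inner
        by (simp only: inner_diff_left[of "z - x" "u - x"] inner_diff_right[of _ "z - x" "u - x"] inner_commute[of "u
            - x" "z - x"])
      finally have "2 * inner (z - x) (u - x) \<le> (norm (u - x))\<^sup>2" by simp
      then have "c * (2 * inner (z - x) (u - x)) \<le> c * (norm (u - x))\<^sup>2" using c by (intro mult_left_mono) auto
      then show ?case by simp
    qed
  qed
  then show ?thesis using regular_normal_cone_subset[OF xr(1) p] by blast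
qed

lemma closed_local_feasible_set:
  assumes p: "p \<in> ball pb r" and \<epsilon>: "\<epsilon> < r"
  shows "closed (feasible_set \<phi> p \<inter> cball xb \<epsilon>)"
  unfolding closed_sequential_limits
proof (intro allI impI, elim conjE)
  fix X x assume X: "\<forall>k. X k \<in> feasible_set \<phi> p \<inter> cball xb \<epsilon>" and lim: "X
      \<longlonglongrightarrow> x"
  have xc: "x \<in> cball xb \<epsilon>"
    by (rule closed_sequentially[OF closed_cball _ lim]) (use X in auto)
  then have xr: "x \<in> ball xb r" using \<epsilon> by simp
  have "\<phi> i (x, p) \<le> 0" for i
    by (rule LIMSEQ_le_const2[OF box_tendsto(1)[OF lim tendsto_const xr p]]) (use X in \<open>auto simp: feasible_set_def\<close>)
  then show "x \<in> feasible_set \<phi> p \<inter> cball xb \<epsilon>" using xc by (simp add: feasible_set_def)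
qed

end

context parametric_mfcq_system
begin

text \<open>The solution is a point \<open>x\<close> of \<open>C(p)\<close> nearest to \<open>z = w/\<rho>\<close> within a small ball. For the reference data this
  is \<open>xb\<close>, with quadratic growth of the distance since \<open>\<rho>\<close> dominates the curvature of the constraints.
  For nearby data the comparison with a feasible point \<open>y\<close> close to \<open>xb\<close> keeps \<open>x\<close> in the interior of
  the ball, where nearest points have proximal normals.\<close>

lemma projection_locally_solvable:
  assumes lam: "lam \<in> multipliers f \<phi> xb pb qb vb"
    and \<rho>: "0 < \<rho>" "4 * (K * (\<Sum>i\<in>UNIV. lam $ i)) \<le> \<rho>"
  shows "locally_solvable (\<lambda>t x. {w. x \<in> feasible_set \<phi> (fst t) \<and> w - \<rho> *\<^sub>R x \<in>
      active_cone x (fst t)})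
      (pb, qb) xb (\<rho> *\<^sub>R xb + (vb - f (xb, pb, qb)))"
  unfolding locally_solvable_def
proof (intro allI impI)
  fix e0 :: real assume "0 < e0"
  define \<epsilon> where "\<epsilon> = min e0 (r / 2)"
  have \<epsilon>: "0 < \<epsilon>" "\<epsilon> \<le> e0" "\<epsilon> < r" using \<open>0 < e0\<close> r_pos by (auto
      simp: \<epsilon>_def)
  define n0 where "n0 = vb - f (xb, pb, qb)"
  define \<Lambda> where "\<Lambda> = (\<Sum>i\<in>UNIV. lam $ i)"
  have \<Lambda>: "0 \<le> \<Lambda>" unfolding \<Lambda>_def using lam base_feasible by (intro sum_nonneg) (simp
      add: multipliers_iff)
  define a0 where "a0 = norm n0 / \<rho>"
  define c0 where "c0 = 2 * (a0 + 1) + 1"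
  have "0 \<le> a0" using \<rho>(1) by (simp add: a0_def)
  then have c0: "0 < c0" by (simp add: c0_def)
  \<comment> \<open>The comparison with \<open>y\<close>, the change of the parameter and the change of the datum are each
    allowed an error of \<open>\<epsilon>\<^sup>2 / 16\<close>.\<close>
  define \<tau> where "\<tau> = Min {\<epsilon>, 1, \<epsilon>\<^sup>2 / (16 * c0)}"
  have \<tau>: "0 < \<tau>" "\<tau> \<le> \<epsilon>" "\<tau> \<le> 1" "\<tau> \<le> \<epsilon>\<^sup>2 / (16 * c0)"
      using \<epsilon> c0 by (auto simp: \<tau>_def)
  have c\<tau>: "c0 * \<tau> \<le> \<epsilon>\<^sup>2 / 16"
  proof -
    have "\<tau> * (16 * c0) \<le> \<epsilon>\<^sup>2" using \<tau>(4) c0 by (simp add: pos_le_divide_eq)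
    then show ?thesis by (simp add: mult.commute)
  qed
  obtain \<delta>1 y where \<delta>1: "0 < \<delta>1" and y: "norm (y - xb) \<le> \<tau>" "\<And>p. p \<in> ball pb
      \<delta>1 \<Longrightarrow> y \<in> feasible_set \<phi> p"
    by (rule feasible_point_nearby[OF \<tau>(1)]) (rule that)
  define B where "B = 2 * \<Lambda> * (K * (1 + r)) / \<rho>"
  have B: "0 \<le> B" using \<Lambda> K_nonneg r_pos \<rho> by (simp add: B_def)
  define d0 where "d0 = Min {\<delta>1, r, \<epsilon>\<^sup>2 / (16 * (B + 1)), \<rho>, \<rho> * \<epsilon> / 32}"
  have "0 < d0" using \<delta>1 r_pos \<epsilon> B \<rho> by (simp add: d0_def)
  moreover have "d0 \<le> \<delta>1" "d0 \<le> r" "d0 \<le> \<epsilon>\<^sup>2 / (16 * (B + 1))" "d0 \<le> \<rho>"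
      "d0 \<le> \<rho> * \<epsilon> / 32"
    unfolding d0_def by (rule Min_le; simp)+
  ultimately have d0: "0 < d0" "d0 \<le> \<delta>1" "d0 \<le> r" "d0 \<le> \<epsilon>\<^sup>2 / (16 * (B + 1))" "d0
      \<le> \<rho>" "d0 \<le> \<rho> * \<epsilon> / 32"
    by simp_all
  have Bd: "B * d0 \<le> \<epsilon>\<^sup>2 / 16"
  proof -
    have "d0 * (16 * (B + 1)) \<le> \<epsilon>\<^sup>2" using d0(4) B by (simp add: pos_le_divide_eq)
    then have "B * d0 + d0 \<le> \<epsilon>\<^sup>2 / 16" by (simp add: algebra_simps)
    then show ?thesis using d0(1) by linarith
  qed
  show "\<exists>d>0. \<forall>t\<in>ball (pb, qb) d. \<forall>w\<in>ball (\<rho> *\<^sub>R xb + (vb - f (xb, pb,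
      qb))) d. \<exists>x\<in>cball xb e0.
      w \<in> {w. x \<in> feasible_set \<phi> (fst t) \<and> w - \<rho> *\<^sub>R x \<in> active_cone x (fst t)}"
  proof (intro exI[of _ d0] conjI ballI d0(1))
    fix t w assume t: "t \<in> ball (pb, qb) d0" and w: "w \<in> ball (\<rho> *\<^sub>R xb + (vb - f (xb, pb, qb))) d0"
    define p where "p = fst t"
    have "dist pb p \<le> dist (pb, qb) t" unfolding p_def using dist_fst_le[of "(pb, qb)" t] by simp
    then have p: "p \<in> ball pb d0" using t by simp
    then have pr: "p \<in> ball pb r" and py: "y \<in> feasible_set \<phi> p" using d0 y(2) by auto
    have np: "norm (p - pb) \<le> d0" using p by (simp add: dist_norm norm_minus_commute)
    define e1 where "e1 = (w - (\<rho> *\<^sub>R xb + n0)) /\<^sub>R \<rho>"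
    have ne1: "norm e1 \<le> d0 / \<rho>"
      using w \<rho>(1) by (simp add: e1_def n0_def dist_norm norm_minus_commute divide_inverse_commute)
    have "d0 / \<rho> \<le> \<rho> / \<rho>" by (rule divide_right_mono) (use d0(5) \<rho>(1) in auto)
    from order_trans[OF ne1 this] have e1a: "norm e1 \<le> 1" using \<rho>(1) by simp
    have "d0 / \<rho> \<le> (\<rho> * \<epsilon> / 32) / \<rho>" by (rule divide_right_mono) (use d0(6) \<rho>(1) in auto)
    from order_trans[OF ne1 this] have e1b: "norm e1 \<le> \<epsilon> / 32" using \<rho>(1) by simp
    define z where "z = w /\<^sub>R \<rho>"
    have zxb: "z - xb = n0 /\<^sub>R \<rho> + e1" using \<rho>(1) by (simp add: z_def e1_def scaleR_diff_right scaleR_add_right)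
    have nz: "norm (z - xb) \<le> a0 + 1"
    proof -
      have "norm (z - xb) \<le> norm (n0 /\<^sub>R \<rho>) + norm e1" unfolding zxb by (rule norm_triangle_ineq)
      also have "norm (n0 /\<^sub>R \<rho>) = a0" using \<rho>(1) by (simp add: a0_def divide_inverse_commute)
      finally show ?thesis using e1a by linarith
    qed
    have "y \<in> feasible_set \<phi> p \<inter> cball xb \<epsilon>" using py y(1) \<tau>(2) by (simp add: dist_norm
        norm_minus_commute)
    moreover from this have "feasible_set \<phi> p \<inter> cball xb \<epsilon> \<noteq> {}" by blast
    ultimately obtain x where x: "x \<in> feasible_set \<phi> p \<inter> cball xb \<epsilon>"
      and near: "\<And>u. u \<in> feasible_set \<phi> p \<inter> cball xb \<epsilon> \<Longrightarrow> norm (z - x)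
          \<le> norm (z - u)"
      using distance_attains_inf[OF closed_local_feasible_set[OF pr \<epsilon>(3)], of z] unfolding dist_norm by metis
    have xf: "x \<in> feasible_set \<phi> p" using x by simp
    have a\<epsilon>: "norm (x - xb) \<le> \<epsilon>" using x by (simp add: dist_norm norm_minus_commute)
    then have xr: "x \<in> ball xb r" using \<epsilon>(3) by (simp add: dist_norm norm_minus_commute)
    define a where "a = norm (x - xb)"
    have "norm (z - x) \<le> norm (z - y)" using near \<open>y \<in> feasible_set \<phi> p \<inter> cball xb
        \<epsilon>\<close> by blast
    also have "\<dots> \<le> norm (z - xb) + \<tau>"
      using norm_triangle_ineq4[of "z - xb" "y - xb"] y(1) by simp
    finally have "(norm (z - x))\<^sup>2 \<le> (norm (z - xb) + \<tau>)\<^sup>2" by (intro power_mono) auto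
    also have "\<dots> = (norm (z - xb))\<^sup>2 + (2 * norm (z - xb) + \<tau>) * \<tau>" by (simp add:
        power2_eq_square algebra_simps)
    also have "(2 * norm (z - xb) + \<tau>) * \<tau> \<le> c0 * \<tau>"
      using nz \<tau> by (intro mult_right_mono) (auto simp: c0_def)
    finally have up: "(norm (z - x))\<^sup>2 \<le> (norm (z - xb))\<^sup>2 + \<epsilon>\<^sup>2 / 16" using c\<tau> by linarith
    have "(norm (z - x))\<^sup>2 = (norm ((z - xb) - (x - xb)))\<^sup>2" by simp
    also have "\<dots> = (norm (z - xb))\<^sup>2 - 2 * inner (z - xb) (x - xb) + a\<^sup>2"
      unfolding power2_norm_eq_inner a_def
      by (simp only: inner_diff_left[of "z - xb" "x - xb"] inner_diff_right[of _ "z - xb" "x - xb"] inner_commute[of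
          "x - xb" "z - xb"])
    finally have "a\<^sup>2 \<le> 2 * inner (z - xb) (x - xb) + \<epsilon>\<^sup>2 / 16" using up by linarith
    moreover have "2 * inner (z - xb) (x - xb) \<le> a\<^sup>2 / 2 + \<epsilon>\<^sup>2 / 8"
    proof -
      have "inner n0 (x - xb) \<le> \<Lambda> * (K * a\<^sup>2 + K * (1 + r) * norm (p - pb))"
        unfolding n0_def \<Lambda>_def a_def by (rule base_normal_inequality[OF lam xr pr xf])
      also have "\<dots> \<le> \<Lambda> * (K * a\<^sup>2 + K * (1 + r) * d0)"
        using np \<Lambda> K_nonneg r_pos by (intro mult_left_mono add_left_mono) auto
      finally have "2 / \<rho> * inner n0 (x - xb) \<le> 2 / \<rho> * (\<Lambda> * (K * a\<^sup>2 + K * (1 + r) * d0))"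
        using \<rho>(1) by (intro mult_left_mono) auto
      also have "\<dots> = 2 * (K * \<Lambda>) / \<rho> * a\<^sup>2 + B * d0"
        by (simp add: B_def distrib_left divide_inverse mult_ac)
      also have "2 * (K * \<Lambda>) / \<rho> * a\<^sup>2 \<le> 1 / 2 * a\<^sup>2"
        using \<rho> by (intro mult_right_mono) (auto simp: \<Lambda>_def pos_divide_le_eq)
      finally have n: "2 / \<rho> * inner n0 (x - xb) \<le> a\<^sup>2 / 2 + \<epsilon>\<^sup>2 / 16" using Bd by linarith
      have "\<bar>inner e1 (x - xb)\<bar> \<le> norm e1 * norm (x - xb)" by (rule Cauchy_Schwarz_ineq2)
      also have "\<dots> \<le> \<epsilon> / 32 * \<epsilon>" using e1b a\<epsilon> \<epsilon>(1) by (intro mult_mono) auto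
      finally have "2 * inner e1 (x - xb) \<le> \<epsilon>\<^sup>2 / 16" by (simp add: power2_eq_square)
      moreover have "2 * inner (z - xb) (x - xb) = 2 / \<rho> * inner n0 (x - xb) + 2 * inner e1 (x - xb)"
        unfolding zxb inner_add_left inner_scaleR_left by (simp add: divide_inverse)
      ultimately show ?thesis using n by linarith
    qed
    ultimately have "a\<^sup>2 \<le> 3 / 8 * \<epsilon>\<^sup>2" by linarith
    also have "\<dots> < \<epsilon>\<^sup>2" using \<epsilon>(1) by simp
    finally have "norm (x - xb) < \<epsilon>" unfolding a_def using \<epsilon>(1) by (simp add: power2_less_imp_less)
    from nearest_point_normal[OF pr \<epsilon>(3) \<rho>(1) xf this near]
    have "\<rho> *\<^sub>R (z - x) \<in> active_cone x p" by blast
    moreover have "\<rho> *\<^sub>R (z - x) = w - \<rho> *\<^sub>R x" using \<rho>(1) by (simp add: z_def scaleR_diff_right)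
    ultimately show "\<exists>x\<in>cball xb e0. w \<in> {w. x \<in> feasible_set \<phi> (fst t) \<and> w - \<rho>
        *\<^sub>R x \<in> active_cone x (fst t)}"
      using xf a\<epsilon> \<epsilon>(2) by (intro bexI[of _ x]) (auto simp: p_def dist_norm norm_minus_commute)
  qed
qed

text \<open>Starting from the projection problem \<open>w \<in> \<rho> x + N(x)\<close>, two perturbations lead to \<open>v \<in> f + N(x)\<close>: by
  \<open>- f\<close>, with \<open>\<rho>\<close> exceeding the hypomonotonicity constant \<open>k0\<close> of the normal cone by more than twice the Lipschitz constant
  of \<open>f\<close>, and by \<open>\<rho> x\<close>, where strong monotonicity supplies the modulus \<open>\<rho> + \<kappa>\<close>.\<close>

lemma solution_exists_nearby:
  assumes G: "GSSOSC f \<phi> xb pb qb vb" and lam: "lam \<in> multipliers f \<phi> xb pb qb vb" and "0 < \<epsilon>"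
  obtains \<eta> where "0 < \<eta>"
    "\<And>v p q. \<lbrakk>v \<in> ball vb \<eta>; p \<in> ball pb \<eta>; q \<in> ball qb \<eta>\<rbrakk>
        \<Longrightarrow> \<exists>x\<in>cball xb \<epsilon>. x \<in> solution_map f \<phi> v p q"
proof -
  obtain \<kappa> \<delta> where \<kappa>: "0 < \<kappa>" and \<delta>: "0 < \<delta>" "\<delta> \<le> r"
    and mono: "\<And>p q x1 v1 lam1 x2 v2 lam2. \<lbrakk>local_kkt vb \<delta> x1 p q v1 lam1; local_kkt vb \<delta>
        x2 p q v2 lam2\<rbrakk>
      \<Longrightarrow> \<kappa> * (norm (x1 - x2))\<^sup>2 \<le> inner (v1 - v2) (x1 - x2)"
    by (rule strong_monotonicity[OF G]) (rule that)
  define n0 where "n0 = vb - f (xb, pb, qb)"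
  define N where "N = norm n0 + 1"
  define k0 where "k0 = 2 * K * (norm d / \<sigma>) * N"
  define \<Lambda> where "\<Lambda> = (\<Sum>i\<in>UNIV. lam $ i)"
  have \<Lambda>: "0 \<le> \<Lambda>" unfolding \<Lambda>_def using lam base_feasible by (intro sum_nonneg) (simp
      add: multipliers_iff)
  have k0: "0 \<le> k0" unfolding k0_def N_def using K_nonneg \<sigma>_pos by (intro mult_nonneg_nonneg) auto
  define \<rho> where "\<rho> = k0 + 2 * K + 1 + 4 * (K * \<Lambda>)"
  have "0 \<le> K * \<Lambda>" using K_nonneg \<Lambda> by simp
  then have \<rho>: "0 < \<rho>" "4 * (K * \<Lambda>) \<le> \<rho>" "2 * K + 1 \<le> \<rho> - k0" using k0 K_nonneg
      unfolding \<rho>_def by linarith+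
  define M1 where "M1 = (\<lambda>t x. {w. x \<in> feasible_set \<phi> (fst t) \<and> w - \<rho> *\<^sub>R x \<in>
      active_cone x (fst (t :: (real^'l) \<times> (real^'m)))})"
  define h1 where "h1 = (\<lambda>(t :: (real^'l) \<times> (real^'m)) x. - f (x, t))"
  have S1: "locally_solvable M1 (pb, qb) xb (\<rho> *\<^sub>R xb + n0)"
    unfolding M1_def n0_def by (rule projection_locally_solvable[OF lam \<rho>(1)]) (use \<rho>(2) in \<open>simp
        add: \<Lambda>_def\<close>)
  have box: "fst t \<in> ball pb e" "snd t \<in> ball qb e" if "t \<in> ball (pb, qb) e" for t :: "(real^'l) \<times>
      (real^'m)" and e
    using that dist_fst_le[of "(pb, qb)" t] dist_snd_le[of "(pb, qb)" t] by auto
  have S2: "locally_solvable (\<lambda>t x. {v. v + h1 t x \<in> M1 t x}) (pb, qb) xb ((\<rho> *\<^sub>R xb + n0) -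
      h1 (pb, qb) xb)"
  proof -
    \<comment> \<open>Within radius \<open>e0\<close> the normals \<open>w - \<rho> x\<close> have norm at most \<open>N\<close>.\<close>
    define e0 where "e0 = min (r / 2) (1 / (1 + \<rho>))"
    have e0: "0 < e0" "e0 < r" "e0 \<le> 1 / (1 + \<rho>)" using r_pos \<rho> by (auto simp: e0_def)
    have e0\<rho>: "e0 + \<rho> * e0 \<le> 1" using e0(3) \<rho>(1) by (simp add: field_simps)
    show ?thesis
    proof (rule locally_solvable_perturbation[OF S1, of "1 / (2 * K + 1)" K e0])
      show "0 \<le> 1 / (2 * K + 1)" "0 \<le> K" using K_nonneg by auto
      show "1 / (2 * K + 1) * K < 1" using K_nonneg by (simp add: divide_simps)
      show "0 < e0" by (rule e0(1))
    next
      fix t :: "(real^'l) \<times> (real^'m)" and x1 x2 w1 w2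
      assume t: "t \<in> ball (pb, qb) e0" and x: "x1 \<in> cball xb e0" "x2 \<in> cball xb e0"
        and w: "w1 \<in> ball (\<rho> *\<^sub>R xb + n0) e0" "w2 \<in> ball (\<rho> *\<^sub>R xb + n0) e0"
        and M: "w1 \<in> M1 t x1" "w2 \<in> M1 t x2"
      have p: "fst t \<in> ball pb r" using box(1)[OF t] e0(2) by simp
      have xr: "x1 \<in> ball xb r" "x2 \<in> ball xb r" using x e0(2) by auto
      have nb: "norm (w - \<rho> *\<^sub>R x) \<le> N" if "x \<in> cball xb e0" "w \<in> ball (\<rho> *\<^sub>R xb +
          n0) e0" for x w
      proof -
        have "w - \<rho> *\<^sub>R x = n0 + ((w - (\<rho> *\<^sub>R xb + n0)) - \<rho> *\<^sub>R (x - xb))" by (simp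
            add: algebra_simps)
        then have "norm (w - \<rho> *\<^sub>R x) \<le> norm n0 + norm ((w - (\<rho> *\<^sub>R xb + n0)) - \<rho>
            *\<^sub>R (x - xb))"
          by (metis norm_triangle_ineq)
        moreover have "norm ((w - (\<rho> *\<^sub>R xb + n0)) - \<rho> *\<^sub>R (x - xb)) \<le> norm (w - (\<rho>
            *\<^sub>R xb + n0)) + norm (\<rho> *\<^sub>R (x - xb))"
          by (rule norm_triangle_ineq4)
        moreover have "norm (w - (\<rho> *\<^sub>R xb + n0)) \<le> e0" using that(2) by (simp add: dist_norm norm_minus_commute)
        moreover have "norm (\<rho> *\<^sub>R (x - xb)) \<le> \<rho> * e0" using that(1) \<rho>(1) by (simp add:
            dist_norm norm_minus_commute)
        ultimately show ?thesis using e0\<rho> unfolding N_def by linarith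
      qed
      have "- (2 * K * (norm d / \<sigma>) * N) * (norm (x1 - x2))\<^sup>2 \<le> inner ((w1 - \<rho> *\<^sub>R x1) -
          (w2 - \<rho> *\<^sub>R x2)) (x1 - x2)"
        using M unfolding M1_def by (intro active_cone_hypomonotone[OF p xr(1) _ _ nb[OF x(1) w(1)] xr(2) _ _ nb[OF
            x(2) w(2)]]) auto
      also have "(w1 - \<rho> *\<^sub>R x1) - (w2 - \<rho> *\<^sub>R x2) = (w1 - w2) - \<rho> *\<^sub>R (x1 - x2)" by
          (simp add: algebra_simps)
      also have "inner ((w1 - w2) - \<rho> *\<^sub>R (x1 - x2)) (x1 - x2) = inner (w1 - w2) (x1 - x2) - \<rho> *
          (norm (x1 - x2))\<^sup>2"
        by (simp only: inner_diff_left[of "w1 - w2"] inner_scaleR_left power2_norm_eq_inner)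
      finally have "(\<rho> - k0) * (norm (x1 - x2))\<^sup>2 \<le> inner (w1 - w2) (x1 - x2)"
        unfolding k0_def[symmetric] by (simp add: left_diff_distrib)
      moreover have "(2 * K + 1) * (norm (x1 - x2))\<^sup>2 \<le> (\<rho> - k0) * (norm (x1 - x2))\<^sup>2"
        by (rule mult_right_mono[OF \<rho>(3)]) simp
      ultimately have "(2 * K + 1) * (norm (x1 - x2))\<^sup>2 \<le> inner (w1 - w2) (x1 - x2)" by linarith
      then show "norm (x1 - x2) \<le> 1 / (2 * K + 1) * norm (w1 - w2)"
        using K_nonneg by (intro norm_le_of_strongly_monotone) auto
    next
      fix t :: "(real^'l) \<times> (real^'m)" and x y
      assume t: "t \<in> ball (pb, qb) e0" and x: "x \<in> cball xb e0" "y \<in> cball xb e0"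
      have "norm (f (x, fst t, snd t) - f (y, fst t, snd t)) \<le> K * (norm (x - y) + norm (fst t - fst t) + norm
          (snd t - snd t))"
        using box[OF t] x e0(2) by (intro f_lip) auto
      then show "norm (h1 t x - h1 t y) \<le> K * norm (x - y)" by (simp add: h1_def norm_minus_commute)
    next
      show "isCont (\<lambda>t. h1 t xb) (pb, qb)"
        unfolding h1_def continuous_at_sequentially
        using partial_strict_derivative_tendsto[OF f_strict tendsto_const] by (auto simp: o_def intro: tendsto_minus)
    qed
  qed
  have S2': "locally_solvable (\<lambda>t x. {v. v + h1 t x \<in> M1 t x}) (pb, qb) xb (\<rho> *\<^sub>R xb + vb)"
    using S2 by (simp add: h1_def n0_def)
  have S3: "locally_solvable (\<lambda>t x. {v. v + \<rho> *\<^sub>R x \<in> {v. v + h1 t x \<in> M1 t x}}) (pb, qb)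
      xb ((\<rho> *\<^sub>R xb + vb) - \<rho> *\<^sub>R xb)"
  proof -
    \<comment> \<open>Within radius \<open>e0\<close> the data \<open>w - \<rho> x\<close> stay in the ball where strong monotonicity holds.\<close>
    define e0 where "e0 = min (\<delta> / 2) (\<delta> / (2 * (1 + \<rho>)))"
    have e0: "0 < e0" "e0 < \<delta>" "e0 \<le> \<delta> / (2 * (1 + \<rho>))" using \<delta> \<rho> by (auto simp: e0_def)
    have e0\<rho>: "e0 + \<rho> * e0 < \<delta>"
    proof -
      have "e0 * (2 * (1 + \<rho>)) \<le> \<delta>" using e0(3) \<rho>(1) by (simp add: pos_le_divide_eq)
      then have "e0 + \<rho> * e0 \<le> \<delta> / 2" by (simp add: algebra_simps)
      then show ?thesis using \<delta>(1) by linarith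
    qed
    show ?thesis
    proof (rule locally_solvable_perturbation[OF S2', of "1 / (\<rho> + \<kappa>)" \<rho> e0])
      show "0 \<le> 1 / (\<rho> + \<kappa>)" "0 \<le> \<rho>" "1 / (\<rho> + \<kappa>) * \<rho> < 1" using \<rho>(1)
          \<kappa> by (auto simp: divide_simps)
      show "0 < e0" by (rule e0(1))
    next
      fix t :: "(real^'l) \<times> (real^'m)" and x1 x2 w1 w2
      assume t: "t \<in> ball (pb, qb) e0" and x: "x1 \<in> cball xb e0" "x2 \<in> cball xb e0"
        and w: "w1 \<in> ball (\<rho> *\<^sub>R xb + vb) e0" "w2 \<in> ball (\<rho> *\<^sub>R xb + vb) e0"
        and M: "w1 \<in> {v. v + h1 t x1 \<in> M1 t x1}" "w2 \<in> {v. v + h1 t x2 \<in> M1 t x2}"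
      have kkt: "\<exists>lam. local_kkt vb \<delta> x (fst t) (snd t) (w - \<rho> *\<^sub>R x) lam"
        if xx: "x \<in> cball xb e0" and ww: "w \<in> ball (\<rho> *\<^sub>R xb + vb) e0" and MM: "w \<in> {v. v + h1
            t x \<in> M1 t x}" for x w
      proof -
        have feas: "x \<in> feasible_set \<phi> (fst t)" and "w - f (x, t) - \<rho> *\<^sub>R x \<in> active_cone x (fst t)"
          using MM by (auto simp: M1_def h1_def)
        then have "(w - \<rho> *\<^sub>R x) - f (x, fst t, snd t) \<in> active_cone x (fst t)" by (simp add: algebra_simps)
        then obtain lam' where l: "lam' \<in> multipliers f \<phi> x (fst t) (snd t) (w - \<rho> *\<^sub>R x)"
          unfolding multipliers_iff_active_cone[OF feas, symmetric] ..
        have "norm ((w - \<rho> *\<^sub>R x) - vb) < \<delta>"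
        proof -
          have "(w - \<rho> *\<^sub>R x) - vb = (w - (\<rho> *\<^sub>R xb + vb)) - \<rho> *\<^sub>R (x - xb)" by
              (simp add: algebra_simps)
          then have "norm ((w - \<rho> *\<^sub>R x) - vb) \<le> norm (w - (\<rho> *\<^sub>R xb + vb)) + norm (\<rho>
              *\<^sub>R (x - xb))"
            by (metis norm_triangle_ineq4)
          moreover have "norm (w - (\<rho> *\<^sub>R xb + vb)) \<le> e0" using ww by (simp add: dist_norm norm_minus_commute)
          moreover have "norm (\<rho> *\<^sub>R (x - xb)) \<le> \<rho> * e0" using xx \<rho>(1) by (simp add:
              dist_norm norm_minus_commute)
          ultimately show ?thesis using e0\<rho> by linarith
        qed
        then have "w - \<rho> *\<^sub>R x \<in> ball vb \<delta>" by (simp add: dist_norm norm_minus_commute)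
        moreover have "x \<in> ball xb \<delta>" using xx e0(2) by simp
        moreover have "fst t \<in> ball pb \<delta>" "snd t \<in> ball qb \<delta>" using box[OF t] e0(2) by auto
        ultimately show ?thesis using feas l unfolding local_kkt_def by blast
      qed
      obtain l1 where l1: "local_kkt vb \<delta> x1 (fst t) (snd t) (w1 - \<rho> *\<^sub>R x1) l1" using kkt[OF x(1) w(1) M(1)] ..
      obtain l2 where l2: "local_kkt vb \<delta> x2 (fst t) (snd t) (w2 - \<rho> *\<^sub>R x2) l2" using kkt[OF x(2) w(2) M(2)] ..
      have "\<kappa> * (norm (x1 - x2))\<^sup>2 \<le> inner ((w1 - \<rho> *\<^sub>R x1) - (w2 - \<rho> *\<^sub>R x2)) (x1 - x2)"
        by (rule mono[OF l1 l2])
      also have "(w1 - \<rho> *\<^sub>R x1) - (w2 - \<rho> *\<^sub>R x2) = (w1 - w2) - \<rho> *\<^sub>R (x1 - x2)" by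
          (simp add: algebra_simps)
      also have "inner ((w1 - w2) - \<rho> *\<^sub>R (x1 - x2)) (x1 - x2) = inner (w1 - w2) (x1 - x2) - \<rho> *
          (norm (x1 - x2))\<^sup>2"
        by (simp only: inner_diff_left[of "w1 - w2"] inner_scaleR_left power2_norm_eq_inner)
      finally have "(\<rho> + \<kappa>) * (norm (x1 - x2))\<^sup>2 \<le> inner (w1 - w2) (x1 - x2)" by (simp add: distrib_right)
      then show "norm (x1 - x2) \<le> 1 / (\<rho> + \<kappa>) * norm (w1 - w2)"
        using \<rho>(1) \<kappa> by (intro norm_le_of_strongly_monotone) auto
    next
      fix t :: "(real^'l) \<times> (real^'m)" and x y :: "real^'n"
      show "norm (\<rho> *\<^sub>R x - \<rho> *\<^sub>R y) \<le> \<rho> * norm (x - y)" using \<rho>(1) by (simp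
          flip: scaleR_diff_right)
    next
      show "isCont (\<lambda>t. \<rho> *\<^sub>R xb) (pb, qb)" by simp
    qed
  qed
  define e where "e = min \<epsilon> (r / 2)"
  have e: "0 < e" "e \<le> \<epsilon>" "e < r" using \<open>0 < \<epsilon>\<close> r_pos by (auto simp: e_def)
  obtain \<eta> where \<eta>: "0 < \<eta>" "\<And>t w. t \<in> ball (pb, qb) \<eta> \<Longrightarrow> w \<in> ball vb
      \<eta> \<Longrightarrow>
      \<exists>x\<in>cball xb e. w \<in> {v. v + \<rho> *\<^sub>R x \<in> {v. v + h1 t x \<in> M1 t x}}"
    using S3[unfolded locally_solvable_def, rule_format, OF e(1)] by auto
  define \<eta>' where "\<eta>' = min r (\<eta> / 2)"
  have \<eta>': "0 < \<eta>'" "\<eta>' \<le> r" "\<eta>' \<le> \<eta> / 2" using \<eta>(1) r_pos by (auto simp: \<eta>'_def)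
  show ?thesis
  proof (rule that[OF \<eta>'(1)])
    fix v p q assume v: "v \<in> ball vb \<eta>'" and p: "p \<in> ball pb \<eta>'" and q: "q \<in> ball qb \<eta>'"
    have "norm (pb - p, qb - q) \<le> norm (pb - p) + norm (qb - q)" by (rule norm_Pair_le)
    then have pq: "(p, q) \<in> ball (pb, qb) \<eta>" using p q \<eta>'(3) by (simp add: dist_norm)
    have "v \<in> ball vb \<eta>" using v \<eta>' by auto
    then obtain x where x: "x \<in> cball xb e" "v \<in> {v. v + \<rho> *\<^sub>R x \<in> {v. v + h1 (p, q) x \<in> M1 (p, q) x}}"
      using \<eta>(2)[OF pq] by blast
    then have feas: "x \<in> feasible_set \<phi> p" and "v - f (x, p, q) \<in> active_cone x p"
      by (auto simp: M1_def h1_def algebra_simps)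
    then have "\<exists>lam. lam \<in> multipliers f \<phi> x p q v" unfolding multipliers_iff_active_cone[OF feas] by blast
    moreover have "x \<in> ball xb r" "p \<in> ball pb r" using x(1) e(3) p \<eta>'(2) by auto
    ultimately have "x \<in> solution_map f \<phi> v p q" using solution_map_iff feas by blast
    then show "\<exists>x\<in>cball xb \<epsilon>. x \<in> solution_map f \<phi> v p q" using x(1) e(2) by (intro
        bexI[of _ x]) auto
  qed
qed

end

section \<open>Sufficiency\<close>

context parametric_mfcq_system
begin

lemma independent_multiplier:
  assumes x: "x \<in> ball xb r" "p \<in> ball pb r" "x \<in> feasible_set \<phi> p"
    and lam: "lam \<in> multipliers f \<phi> x p q v"
  obtains J mu where "J \<subseteq> active_set \<phi> xb pb" "independent_family J (\<lambda>i. grad_x (\<phi> i) (x, p))"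
    "mu \<in> multipliers f \<phi> x p q v" "supported_on J x p mu"
proof -
  let ?g = "\<lambda>i. grad_x (\<phi> i) (x, p)"
  define I where "I = {i. \<phi> i (x, p) = 0}"
  note l = lam[unfolded multipliers_iff[OF x(3)]]
  have nn: "\<And>i. i \<in> I \<Longrightarrow> 0 \<le> lam $ i" using l by blast
  obtain J c where J: "J \<subseteq> I" "independent_family J ?g" "\<And>i. i \<in> J \<Longrightarrow> 0 \<le> c i"
    "(\<Sum>i\<in>J. c i *\<^sub>R ?g i) = (\<Sum>i\<in>I. lam $ i *\<^sub>R ?g i)"
    by (rule conic_caratheodory[where g = ?g and I = I and lam = "\<lambda>i. lam $ i", OF finite nn]) (assumption, rule that)
  define mu :: "real^'s" where "mu = (\<chi> i. if i \<in> J then c i else 0)"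
  have "(\<Sum>i\<in>UNIV. mu $ i *\<^sub>R ?g i) = (\<Sum>i\<in>J. mu $ i *\<^sub>R ?g i)"
    by (rule sum.mono_neutral_right) (auto simp: mu_def)
  also have "\<dots> = (\<Sum>i\<in>J. c i *\<^sub>R ?g i)" by (intro sum.cong) (auto simp: mu_def)
  also have "\<dots> = (\<Sum>i\<in>I. lam $ i *\<^sub>R ?g i)" by (rule J(4))
  also have "\<dots> = (\<Sum>i\<in>UNIV. lam $ i *\<^sub>R ?g i)"
    by (rule sum.mono_neutral_left) (use l in \<open>auto simp: I_def\<close>)
  finally have eq: "(\<Sum>i\<in>UNIV. mu $ i *\<^sub>R ?g i) = (\<Sum>i\<in>UNIV. lam $ i *\<^sub>R ?g i)" .
  have z: "\<phi> i (x, p) = 0" if "i \<in> J" for i using J(1) that by (auto simp: I_def)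
  show ?thesis
  proof (rule that[OF _ J(2)])
    show "J \<subseteq> active_set \<phi> xb pb" using z active_subset_base[OF x(1,2)] by blast
    have "0 \<le> mu $ i" for i using J(3) by (simp add: mu_def)
    moreover have "mu $ i * \<phi> i (x, p) = 0" for i using z by (simp add: mu_def)
    ultimately show "mu \<in> multipliers f \<phi> x p q v" unfolding multipliers_iff[OF x(3)] eq using l by blast
    show "supported_on J x p mu" using z by (simp add: supported_on_def mu_def)
  qed
qed

lemma norm_scaled_diff: "norm ((p1 + s *\<^sub>R (p2 - p1)) - (p1 + t *\<^sub>R (p2 - p1))) = \<bar>s - t\<bar> * norm (p1 - p2)"
  for p1 p2 :: "'z::real_normed_vector"
proof -
  have "(p1 + s *\<^sub>R (p2 - p1)) - (p1 + t *\<^sub>R (p2 - p1)) = (s - t) *\<^sub>R (p2 - p1)" by (simp add: algebra_simps)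
  then show ?thesis by (simp add: norm_minus_commute)
qed

text \<open>Along the segment from \<open>(p1, q1)\<close> to \<open>(p2, q2)\<close> let \<open>S J\<close> be the set of instants at which the solution has
  a multiplier supported on \<open>J\<close>. By CRCQ the sets with \<open>J\<close> independent at the reference point cover the segment;
  they are closed because solutions and multipliers stay in a compact set and solutions are unique. The solution is
  Lipschitz on each of them with the same constant, hence on the whole segment.\<close>

lemma solution_lipschitz_in_parameters:
  assumes G: "GSSOSC f \<phi> xb pb qb vb"
    and crcq: "\<And>J x p. \<lbrakk>J \<subseteq> active_set \<phi> xb pb; x \<in> ball xb r; p \<in> ball pb r;
        independent_family J (\<lambda>i. grad_x (\<phi> i) (x, p))\<rbrakk> \<Longrightarrow> independent_family J
            (\<lambda>i. grad_x (\<phi> i) (xb, pb))"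
  obtains M \<delta> where "0 \<le> M" "0 < \<delta>" "\<delta> \<le> r"
    "\<And>\<epsilon> \<theta> v p1 q1 p2 q2. \<lbrakk>\<epsilon> < \<delta>; v \<in> ball vb \<delta>; p1 \<in> ball
        pb \<delta>; p2 \<in> ball pb \<delta>; q1 \<in> ball qb \<delta>; q2 \<in> ball qb \<delta>;
      \<forall>p\<in>closed_segment p1 p2. \<forall>q\<in>closed_segment q1 q2.
         {x \<in> cball xb \<epsilon>. x \<in> solution_map f \<phi> v p q} = {\<theta> p q}\<rbrakk>
      \<Longrightarrow> norm (\<theta> p1 q1 - \<theta> p2 q2) \<le> M * (norm (p1 - p2) + norm (q1 - q2))"
proof -
  define P where "P J \<delta> M \<longleftrightarrow> (independent_family J (\<lambda>i. grad_x (\<phi> i) (xb, pb))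
      \<longrightarrow>
      (\<forall>x1 p1 q1 v1 lam1 x2 p2 q2 v2 lam2. local_kkt vb \<delta> x1 p1 q1 v1 lam1 \<longrightarrow> local_kkt
          vb \<delta> x2 p2 q2 v2 lam2 \<longrightarrow>
        supported_on J x1 p1 lam1 \<longrightarrow> supported_on J x2 p2 lam2 \<longrightarrow>
        norm (x1 - x2) \<le> M * (norm (p1 - p2) + norm (q1 - q2) + norm (v1 - v2))))" for J \<delta> M
  have "\<exists>\<delta>>0. \<exists>M\<ge>0. \<forall>J. P J \<delta> M"
  proof (rule uniform_constants)
    fix J
    show "\<exists>\<delta>>0. \<exists>M\<ge>0. P J \<delta> M"
    proof (cases "independent_family J (\<lambda>i. grad_x (\<phi> i) (xb, pb))")
      case False
      then show ?thesis unfolding P_def by (intro exI[of _ 1] conjI exI[of _ 0]) auto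
    next
      case True
      obtain M \<delta> where M: "0 \<le> M" "0 < \<delta>" "\<delta> \<le> r"
        "\<And>x1 p1 q1 v1 lam1 x2 p2 q2 v2 lam2. \<lbrakk>local_kkt vb \<delta> x1 p1 q1 v1 lam1; local_kkt vb
            \<delta> x2 p2 q2 v2 lam2;
            supported_on J x1 p1 lam1; supported_on J x2 p2 lam2\<rbrakk>
          \<Longrightarrow> norm (x1 - x2) \<le> M * (norm (p1 - p2) + norm (q1 - q2) + norm (v1 - v2))"
        by (rule common_support_lipschitz[OF G True]) (rule that)
      have "P J \<delta> M" unfolding P_def by (intro impI allI) (rule M(4))
      then show ?thesis using M(1,2) by blast
    qed
  next
    fix J \<delta> \<delta>' M M' assume P: "P J \<delta> M" and le: "0 < \<delta>'" "\<delta>' \<le> \<delta>" "M \<le> M'"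
    show "P J \<delta>' M'" unfolding P_def
    proof (intro impI allI)
      fix x1 p1 q1 v1 lam1 x2 p2 q2 v2 lam2
      assume J: "independent_family J (\<lambda>i. grad_x (\<phi> i) (xb, pb))"
        and k: "local_kkt vb \<delta>' x1 p1 q1 v1 lam1" "local_kkt vb \<delta>' x2 p2 q2 v2 lam2"
        and s: "supported_on J x1 p1 lam1" "supported_on J x2 p2 lam2"
      have "norm (x1 - x2) \<le> M * (norm (p1 - p2) + norm (q1 - q2) + norm (v1 - v2))"
        by (rule P[unfolded P_def, rule_format, OF J local_kkt_mono[OF k(1) le(2)] local_kkt_mono[OF k(2) le(2)] s])
      also have "\<dots> \<le> M' * (norm (p1 - p2) + norm (q1 - q2) + norm (v1 - v2))"
        using le(3) by (intro mult_right_mono) auto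
      finally show "norm (x1 - x2) \<le> M' * (norm (p1 - p2) + norm (q1 - q2) + norm (v1 - v2))" .
    qed
  qed
  then obtain \<delta>0 M where \<delta>0: "0 < \<delta>0" and M: "0 \<le> M" and PJ: "\<And>J. P J \<delta>0 M" by blast
  define \<delta> where "\<delta> = min \<delta>0 r"
  have \<delta>: "0 < \<delta>" "\<delta> \<le> \<delta>0" "\<delta> \<le> r" using \<delta>0 r_pos by (auto simp: \<delta>_def)
  show ?thesis
  proof (rule that[OF M \<delta>(1,3)])
    fix \<epsilon> \<theta> v p1 q1 p2 q2
    assume \<epsilon>: "\<epsilon> < \<delta>" and v: "v \<in> ball vb \<delta>" and p: "p1 \<in> ball pb \<delta>"
        "p2 \<in> ball pb \<delta>"
      and q: "q1 \<in> ball qb \<delta>" "q2 \<in> ball qb \<delta>"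
      and segsol: "\<forall>p\<in>closed_segment p1 p2. \<forall>q\<in>closed_segment q1 q2.
         {x \<in> cball xb \<epsilon>. x \<in> solution_map f \<phi> v p q} = {\<theta> p q}"
    note \<theta> = segsol[rule_format]
    define pt where "pt t = p1 + t *\<^sub>R (p2 - p1)" for t :: real
    define qt where "qt t = q1 + t *\<^sub>R (q2 - q1)" for t :: real
    define g where "g t = \<theta> (pt t) (qt t)" for t
    define m where "m = norm (p1 - p2) + norm (q1 - q2)"
    have seg: "pt t \<in> closed_segment p1 p2" "qt t \<in> closed_segment q1 q2" if "t \<in> {0..1}" for t
      using that unfolding pt_def qt_def closed_segment_def
      by (auto intro!: exI[of _ t] simp: algebra_simps)
    have ptb: "pt t \<in> ball pb \<delta>" "qt t \<in> ball qb \<delta>" if "t \<in> {0..1}" for t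
      using seg[OF that] closed_segment_subset[OF p convex_ball] closed_segment_subset[OF q convex_ball] by auto
    have ptr: "pt t \<in> ball pb r" "qt t \<in> ball qb r" if "t \<in> {0..1}" for t
      using ptb[OF that] \<delta>(3) by auto
    have gsol: "g t \<in> cball xb \<epsilon>" "g t \<in> solution_map f \<phi> v (pt t) (qt t)" if "t \<in> {0..1}" for t
    proof -
      have "g t \<in> {x \<in> cball xb \<epsilon>. x \<in> solution_map f \<phi> v (pt t) (qt t)}"
        unfolding \<theta>[OF seg[OF that]] g_def by simp
      then show "g t \<in> cball xb \<epsilon>" "g t \<in> solution_map f \<phi> v (pt t) (qt t)" by auto
    qed
    have guniq: "x = g t" if "t \<in> {0..1}" "x \<in> cball xb \<epsilon>" "x \<in> solution_map f \<phi> v (pt t)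
        (qt t)" for x t
    proof -
      have "x \<in> {x \<in> cball xb \<epsilon>. x \<in> solution_map f \<phi> v (pt t) (qt t)}" using that by simp
      then show ?thesis unfolding \<theta>[OF seg[OF that(1)]] g_def by simp
    qed
    have gr: "g t \<in> ball xb \<delta>" "g t \<in> ball xb r" if "t \<in> {0..1}" for t
      using gsol(1)[OF that] \<epsilon> \<delta>(3) by auto
    have gf: "g t \<in> feasible_set \<phi> (pt t)" if "t \<in> {0..1}" for t
      using gsol(2)[OF that] solution_map_iff[OF gr(2)[OF that] ptr(1)[OF that]] by blast
    define \<J> where "\<J> = {J. independent_family J (\<lambda>i. grad_x (\<phi> i) (xb, pb))}"
    define S where "S J = {t \<in> {0..1}. \<exists>lam. lam \<in> multipliers f \<phi> (g t) (pt t) (qt t) v \<and>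
        supported_on J (g t) (pt t) lam}" for J
    have kkt: "local_kkt vb \<delta>0 (g t) (pt t) (qt t) v lam" if t: "t \<in> {0..1}" and l: "lam \<in> multipliers
        f \<phi> (g t) (pt t) (qt t) v" for t lam
      by (rule local_kkt_mono[OF _ \<delta>(2)]) (use gr[OF t] ptb[OF t] v gf[OF t] l in \<open>simp add: local_kkt_def\<close>)
    have kktr: "local_kkt vb \<delta> (g t) (pt t) (qt t) v lam" if t: "t \<in> {0..1}" and l: "lam \<in> multipliers
        f \<phi> (g t) (pt t) (qt t) v" for t lam
      using gr[OF t] ptb[OF t] v gf[OF t] l by (simp add: local_kkt_def)
    have lip: "(M * m)-lipschitz_on (S J) g" if J: "J \<in> \<J>" for J
    proof (rule lipschitz_onI)
      fix s t assume "s \<in> S J" "t \<in> S J"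
      then obtain l1 l2 where s: "s \<in> {0..1}" "l1 \<in> multipliers f \<phi> (g s) (pt s) (qt s) v" "supported_on
          J (g s) (pt s) l1"
        and t: "t \<in> {0..1}" "l2 \<in> multipliers f \<phi> (g t) (pt t) (qt t) v" "supported_on J (g t) (pt t) l2"
        unfolding S_def by blast
      have "norm (g s - g t) \<le> M * (norm (pt s - pt t) + norm (qt s - qt t) + norm (v - v))"
        by (rule PJ[of J, unfolded P_def, rule_format, OF J[unfolded \<J>_def, THEN CollectD] kkt[OF s(1,2)] kkt[OF
            t(1,2)] s(3) t(3)])
      also have "\<dots> = M * m * \<bar>s - t\<bar>"
        unfolding pt_def qt_def norm_scaled_diff m_def by (simp add: algebra_simps)
      finally show "dist (g s) (g t) \<le> M * m * dist s t" by (simp add: dist_norm)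
    qed (use M in \<open>simp add: m_def\<close>)
    have closed: "closed (S J)" for J
      unfolding closed_sequential_limits
    proof (intro allI impI, elim conjE)
      fix T t assume T: "\<forall>k. T k \<in> S J" and lim: "T \<longlonglongrightarrow> t"
      have t: "t \<in> {0..1}" by (rule closed_sequentially[OF closed_atLeastAtMost _ lim]) (use T in \<open>simp
          add: S_def\<close>)
      have "\<forall>k. \<exists>lam. T k \<in> {0..1} \<and> lam \<in> multipliers f \<phi> (g (T k)) (pt (T k)) (qt
          (T k)) v \<and> supported_on J (g (T k)) (pt (T k)) lam"
        using T unfolding S_def by blast
      then obtain L where L: "\<forall>k. T k \<in> {0..1} \<and> L k \<in> multipliers f \<phi> (g (T k)) (pt (T k))
          (qt (T k)) v \<and> supported_on J (g (T k)) (pt (T k)) (L k)"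
        by (elim choice[THEN exE]) (rule that)
      then have L: "\<And>k. T k \<in> {0..1}" "\<And>k. L k \<in> multipliers f \<phi> (g (T k)) (pt (T k)) (qt (T k)) v"
        "\<And>k. supported_on J (g (T k)) (pt (T k)) (L k)" by blast+
      obtain B where B: "\<And>\<delta> x p q v lam. local_kkt vb \<delta> x p q v lam \<Longrightarrow> \<delta>
          \<le> r \<Longrightarrow> norm lam \<le> B"
        by (rule local_kkt_multiplier_bound[of vb]) (rule that)
      have cS: "compact (cball xb \<epsilon> \<times> cball (0::real^'s) B)" by (intro compact_Times compact_cball)
      have TS: "\<forall>k. (g (T k), L k) \<in> cball xb \<epsilon> \<times> cball (0::real^'s) B"
        using gsol(1)[OF L(1)] B[OF kktr[OF L(1,2)] \<delta>(3)] by simp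
      obtain l \<rho> where l: "l \<in> cball xb \<epsilon> \<times> cball (0::real^'s) B" "strict_mono \<rho>"
          "((\<lambda>k. (g (T k), L k)) \<circ> \<rho>) \<longlonglongrightarrow> l"
        by (rule seq_compactE[OF compact_imp_seq_compact[OF cS] TS]) (rule that)
      obtain x lam where xl: "l = (x, lam)" by (cases l)
      have lims: "(\<lambda>k. g (T (\<rho> k))) \<longlonglongrightarrow> x" "(\<lambda>k. L (\<rho> k))
          \<longlonglongrightarrow> lam"
        using tendsto_fst[OF l(3)] tendsto_snd[OF l(3)] by (simp_all add: xl o_def)
      have limT: "(\<lambda>k. T (\<rho> k)) \<longlonglongrightarrow> t" using LIMSEQ_subseq_LIMSEQ[OF lim l(2)] by
          (simp add: o_def)
      have limp: "(\<lambda>k. pt (T (\<rho> k))) \<longlonglongrightarrow> pt t" "(\<lambda>k. qt (T (\<rho> k)))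
          \<longlonglongrightarrow> qt t"
        unfolding pt_def qt_def by (intro tendsto_intros limT)+
      have xc: "x \<in> cball xb \<epsilon>" using l(1) xl by simp
      then have xr: "x \<in> ball xb r" using \<epsilon> \<delta>(3) by simp
      note cg = multipliers_closed_graph[OF lims(1) limp tendsto_const lims(2) xr ptr[OF t] gf[OF L(1)] L(2)]
      have "x \<in> solution_map f \<phi> v (pt t) (qt t)" using cg multipliers_imp_solution[OF xr ptr(1)[OF t]] by blast
      then have xg: "x = g t" by (rule guniq[OF t xc])
      have "supported_on J x (pt t) lam" unfolding supported_on_def
      proof (intro conjI allI impI ballI)
        fix i assume "i \<notin> J"
        then show "lam $ i = 0" using tendsto_vec_nth[OF lims(2), of i] L(3) unfolding supported_on_def by (simp add:
            LIMSEQ_const_iff)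
      next
        fix i assume "i \<in> J"
        then show "\<phi> i (x, pt t) = 0" using box_tendsto(1)[OF lims(1) limp(1) xr ptr(1)[OF t], of i] L(3)
          unfolding supported_on_def by (simp add: LIMSEQ_const_iff)
      qed
      then show "t \<in> S J" using cg(2) t unfolding S_def xg by blast
    qed
    have cover: "{0..1} \<subseteq> (\<Union>J\<in>\<J>. S J)"
    proof
      fix t :: real assume t: "t \<in> {0..1}"
      obtain lam where "lam \<in> multipliers f \<phi> (g t) (pt t) (qt t) v"
        using gsol(2)[OF t] solution_map_iff[OF gr(2)[OF t] ptr(1)[OF t]] by blast
      then obtain J mu where J: "J \<subseteq> active_set \<phi> xb pb" "independent_family J (\<lambda>i. grad_x
          (\<phi> i) (g t, pt t))"
        "mu \<in> multipliers f \<phi> (g t) (pt t) (qt t) v" "supported_on J (g t) (pt t) mu"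
        by (rule independent_multiplier[OF gr(2)[OF t] ptr(1)[OF t] gf[OF t]]) (rule that)
      have "J \<in> \<J>" unfolding \<J>_def using crcq[OF J(1) gr(2)[OF t] ptr(1)[OF t] J(2)] by simp
      moreover have "t \<in> S J" unfolding S_def using t J(3,4) by blast
      ultimately show "t \<in> (\<Union>J\<in>\<J>. S J)" by blast
    qed
    have "(M * m)-lipschitz_on {0..1} g"
      by (rule lipschitz_on_closed_Union[OF lip closed finite _ cover]) (use M in \<open>auto simp: m_def\<close>)
    then have "dist (g 0) (g 1) \<le> M * m * dist (0::real) 1" by (rule lipschitz_onD) auto
    then show "norm (\<theta> p1 q1 - \<theta> p2 q2) \<le> M * (norm (p1 - p2) + norm (q1 - q2))"
      by (simp add: g_def pt_def qt_def m_def dist_norm)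
  qed
qed

text \<open>Strong monotonicity controls the change of the solution with \<open>v\<close> for fixed \<open>(p, q)\<close>, Lipschitz continuity its
  change with \<open>(p, q)\<close> for fixed \<open>v\<close>; the triangle inequality combines the two into the required estimate.\<close>

lemma fully_stable_if_GSSOSC:
  assumes G: "GSSOSC f \<phi> xb pb qb vb" and sol: "xb \<in> solution_map f \<phi> vb pb qb"
    and crcq: "\<And>J x p. \<lbrakk>J \<subseteq> active_set \<phi> xb pb; x \<in> ball xb r; p \<in> ball pb r;
        independent_family J (\<lambda>i. grad_x (\<phi> i) (x, p))\<rbrakk> \<Longrightarrow> independent_family J
            (\<lambda>i. grad_x (\<phi> i) (xb, pb))"
  shows "fully_stable (solution_map f \<phi>) xb vb pb qb"
proof -
  let ?S = "solution_map f \<phi>"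
  obtain \<kappa> \<delta>1 where \<kappa>: "0 < \<kappa>" and \<delta>1: "0 < \<delta>1" "\<delta>1 \<le> r"
    and mono: "\<And>p q x1 v1 lam1 x2 v2 lam2. \<lbrakk>local_kkt vb \<delta>1 x1 p q v1 lam1; local_kkt vb
        \<delta>1 x2 p q v2 lam2\<rbrakk>
      \<Longrightarrow> \<kappa> * (norm (x1 - x2))\<^sup>2 \<le> inner (v1 - v2) (x1 - x2)"
    by (rule strong_monotonicity[OF G]) (rule that)
  obtain M \<delta>2 where M: "0 \<le> M" and \<delta>2: "0 < \<delta>2" "\<delta>2 \<le> r"
    and lip: "\<And>\<epsilon> \<theta> v p1 q1 p2 q2. \<lbrakk>\<epsilon> < \<delta>2; v \<in> ball vb \<delta>2; p1
        \<in> ball pb \<delta>2; p2 \<in> ball pb \<delta>2; q1 \<in> ball qb \<delta>2; q2 \<in> ball qb \<delta>2;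
      \<forall>p\<in>closed_segment p1 p2. \<forall>q\<in>closed_segment q1 q2. {x \<in> cball xb \<epsilon>. x \<in>
          ?S v p q} = {\<theta> p q}\<rbrakk>
      \<Longrightarrow> norm (\<theta> p1 q1 - \<theta> p2 q2) \<le> M * (norm (p1 - p2) + norm (q1 - q2))"
    by (rule solution_lipschitz_in_parameters[OF G crcq]) (assumption+, rule that)
  define \<delta> where "\<delta> = min \<delta>1 \<delta>2"
  have \<delta>: "0 < \<delta>" "\<delta> \<le> \<delta>1" "\<delta> \<le> \<delta>2" using \<delta>1 \<delta>2 by
      (auto simp: \<delta>_def)
  define \<epsilon> where "\<epsilon> = \<delta> / 2"
  have \<epsilon>: "0 < \<epsilon>" "\<epsilon> < \<delta>" using \<delta>(1) by (auto simp: \<epsilon>_def)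
  obtain lam where lam: "lam \<in> multipliers f \<phi> xb pb qb vb"
    using sol solution_map_iff[OF base_in_box(1,2)] by blast
  obtain \<eta>0 where \<eta>0: "0 < \<eta>0"
    and ex: "\<And>v p q. \<lbrakk>v \<in> ball vb \<eta>0; p \<in> ball pb \<eta>0; q \<in> ball qb \<eta>0\<rbrakk>
        \<Longrightarrow> \<exists>x\<in>cball xb \<epsilon>. x \<in> ?S v p q"
    by (rule solution_exists_nearby[OF G lam \<epsilon>(1)]) (rule that)
  define \<eta> where "\<eta> = min \<eta>0 \<delta>"
  have \<eta>: "0 < \<eta>" "\<eta> \<le> \<eta>0" "\<eta> \<le> \<delta>" using \<eta>0 \<delta> by (auto simp: \<eta>_def)
  define V where "V = ball vb \<eta>"
  define P where "P = ball pb \<eta>"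
  define Q where "Q = ball qb \<eta>"
  define U where "U = cball xb \<epsilon>"
  have sub: "V \<subseteq> ball vb \<delta>1" "P \<subseteq> ball pb \<delta>1" "Q \<subseteq> ball qb \<delta>1" "U
      \<subseteq> ball xb \<delta>1"
    "V \<subseteq> ball vb \<delta>2" "P \<subseteq> ball pb \<delta>2" "Q \<subseteq> ball qb \<delta>2" "P
        \<subseteq> ball pb r" "U \<subseteq> ball xb r"
    "V \<subseteq> ball vb \<eta>0" "P \<subseteq> ball pb \<eta>0" "Q \<subseteq> ball qb \<eta>0"
    using \<eta> \<delta> \<epsilon> \<delta>1 \<delta>2 unfolding V_def P_def Q_def U_def by auto
  have kkt: "\<exists>lam. local_kkt vb \<delta>1 x p q v lam"
    if h: "v \<in> V" "p \<in> P" "q \<in> Q" "x \<in> U" "x \<in> ?S v p q" for v p q x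
  proof -
    have "x \<in> ball xb r" "p \<in> ball pb r" using h sub by blast+
    then obtain lam where l: "x \<in> feasible_set \<phi> p" "lam \<in> multipliers f \<phi> x p q v"
      using h(5) solution_map_iff by blast
    show ?thesis unfolding local_kkt_def using h(1-4) l sub(1-4) by (intro exI[of _ lam]) blast
  qed
  have smono: "\<kappa> * (norm (x1 - x2))\<^sup>2 \<le> inner (v1 - v2) (x1 - x2)"
    if h: "v1 \<in> V" "v2 \<in> V" "p \<in> P" "q \<in> Q" "x1 \<in> U" "x2 \<in> U" "x1 \<in> ?S v1 p q" "x2 \<in>
        ?S v2 p q" for v1 v2 p q x1 x2
  proof -
    obtain l1 where "local_kkt vb \<delta>1 x1 p q v1 l1" using kkt[OF h(1,3,4,5,7)] ..
    moreover obtain l2 where "local_kkt vb \<delta>1 x2 p q v2 l2" using kkt[OF h(2,3,4,6,8)] ..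
    ultimately show ?thesis by (rule mono)
  qed
  define \<theta> where "\<theta> v p q = (SOME x. x \<in> U \<and> x \<in> ?S v p q)" for v p q
  have \<theta>: "\<theta> v p q \<in> U" "\<theta> v p q \<in> ?S v p q" if "v \<in> V" "p \<in> P" "q \<in> Q" for v p q
  proof -
    have "\<exists>x. x \<in> U \<and> x \<in> ?S v p q" using ex[of v p q] that sub unfolding U_def by blast
    then have "\<theta> v p q \<in> U \<and> \<theta> v p q \<in> ?S v p q" unfolding \<theta>_def by (rule someI_ex)
    then show "\<theta> v p q \<in> U" "\<theta> v p q \<in> ?S v p q" by blast+
  qed
  have uniq: "x = \<theta> v p q" if vpq: "v \<in> V" "p \<in> P" "q \<in> Q" and x: "x \<in> U" "x \<in> ?S v p q" for v p q x
  proof -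
    have "\<kappa> * (norm (x - \<theta> v p q))\<^sup>2 \<le> 0"
      using smono[OF vpq(1,1,2,3) x(1) \<theta>(1)[OF vpq] x(2) \<theta>(2)[OF vpq]] by simp
    then have "(norm (x - \<theta> v p q))\<^sup>2 \<le> 0" using \<kappa> by (simp add: mult_le_0_iff)
    then show ?thesis by simp
  qed
  have single: "{x \<in> cball xb \<epsilon>. x \<in> ?S v p q} = {\<theta> v p q}" if "v \<in> V" "p \<in> P" "q
      \<in> Q" for v p q
    using \<theta>[OF that] uniq[OF that] unfolding U_def by blast
  have \<theta>lip: "norm (\<theta> v p1 q1 - \<theta> v p2 q2) \<le> M * (norm (p1 - p2) + norm (q1 - q2))"
    if v: "v \<in> V" and p: "p1 \<in> P" "p2 \<in> P" and q: "q1 \<in> Q" "q2 \<in> Q" for v p1 p2 q1 q2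
  proof (rule lip[of \<epsilon> v p1 p2 q1 q2 "\<theta> v"])
    show "\<epsilon> < \<delta>2" using \<epsilon> \<delta> by simp
    show "v \<in> ball vb \<delta>2" "p1 \<in> ball pb \<delta>2" "p2 \<in> ball pb \<delta>2" "q1 \<in> ball qb
        \<delta>2" "q2 \<in> ball qb \<delta>2"
      using v p q sub by blast+
    have "closed_segment p1 p2 \<subseteq> P" unfolding P_def by (rule closed_segment_subset) (use that in
        \<open>simp_all add: P_def\<close>)
    moreover have "closed_segment q1 q2 \<subseteq> Q" unfolding Q_def by (rule closed_segment_subset) (use that in
        \<open>simp_all add: Q_def\<close>)
    ultimately show "\<forall>p\<in>closed_segment p1 p2. \<forall>q\<in>closed_segment q1 q2. {x \<in> cball xb
        \<epsilon>. x \<in> ?S v p q} = {\<theta> v p q}"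
      using single[OF v] by (meson subsetD)
  qed
  have int: "vb \<in> interior V" "pb \<in> interior P" "qb \<in> interior Q" "xb \<in> interior U"
    using \<eta>(1) \<epsilon>(1) by (simp_all add: V_def P_def Q_def U_def interior_cball)
  have gph: "{(v, p, q, \<theta> v p q) |v p q. v \<in> V \<and> p \<in> P \<and> q \<in> Q}
      = {(v, p, q, x) |v p q x. x \<in> ?S v p q} \<inter> (V \<times> P \<times> Q \<times> U)" (is "?L = ?R")
  proof (intro subset_antisym subsetI)
    fix z assume "z \<in> ?L"
    then obtain v p q where z: "z = (v, p, q, \<theta> v p q)" and vpq: "v \<in> V" "p \<in> P" "q \<in> Q"
      by (elim CollectE exE conjE) (rule that)
    show "z \<in> ?R" unfolding z using \<theta>[OF vpq] vpq by simp
  next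
    fix z assume "z \<in> ?R"
    then obtain v p q x where z: "z = (v, p, q, x)" and x: "x \<in> ?S v p q" "v \<in> V" "p \<in> P" "q \<in> Q" "x \<in> U"
      by auto
    have "x = \<theta> v p q" by (rule uniq[OF x(2-5) x(1)])
    then show "z \<in> ?L" unfolding z using x(2-4) by simp
  qed
  have est: "norm ((v1 - v2) - (2 * \<kappa>) *\<^sub>R (\<theta> v1 p1 q1 - \<theta> v2 p2 q2))
      \<le> norm (v1 - v2) + (2 * \<kappa> * M + 1) * (norm (p1 - p2) + norm (q1 - q2))"
    if v: "v1 \<in> V" "v2 \<in> V" and p: "p1 \<in> P" "p2 \<in> P" and q: "q1 \<in> Q" "q2 \<in> Q" for v1 v2 p1 p2 q1 q2
  proof -
    let ?m = "norm (p1 - p2) + norm (q1 - q2)"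
    have "\<kappa> * (norm (\<theta> v1 p1 q1 - \<theta> v2 p1 q1))\<^sup>2 \<le> inner (v1 - v2) (\<theta> v1 p1 q1
        - \<theta> v2 p1 q1)"
      by (rule smono[OF v p(1) q(1)]) (use \<theta> v p q in blast)+
    then have 1: "norm ((v1 - v2) - (2 * \<kappa>) *\<^sub>R (\<theta> v1 p1 q1 - \<theta> v2 p1 q1)) \<le> norm (v1 - v2)"
      using norm_diff_scaled_le_iff[OF \<kappa>] by blast
    have 2: "norm ((2 * \<kappa>) *\<^sub>R (\<theta> v2 p1 q1 - \<theta> v2 p2 q2)) \<le> 2 * \<kappa> * (M * ?m)"
      using \<theta>lip[OF v(2) p q] \<kappa> by simp
    have "(v1 - v2) - (2 * \<kappa>) *\<^sub>R (\<theta> v1 p1 q1 - \<theta> v2 p2 q2)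
       = ((v1 - v2) - (2 * \<kappa>) *\<^sub>R (\<theta> v1 p1 q1 - \<theta> v2 p1 q1)) - (2 * \<kappa>) *\<^sub>R
           (\<theta> v2 p1 q1 - \<theta> v2 p2 q2)"
      by (simp add: algebra_simps)
    then have "norm ((v1 - v2) - (2 * \<kappa>) *\<^sub>R (\<theta> v1 p1 q1 - \<theta> v2 p2 q2))
       \<le> norm ((v1 - v2) - (2 * \<kappa>) *\<^sub>R (\<theta> v1 p1 q1 - \<theta> v2 p1 q1)) + norm ((2 *
           \<kappa>) *\<^sub>R (\<theta> v2 p1 q1 - \<theta> v2 p2 q2))"
      by (simp only: norm_triangle_ineq4)
    moreover have "(2 * \<kappa> * M + 1) * ?m = 2 * \<kappa> * (M * ?m) + ?m" by (simp only: distrib_right mult.assoc mult_1)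
    ultimately show ?thesis using 1 2 norm_ge_zero[of "p1 - p2"] norm_ge_zero[of "q1 - q2"] by linarith
  qed
  have l: "0 < 2 * \<kappa> * M + 1" using \<kappa> M by (auto intro: add_nonneg_pos)
  show ?thesis
    unfolding fully_stable_def
  proof (rule exI[of _ V], rule exI[of _ P], rule exI[of _ Q], rule exI[of _ U], rule exI[of _ \<theta>], intro conjI int gph)
    show "\<forall>v\<in>V. \<forall>p\<in>P. \<forall>q\<in>Q. \<theta> v p q \<in> U" using \<theta>(1) by blast
    show "\<exists>\<kappa>>0. \<exists>l>0. \<forall>v1\<in>V. \<forall>v2\<in>V. \<forall>p1\<in>P.
        \<forall>p2\<in>P. \<forall>q1\<in>Q. \<forall>q2\<in>Q.
           norm ((v1 - v2) - (2 * \<kappa>) *\<^sub>R (\<theta> v1 p1 q1 - \<theta> v2 p2 q2))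
             \<le> norm (v1 - v2) + l * (norm (p1 - p2) + norm (q1 - q2))"
      using \<kappa> l est by (intro exI[of _ \<kappa>] exI[of _ "2 * \<kappa> * M + 1"] conjI ballI) auto
  qed
qed

end

section \<open>Constraint qualifications and straightening\<close>

lemma independent_family_subset:
  assumes "finite I" "independent_family I g" "J \<subseteq> I"
  shows "independent_family J g"
  unfolding independent_family_def
proof (intro allI impI ballI)
  fix c j assume c: "(\<Sum>j\<in>J. c j *\<^sub>R g j) = 0" and j: "j \<in> J"
  define c' where "c' i = (if i \<in> J then c i else 0)" for i
  have "(\<Sum>i\<in>I. c' i *\<^sub>R g i) = (\<Sum>i\<in>J. c' i *\<^sub>R g i)"
    by (rule sum.mono_neutral_right) (use assms in \<open>auto simp: c'_def\<close>)
  also have "\<dots> = 0" using c by (simp add: c'_def)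
  finally have "\<forall>i\<in>I. c' i = 0" using assms(2) unfolding independent_family_def by blast
  then have "c' j = 0" using j assms(3) by blast
  then show "c j = 0" using j by (simp add: c'_def)
qed

lemma partial_LICQ_iff:
  "partial_LICQ \<phi> xb pb \<longleftrightarrow> independent_family (active_set \<phi> xb pb) (\<lambda>i. grad_x
      (\<phi> i) (xb, pb))"
  unfolding partial_LICQ_def by (simp add: independent_family_iff)

text \<open>The negative sum of the dual vectors is an MFCQ direction.\<close>

lemma partial_LICQ_imp_MFCQ:
  assumes "partial_LICQ \<phi> xb pb"
  shows "partial_MFCQ \<phi> xb pb"
proof -
  let ?I = "active_set \<phi> xb pb" and ?g = "\<lambda>i. grad_x (\<phi> i) (xb, pb)"
  obtain h where h: "\<And>i j. i \<in> ?I \<Longrightarrow> j \<in> ?I \<Longrightarrow> inner (?g i) (h j) = (if i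
      = j then 1 else 0)"
    by (rule independent_family_dual[OF finite assms[unfolded partial_LICQ_iff]]) (rule that)
  have "inner (?g i) (- (\<Sum>j\<in>?I. h j)) = -1" if i: "i \<in> ?I" for i
  proof -
    have "(\<Sum>j\<in>?I. inner (?g i) (h j)) = (\<Sum>j\<in>?I. if i = j then 1 else 0)"
      by (intro sum.cong refl h[OF i])
    also have "\<dots> = 1" using i by simp
    finally show ?thesis by (simp add: inner_sum_right)
  qed
  then show ?thesis unfolding partial_MFCQ_def by (intro exI[of _ "- (\<Sum>j\<in>?I. h j)"]) auto
qed

lemma box_in_neighbourhood:
  fixes a :: "'a::metric_space" and b :: "'b::metric_space"
  assumes "(a, b) \<in> interior W"
  obtains \<rho> where "0 < \<rho>" "ball a \<rho> \<times> ball b \<rho> \<subseteq> W"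
proof -
  obtain A B where AB: "open A" "open B" "(a, b) \<in> A \<times> B" "A \<times> B \<subseteq> interior W"
    using open_prod_elim[OF open_interior assms] by metis
  obtain e1 where e1: "0 < e1" "ball a e1 \<subseteq> A" using AB(1,3) by (auto elim: openE)
  obtain e2 where e2: "0 < e2" "ball b e2 \<subseteq> B" using AB(2,3) by (auto elim: openE)
  have "ball a (min e1 e2) \<times> ball b (min e1 e2) \<subseteq> A \<times> B" using e1(2) e2(2) by auto
  then have "ball a (min e1 e2) \<times> ball b (min e1 e2) \<subseteq> W" using AB(4) interior_subset by blast
  then show ?thesis using that[of "min e1 e2"] e1(1) e2(1) by simp
qed

lemma partial_CRCQ_independent:
  assumes "partial_CRCQ \<phi> xb pb"
  obtains \<rho> where "0 < \<rho>" "\<And>J x p. \<lbrakk>J \<subseteq> active_set \<phi> xb pb; x \<in> ball xb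
      \<rho>; p \<in> ball pb \<rho>;
        independent_family J (\<lambda>i. grad_x (\<phi> i) (x, p))\<rbrakk> \<Longrightarrow> independent_family J
            (\<lambda>i. grad_x (\<phi> i) (xb, pb))"
proof -
  obtain W where W: "(xb, pb) \<in> interior W"
    "\<forall>J\<subseteq>active_set \<phi> xb pb. \<exists>r. \<forall>z\<in>W. dim ((\<lambda>i. grad_x (\<phi> i) z) ` J) = r"
    using assms unfolding partial_CRCQ_def by blast
  obtain \<rho> where \<rho>: "0 < \<rho>" "ball xb \<rho> \<times> ball pb \<rho> \<subseteq> W" by (rule
      box_in_neighbourhood[OF W(1)]) (rule that)
  show ?thesis
  proof (rule that[OF \<rho>(1)])
    fix J x p assume J: "J \<subseteq> active_set \<phi> xb pb" and x: "x \<in> ball xb \<rho>" "p \<in> ball pb \<rho>"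
      and ind: "independent_family J (\<lambda>i. grad_x (\<phi> i) (x, p))"
    have "(x, p) \<in> W" "(xb, pb) \<in> W" using \<rho> x by auto
    then have "dim ((\<lambda>i. grad_x (\<phi> i) (xb, pb)) ` J) = dim ((\<lambda>i. grad_x (\<phi> i) (x, p)) ` J)"
      using W(2)[rule_format, OF J] by metis
    also have "\<dots> = card J" using ind by (simp add: independent_family_iff_rank)
    finally show "independent_family J (\<lambda>i. grad_x (\<phi> i) (xb, pb))" by (simp add: independent_family_iff_rank)
  qed
qed

context parametric_system
begin

lemma grad_close:
  assumes "0 < \<eta>"
  obtains \<rho> where "0 < \<rho>" "\<rho> \<le> r"
    "\<And>i x p. x \<in> ball xb \<rho> \<Longrightarrow> p \<in> ball pb \<rho> \<Longrightarrow> norm (grad_x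
        (\<phi> i) (x, p) - grad_x (\<phi> i) (xb, pb)) \<le> \<eta>"
proof -
  define \<rho> where "\<rho> = min r (\<eta> / (2 * (K + 1)))"
  have \<rho>: "0 < \<rho>" "\<rho> \<le> r" "\<rho> \<le> \<eta> / (2 * (K + 1))" using r_pos K_nonneg assms by
      (auto simp: \<rho>_def)
  have "\<rho> * (2 * (K + 1)) \<le> \<eta>" using \<rho>(3) K_nonneg by (simp add: pos_le_divide_eq)
  then have K\<rho>: "K * (\<rho> + \<rho>) \<le> \<eta>" using \<rho>(1) by (simp add: algebra_simps)
  show ?thesis
  proof (rule that[OF \<rho>(1,2)])
    fix i x p assume x: "x \<in> ball xb \<rho>" "p \<in> ball pb \<rho>"
    have "norm (grad_x (\<phi> i) (x, p) - grad_x (\<phi> i) (xb, pb)) \<le> K * (norm (x - xb) + norm (p - pb))"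
      using x \<rho>(2) r_pos by (intro grad_lip) auto
    also have "\<dots> \<le> K * (\<rho> + \<rho>)"
      using x K_nonneg by (intro mult_left_mono) (auto simp: dist_norm norm_minus_commute)
    finally show "norm (grad_x (\<phi> i) (x, p) - grad_x (\<phi> i) (xb, pb)) \<le> \<eta>" using K\<rho> by linarith
  qed
qed

lemma partial_MFCQ_uniform:
  assumes "partial_MFCQ \<phi> xb pb"
  obtains d \<sigma> \<rho> where "0 < \<sigma>" "0 < \<rho>"
    "\<And>i x p. \<lbrakk>i \<in> active_set \<phi> xb pb; x \<in> ball xb \<rho>; p \<in> ball pb \<rho>\<rbrakk>
        \<Longrightarrow> inner (grad_x (\<phi> i) (x, p)) d \<le> - \<sigma>"
proof -
  let ?I = "active_set \<phi> xb pb" and ?g = "\<lambda>i. grad_x (\<phi> i) (xb, pb)"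
  obtain d where d: "\<And>i. i \<in> ?I \<Longrightarrow> inner (?g i) d < 0" using assms unfolding partial_MFCQ_def by blast
  define m where "m = Min (insert 1 ((\<lambda>i. - inner (?g i) d) ` ?I))"
  have m: "0 < m" unfolding m_def using d by (subst Min_gr_iff) auto
  have md: "inner (?g i) d \<le> - m" if "i \<in> ?I" for i
  proof -
    have "m \<le> - inner (?g i) d" unfolding m_def using that by (intro Min_le) auto
    then show ?thesis by simp
  qed
  define D where "D = norm d + 1"
  have D: "0 < D" "norm d \<le> D" by (auto simp: D_def add_nonneg_pos)
  have "0 < m / (2 * D)" using m D by simp
  then obtain \<rho> where \<rho>: "0 < \<rho>" "\<rho> \<le> r" "\<And>i x p. x \<in> ball xb \<rho>
      \<Longrightarrow> p \<in> ball pb \<rho> \<Longrightarrow>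
      norm (grad_x (\<phi> i) (x, p) - ?g i) \<le> m / (2 * D)"
    by (rule grad_close) (rule that)
  show ?thesis
  proof (rule that[of "m / 2" \<rho> d])
    fix i x p assume i: "i \<in> ?I" and x: "x \<in> ball xb \<rho>" "p \<in> ball pb \<rho>"
    have "\<bar>inner (grad_x (\<phi> i) (x, p) - ?g i) d\<bar> \<le> norm (grad_x (\<phi> i) (x, p) - ?g i) * norm
        d" by (rule Cauchy_Schwarz_ineq2)
    also have "\<dots> \<le> m / (2 * D) * D" using \<rho>(3)[OF x] D m by (intro mult_mono) auto
    also have "\<dots> = m / 2" using D by simp
    finally have "inner (grad_x (\<phi> i) (x, p)) d - inner (?g i) d \<le> m / 2" unfolding inner_diff_left by linarith
    then show "inner (grad_x (\<phi> i) (x, p)) d \<le> - (m / 2)" using md[OF i] by simp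
  qed (use m \<rho>(1) in auto)
qed

lemma partial_LICQ_imp_CRCQ:
  assumes "partial_LICQ \<phi> xb pb"
  shows "partial_CRCQ \<phi> xb pb"
proof -
  let ?I = "active_set \<phi> xb pb"
  obtain \<eta> M where \<eta>: "0 < \<eta>" and "0 \<le> M" and bound: "\<And>g' c. \<forall>j\<in>?I. norm (g' j -
      grad_x (\<phi> j) (xb, pb)) \<le> \<eta>
       \<Longrightarrow> (\<Sum>j\<in>?I. \<bar>c j\<bar>) \<le> M * norm (\<Sum>j\<in>?I. c j *\<^sub>R g' j)"
    by (rule independent_family_coefficient_bound[OF finite assms[unfolded partial_LICQ_iff]]) (rule that)
  obtain \<rho> where \<rho>: "0 < \<rho>" "\<rho> \<le> r" "\<And>i x p. x \<in> ball xb \<rho> \<Longrightarrow> p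
      \<in> ball pb \<rho> \<Longrightarrow>
      norm (grad_x (\<phi> i) (x, p) - grad_x (\<phi> i) (xb, pb)) \<le> \<eta>"
    by (rule grad_close[OF \<eta>]) (rule that)
  have "dim ((\<lambda>i. grad_x (\<phi> i) (x, p)) ` J) = card J" if J: "J \<subseteq> ?I" and x: "x \<in> ball xb
      \<rho>" "p \<in> ball pb \<rho>" for J x p
  proof -
    have "independent_family ?I (\<lambda>i. grad_x (\<phi> i) (x, p))"
      unfolding independent_family_def
    proof (intro allI impI)
      fix c assume c: "(\<Sum>j\<in>?I. c j *\<^sub>R grad_x (\<phi> j) (x, p)) = 0"
      have "(\<Sum>j\<in>?I. \<bar>c j\<bar>) \<le> M * norm (\<Sum>j\<in>?I. c j *\<^sub>R grad_x (\<phi> j) (x, p))"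
        by (rule bound) (use \<rho>(3)[OF x] in blast)
      then have "(\<Sum>j\<in>?I. \<bar>c j\<bar>) \<le> 0" unfolding c by simp
      moreover have "0 \<le> (\<Sum>j\<in>?I. \<bar>c j\<bar>)" by (rule sum_nonneg) simp
      ultimately have "(\<Sum>j\<in>?I. \<bar>c j\<bar>) = 0" by simp
      then show "\<forall>j\<in>?I. c j = 0" by (subst (asm) sum_nonneg_eq_0_iff) auto
    qed
    then have "independent_family J (\<lambda>i. grad_x (\<phi> i) (x, p))" by (rule independent_family_subset[OF finite _ J])
    then show ?thesis by (simp add: independent_family_iff_rank)
  qed
  moreover have "(xb, pb) \<in> interior (ball xb \<rho> \<times> ball pb \<rho>)"
    using \<rho>(1) by (simp add: interior_open open_Times)
  ultimately show ?thesis unfolding partial_CRCQ_def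
    by (intro exI[of _ "ball xb \<rho> \<times> ball pb \<rho>"] conjI allI impI) auto
qed

text \<open>The map \<open>x + E x\<close> satisfies \<open>\<langle>\<nabla>\<phi>\<^sub>i(xb), x + E x - xb\<rangle> = \<phi>\<^sub>i(x)\<close>: it straightens all active constraints at once.
  Since \<open>E\<close> has a vanishing strict derivative at \<open>xb\<close>, the equation \<open>x + E x = xb + t w\<close> is solved by a contraction,
  and its solution is \<open>xb + t w\<close> up to \<open>o(t)\<close>.\<close>

lemma straightened_curve:
  assumes h: "\<And>i j. i \<in> active_set \<phi> xb pb \<Longrightarrow> j \<in> active_set \<phi> xb pb \<Longrightarrow>
      inner (grad_x (\<phi> i) (xb, pb)) (h j) = (if i = j then 1 else 0)"
  obtains T where "0 < T" "\<And>t. \<lbrakk>\<forall>k. 0 < t k \<and> t k \<le> T; t \<longlonglongrightarrow>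
      0\<rbrakk> \<Longrightarrow>
      \<exists>X. X \<longlonglongrightarrow> xb \<and> (\<lambda>k. (X k - xb) /\<^sub>R t k) \<longlonglongrightarrow> w \<and>
        (\<forall>k. \<forall>i\<in>active_set \<phi> xb pb. \<phi> i (X k, pb) = t k * inner (grad_x (\<phi> i) (xb, pb)) w)"
proof -
  let ?I = "active_set \<phi> xb pb" and ?g = "\<lambda>i. grad_x (\<phi> i) (xb, pb)"
  define E where "E x = (\<Sum>i\<in>?I. (\<phi> i (x, pb) - inner (?g i) (x - xb)) *\<^sub>R h i)" for x
  have E0: "E xb = 0" unfolding E_def by (rule sum.neutral) (auto simp: active_set_def)
  have gE: "inner (?g i) (E x) = \<phi> i (x, pb) - inner (?g i) (x - xb)" if i: "i \<in> ?I" for i x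
  proof -
    have "inner (?g i) (E x) = (\<Sum>j\<in>?I. if i = j then \<phi> j (x, pb) - inner (?g j) (x - xb) else 0)"
      unfolding E_def inner_sum_right inner_scaleR_right by (intro sum.cong refl) (use h[OF i] in auto)
    also have "\<dots> = \<phi> i (x, pb) - inner (?g i) (x - xb)" using i by simp
    finally show ?thesis .
  qed
  define D where "D = (\<Sum>i\<in>?I. norm (h i)) + 1"
  have D: "0 < D" by (auto simp: D_def intro!: add_nonneg_pos sum_nonneg)
  have Estrict: "\<exists>\<delta>>0. \<forall>x\<in>ball xb \<delta>. \<forall>y\<in>ball xb \<delta>. norm (E x - E
      y) \<le> e * norm (x - y)" if e: "0 < e" for e
  proof -
    have "0 < e / D" using e D by simp
    have "\<forall>i. \<exists>\<delta>>0. \<forall>x\<in>ball xb \<delta>. \<forall>y\<in>ball xb \<delta>.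
        \<bar>\<phi> i (x, pb) - \<phi> i (y, pb) - inner (?g i) (x - y)\<bar> \<le> e / D * norm (x - y)"
    proof
      fix i
      obtain K0 where "\<forall>e>0. \<exists>d>0. \<forall>x\<in>ball xb d. \<forall>y\<in>ball xb d.
          \<forall>u\<in>ball pb d. \<forall>w\<in>ball pb d.
        norm (\<phi> i (x, u) - \<phi> i (y, w) - inner (?g i) (x - y)) \<le> e * norm (x - y) + K0 * norm (u - w)"
        using phi_strict[of i] unfolding partial_strict_derivative_def by blast
      from this[rule_format, OF \<open>0 < e / D\<close>] obtain d0 where "0 < d0" and
        d0: "\<forall>x\<in>ball xb d0. \<forall>y\<in>ball xb d0. \<forall>u\<in>ball pb d0. \<forall>w\<in>ball pb d0.
        norm (\<phi> i (x, u) - \<phi> i (y, w) - inner (?g i) (x - y)) \<le> e / D * norm (x - y) + K0 * norm (u - w)" by blast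
      have "\<bar>\<phi> i (x, pb) - \<phi> i (y, pb) - inner (?g i) (x - y)\<bar> \<le> e / D * norm (x - y)"
        if "x \<in> ball xb d0" "y \<in> ball xb d0" for x y
        using d0[rule_format, OF that, of pb pb] \<open>0 < d0\<close> by simp
      then show "\<exists>\<delta>>0. \<forall>x\<in>ball xb \<delta>. \<forall>y\<in>ball xb \<delta>. \<bar>\<phi>
          i (x, pb) - \<phi> i (y, pb) - inner (?g i) (x - y)\<bar> \<le> e / D * norm (x - y)"
        using \<open>0 < d0\<close> by blast
    qed
    then obtain \<delta> where \<delta>: "\<forall>i. 0 < \<delta> i \<and> (\<forall>x\<in>ball xb (\<delta> i).
        \<forall>y\<in>ball xb (\<delta> i).
        \<bar>\<phi> i (x, pb) - \<phi> i (y, pb) - inner (?g i) (x - y)\<bar> \<le> e / D * norm (x - y))"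
      by (elim choice[THEN exE]) (rule that)
    define \<delta>0 where "\<delta>0 = Min (range \<delta>)"
    have \<delta>0: "0 < \<delta>0" "\<And>i. \<delta>0 \<le> \<delta> i" using \<delta> by (auto simp: \<delta>0_def)
    have "norm (E x - E y) \<le> e * norm (x - y)" if x: "x \<in> ball xb \<delta>0" "y \<in> ball xb \<delta>0" for x y
    proof -
      have xi: "x \<in> ball xb (\<delta> i)" "y \<in> ball xb (\<delta> i)" for i using x \<delta>0(2)[of i] by auto
      have "E x - E y = (\<Sum>i\<in>?I. (\<phi> i (x, pb) - \<phi> i (y, pb) - inner (?g i) (x - y)) *\<^sub>R h i)"
        unfolding E_def sum_subtractf[symmetric] scaleR_diff_left[symmetric]
        by (intro sum.cong refl arg_cong2[of _ _ _ _ scaleR]) (simp add: inner_diff_right)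
      also have "norm \<dots> \<le> (\<Sum>i\<in>?I. e / D * norm (x - y) * norm (h i))"
      proof (rule sum_norm_le)
        fix i
        have "\<bar>\<phi> i (x, pb) - \<phi> i (y, pb) - inner (?g i) (x - y)\<bar> \<le> e / D * norm (x - y)"
            using \<delta> xi by blast
        then show "norm ((\<phi> i (x, pb) - \<phi> i (y, pb) - inner (?g i) (x - y)) *\<^sub>R h i) \<le> e / D *
            norm (x - y) * norm (h i)"
          unfolding norm_scaleR by (rule mult_right_mono) simp
      qed
      also have "\<dots> = e / D * norm (x - y) * (\<Sum>i\<in>?I. norm (h i))" by (simp only: sum_distrib_left)
      also have "\<dots> \<le> e / D * norm (x - y) * D" using e D by (intro mult_left_mono) (auto simp: D_def)
      also have "\<dots> = e * norm (x - y)" using D by simp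
      finally show ?thesis .
    qed
    then show ?thesis using \<delta>0(1) by blast
  qed
  have "(0::real) < 1 / 2" by simp
  from Estrict[OF this] obtain \<delta> where \<delta>: "0 < \<delta>"
    "\<And>x y. x \<in> ball xb \<delta> \<Longrightarrow> y \<in> ball xb \<delta> \<Longrightarrow> norm (E x - E
        y) \<le> 1 / 2 * norm (x - y)" by blast
  define W where "W = norm w + 1"
  have W: "0 < W" "norm w \<le> W" by (auto simp: W_def add_nonneg_pos)
  define T where "T = \<delta> / (4 * W)"
  have T: "0 < T" using \<delta>(1) W by (simp add: T_def)
  have sol: "\<exists>x. norm (x - xb) \<le> 2 * t * W \<and> x + E x = xb + t *\<^sub>R w" if t: "0 < t" "t \<le> T" for t
  proof -
    have "t * (4 * W) \<le> \<delta>" using t(2) W(1) by (simp add: T_def pos_le_divide_eq)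
    then have sub: "cball xb (2 * t * W) \<subseteq> ball xb \<delta>" using \<delta>(1) by (auto simp: algebra_simps)
    \<comment> \<open>The shift \<open>t w\<close> uses half of the radius, the contraction with constant \<open>1/2\<close> the other half.\<close>
    obtain x where "x \<in> cball xb (2 * t * W)" "xb + t *\<^sub>R w - E x = x"
    proof (rule contraction_on_cball[of "1/2" "2 * t * W" xb "\<lambda>x. xb + t *\<^sub>R w - E x"])
      fix x y assume "x \<in> cball xb (2 * t * W)" "y \<in> cball xb (2 * t * W)"
      then have "norm (E x - E y) \<le> 1 / 2 * norm (x - y)" using sub by (intro \<delta>(2)) auto
      then show "norm ((xb + t *\<^sub>R w - E x) - (xb + t *\<^sub>R w - E y)) \<le> 1 / 2 * norm (x - y)"
        by (simp add: norm_minus_commute)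
    next
      show "norm (xb + t *\<^sub>R w - E xb - xb) \<le> (1 - 1 / 2) * (2 * t * W)" using t W by (simp add: E0)
    qed (use t W in auto)
    then show ?thesis by (intro exI[of _ x]) (auto simp: dist_norm norm_minus_commute algebra_simps)
  qed
  show ?thesis
  proof (rule that[OF T])
    fix t :: "nat \<Rightarrow> real" assume t: "\<forall>k. 0 < t k \<and> t k \<le> T" and lim: "t \<longlonglongrightarrow> 0"
    have "\<forall>k. \<exists>x. norm (x - xb) \<le> 2 * t k * W \<and> x + E x = xb + t k *\<^sub>R w" using sol t by blast
    then obtain X where X: "\<forall>k. norm (X k - xb) \<le> 2 * t k * W \<and> X k + E (X k) = xb + t k *\<^sub>R w"
      by (elim choice[THEN exE]) (rule that)
    have tp: "0 < t k" for k using t by blast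
    have Xlim: "X \<longlonglongrightarrow> xb"
    proof (rule LIM_zero_cancel, rule Lim_null_comparison)
      show "\<forall>\<^sub>F k in sequentially. norm (X k - xb) \<le> 2 * t k * W" using X by simp
      have "(\<lambda>k. 2 * t k * W) \<longlonglongrightarrow> 2 * 0 * W" by (intro tendsto_intros lim)
      then show "(\<lambda>k. 2 * t k * W) \<longlonglongrightarrow> 0" by simp
    qed
    have Et: "(\<lambda>k. E (X k) /\<^sub>R t k) \<longlonglongrightarrow> 0"
    proof (rule tendstoI)
      fix e :: real assume "0 < e"
      then have "0 < e / (4 * W)" using W by simp
      from Estrict[OF this] obtain \<delta>' where \<delta>': "0 < \<delta>'"
        "\<And>x y. x \<in> ball xb \<delta>' \<Longrightarrow> y \<in> ball xb \<delta>' \<Longrightarrow> norm (E x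
            - E y) \<le> e / (4 * W) * norm (x - y)" by blast
      have "\<forall>\<^sub>F k in sequentially. X k \<in> ball xb \<delta>'" using topological_tendstoD[OF Xlim
          open_ball] \<delta>'(1) by simp
      then show "\<forall>\<^sub>F k in sequentially. dist (E (X k) /\<^sub>R t k) 0 < e"
      proof eventually_elim
        case (elim k)
        have "norm (E (X k)) \<le> e / (4 * W) * norm (X k - xb)" using \<delta>'(2)[OF elim, of xb] \<delta>'(1) E0 by simp
        also have "\<dots> \<le> e / (4 * W) * (2 * t k * W)" using X \<open>0 < e\<close> W by (intro mult_left_mono) auto
        also have "\<dots> = e / 2 * t k" using W by simp
        finally have "norm (E (X k)) / t k \<le> e / 2" using tp[of k] by (simp add: pos_divide_le_eq)
        moreover have "dist (E (X k) /\<^sub>R t k) 0 = norm (E (X k)) / t k" using tp[of k] by (simp add: divide_inverse_commute)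
        ultimately show ?case using \<open>0 < e\<close> by linarith
      qed
    qed
    have "(X k - xb) /\<^sub>R t k = w - E (X k) /\<^sub>R t k" for k
    proof -
      have "X k - xb = t k *\<^sub>R w - E (X k)" using X by (simp add: algebra_simps)
      then show ?thesis using tp[of k] by (simp add: scaleR_diff_right)
    qed
    then have "(\<lambda>k. (X k - xb) /\<^sub>R t k) \<longlonglongrightarrow> w" using tendsto_diff[OF
        tendsto_const[of w] Et] by simp
    moreover have "\<phi> i (X k, pb) = t k * inner (?g i) w" if i: "i \<in> ?I" for i k
    proof -
      have "X k - xb + E (X k) = t k *\<^sub>R w" using X by (simp add: algebra_simps)
      then have "inner (?g i) (X k - xb) + inner (?g i) (E (X k)) = t k * inner (?g i) w"
        by (metis inner_add_right inner_scaleR_right)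
      then show ?thesis using gE[OF i] by simp
    qed
    ultimately show "\<exists>X. X \<longlonglongrightarrow> xb \<and> (\<lambda>k. (X k - xb) /\<^sub>R t k)
        \<longlonglongrightarrow> w \<and>
        (\<forall>k. \<forall>i\<in>?I. \<phi> i (X k, pb) = t k * inner (?g i) w)" using Xlim by blast
  qed
qed

end

section \<open>Necessity and the characterization\<close>

context parametric_system
begin

text \<open>Two straightened curves with velocities differing by \<open>u\<close> are solutions with the constant multiplier
  \<open>lam\<close>, provided both keep the constraints with positive multiplier at zero and the remaining active ones
  nonpositive. The inequality of full stability at the two curves, divided by \<open>t\<^sup>2\<close>, tends to the claim.\<close>

lemma GSSOSC_if_fully_stable:
  assumes licq: "partial_LICQ \<phi> xb pb"
    and fs: "fully_stable (solution_map f \<phi>) xb vb pb qb"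
  shows "GSSOSC f \<phi> xb pb qb vb"
  unfolding GSSOSC_iff
proof (intro ballI allI impI, elim conjE)
  fix lam u assume lam: "lam \<in> multipliers f \<phi> xb pb qb vb" and u: "u \<noteq> 0"
    and orth: "\<forall>i. 0 < lam $ i \<longrightarrow> inner (grad_x (\<phi> i) (xb, pb)) u = 0"
  let ?I = "active_set \<phi> xb pb" and ?g = "\<lambda>i. grad_x (\<phi> i) (xb, pb)"
  have lam_nonneg: "\<And>i. 0 \<le> lam $ i" and lam_compl: "\<And>i. lam $ i * \<phi> i (xb, pb) = 0"
    and vb: "vb = f (xb, pb, qb) + (\<Sum>i\<in>UNIV. lam $ i *\<^sub>R ?g i)"
    using lam base_feasible by (auto simp: multipliers_iff simp del: mult_eq_0_iff)
  have lam_off: "lam $ i = 0" if "i \<notin> ?I" for i using lam_compl[of i] that by (simp add: active_set_def)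
  obtain V P Q U \<theta> \<kappa> l where nb: "vb \<in> interior V" "pb \<in> interior P" "qb \<in> interior Q" "xb
      \<in> interior U"
    and gph: "{(v, p, q, \<theta> v p q) |v p q. v \<in> V \<and> p \<in> P \<and> q \<in> Q}
          = {(v, p, q, x) |v p q x. x \<in> solution_map f \<phi> v p q} \<inter> (V \<times> P \<times> Q \<times> U)"
    and \<kappa>: "0 < \<kappa>"
    and est: "\<forall>v1\<in>V. \<forall>v2\<in>V. \<forall>p1\<in>P. \<forall>p2\<in>P. \<forall>q1\<in>Q. \<forall>q2\<in>Q.
           norm ((v1 - v2) - (2 * \<kappa>) *\<^sub>R (\<theta> v1 p1 q1 - \<theta> v2 p2 q2))
             \<le> norm (v1 - v2) + l * (norm (p1 - p2) + norm (q1 - q2))"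
    using fs unfolding fully_stable_def by (elim exE conjE) (rule that)
  have pq: "pb \<in> P" "qb \<in> Q" using nb interior_subset by blast+
  have \<theta>: "x = \<theta> v pb qb" if "x \<in> solution_map f \<phi> v pb qb" "v \<in> V" "x \<in> U" for v x
  proof -
    have "(v, pb, qb, x) \<in> {(v, p, q, x) |v p q x. x \<in> solution_map f \<phi> v p q} \<inter> (V \<times> P
        \<times> Q \<times> U)"
      using that pq by simp
    then show ?thesis unfolding gph[symmetric] by simp
  qed
  obtain h where h: "\<And>i j. i \<in> ?I \<Longrightarrow> j \<in> ?I \<Longrightarrow> inner (?g i) (h j) = (if i
      = j then 1 else 0)"
    by (rule independent_family_dual[OF finite licq[unfolded partial_LICQ_iff]]) (rule that)
  \<comment> \<open>a direction that keeps the strongly active constraints and offsets \<open>u\<close> on the weakly active ones\<close>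
  define w2 where "w2 = - (\<Sum>j\<in>?I. (if lam $ j = 0 then \<bar>inner (?g j) u\<bar> else 0) *\<^sub>R h j)"
  define w1 where "w1 = w2 + u"
  have gw2: "inner (?g i) w2 = - (if lam $ i = 0 then \<bar>inner (?g i) u\<bar> else 0)" if i: "i \<in> ?I" for i
  proof -
    have "(\<Sum>j\<in>?I. (if lam $ j = 0 then \<bar>inner (?g j) u\<bar> else 0) * inner (?g i) (h j))
        = (\<Sum>j\<in>?I. if i = j then (if lam $ j = 0 then \<bar>inner (?g j) u\<bar> else 0) else 0)"
      by (intro sum.cong refl) (use h[OF i] in auto)
    also have "\<dots> = (if lam $ i = 0 then \<bar>inner (?g i) u\<bar> else 0)" using i by simp
    finally show ?thesis unfolding w2_def by (simp add: inner_sum_right)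
  qed
  have sgn: "inner (?g i) w \<le> 0" "lam $ i \<noteq> 0 \<Longrightarrow> inner (?g i) w = 0" if i: "i \<in> ?I" and
      w: "w = w1 \<or> w = w2" for i w
  proof -
    have "0 < lam $ i" if "lam $ i \<noteq> 0" using lam_nonneg[of i] that by simp
    then have *: "lam $ i \<noteq> 0 \<Longrightarrow> inner (?g i) u = 0" using orth by blast
    show "inner (?g i) w \<le> 0" "lam $ i \<noteq> 0 \<Longrightarrow> inner (?g i) w = 0"
      using w gw2[OF i] * by (auto simp: w1_def inner_add_right)
  qed
  obtain T1 where T1: "0 < T1" "\<And>t. \<lbrakk>\<forall>k. 0 < t k \<and> t k \<le> T1; t
      \<longlonglongrightarrow> 0\<rbrakk> \<Longrightarrow>
      \<exists>X. X \<longlonglongrightarrow> xb \<and> (\<lambda>k. (X k - xb) /\<^sub>R t k)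
          \<longlonglongrightarrow> w1 \<and> (\<forall>k. \<forall>i\<in>?I. \<phi> i (X k, pb) = t k * inner (?g i) w1)"
    by (rule straightened_curve[OF h]) (assumption, assumption, rule that)
  obtain T2 where T2: "0 < T2" "\<And>t. \<lbrakk>\<forall>k. 0 < t k \<and> t k \<le> T2; t
      \<longlonglongrightarrow> 0\<rbrakk> \<Longrightarrow>
      \<exists>X. X \<longlonglongrightarrow> xb \<and> (\<lambda>k. (X k - xb) /\<^sub>R t k)
          \<longlonglongrightarrow> w2 \<and> (\<forall>k. \<forall>i\<in>?I. \<phi> i (X k, pb) = t k * inner (?g i) w2)"
    by (rule straightened_curve[OF h]) (assumption, assumption, rule that)
  define t where "t k = min T1 T2 * inverse (real (Suc k))" for k
  have tpos: "0 < t k" for k using T1(1) T2(1) by (simp add: t_def)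
  have tle: "t k \<le> min T1 T2" for k
  proof -
    have "inverse (real (Suc k)) \<le> 1" by (simp add: inverse_le_1_iff)
    then have "min T1 T2 * inverse (real (Suc k)) \<le> min T1 T2 * 1" using T1(1) T2(1) by (intro mult_left_mono) auto
    then show ?thesis by (simp add: t_def)
  qed
  have t0: "t \<longlonglongrightarrow> 0"
    unfolding t_def[abs_def] by (rule tendsto_mult_right_zero[OF LIMSEQ_inverse_real_of_nat])
  have "t k \<le> T1" "t k \<le> T2" for k using tle[of k] by auto
  then have "\<forall>k. 0 < t k \<and> t k \<le> T1" "\<forall>k. 0 < t k \<and> t k \<le> T2" using tpos by blast+
  then obtain X1 X2 where X1: "X1 \<longlonglongrightarrow> xb" "(\<lambda>k. (X1 k - xb) /\<^sub>R t k)
      \<longlonglongrightarrow> w1" "\<forall>k. \<forall>i\<in>?I. \<phi> i (X1 k, pb) = t k * inner (?g i) w1"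
    and X2: "X2 \<longlonglongrightarrow> xb" "(\<lambda>k. (X2 k - xb) /\<^sub>R t k) \<longlonglongrightarrow> w2"
        "\<forall>k. \<forall>i\<in>?I. \<phi> i (X2 k, pb) = t k * inner (?g i) w2"
    using T1(2)[OF _ t0] T2(2)[OF _ t0] by blast
  define L where "L x = lagrangian f \<phi> lam (x, pb, qb)" for x
  have sol: "\<forall>\<^sub>F k in sequentially. L (X k) \<in> V \<and> X k \<in> U \<and> X k \<in> solution_map f
      \<phi> (L (X k)) pb qb"
    if X: "X \<longlonglongrightarrow> xb" "\<forall>k. \<forall>i\<in>?I. \<phi> i (X k, pb) = t k * inner (?g i) w"
        and w: "w = w1 \<or> w = w2" for X w
  proof -
    have "(\<lambda>k. L (X k)) \<longlonglongrightarrow> f (xb, pb, qb) + (\<Sum>i\<in>UNIV. lam $ i *\<^sub>R ?g i)"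
      unfolding L_def lagrangian_def split
      by (intro tendsto_intros box_tendsto[OF X(1) tendsto_const[of pb] base_in_box(1,2)] base_in_box(3))
    then have "(\<lambda>k. L (X k)) \<longlonglongrightarrow> vb" using vb by simp
    then have "\<forall>\<^sub>F k in sequentially. L (X k) \<in> interior V" using topological_tendstoD[OF _
        open_interior nb(1)] by blast
    moreover have "\<forall>\<^sub>F k in sequentially. X k \<in> interior U" using topological_tendstoD[OF X(1)
        open_interior nb(4)] .
    moreover have "\<forall>\<^sub>F k in sequentially. X k \<in> ball xb r" using topological_tendstoD[OF X(1)
        open_ball base_in_box(1)] .
    ultimately show ?thesis
    proof eventually_elim
      case (elim k)
      have val: "\<phi> i (X k, pb) = t k * inner (?g i) w" if "i \<in> ?I" for i using X(2) that by blast
      have "\<phi> i (X k, pb) \<le> 0" for i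
      proof (cases "i \<in> ?I")
        case True
        then show ?thesis using val[OF True] sgn(1)[OF True w] tpos[of k] by (simp add: mult_nonneg_nonpos)
      next
        case False
        then show ?thesis using inactive[OF False elim(3) base_in_box(2)] by simp
      qed
      then have feas: "X k \<in> feasible_set \<phi> pb" by (simp add: feasible_set_def)
      have compl: "lam $ i * \<phi> i (X k, pb) = 0" for i
      proof (cases "i \<in> ?I")
        case True
        then show ?thesis using val[OF True] sgn(2)[OF True w] by (cases "lam $ i = 0") auto
      next
        case False
        then show ?thesis using lam_off[OF False] by simp
      qed
      have "lam \<in> multipliers f \<phi> (X k) pb qb (L (X k))"
        unfolding multipliers_iff[OF feas] using lam_nonneg compl by (simp add: L_def lagrangian_def del: mult_eq_0_iff)
      then have "X k \<in> solution_map f \<phi> (L (X k)) pb qb"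
        by (rule multipliers_imp_solution[OF elim(3) base_in_box(2) feas])
      then show ?case using elim(1,2) interior_subset by blast
    qed
  qed
  have monotone: "\<forall>\<^sub>F k in sequentially. \<kappa> * (norm ((X1 k - X2 k) /\<^sub>R t k))\<^sup>2 \<le>
      inner (L (X1 k) - L (X2 k)) (X1 k - X2 k) / (t k)\<^sup>2"
    using sol[OF X1(1,3) disjI1[OF refl]] sol[OF X2(1,3) disjI2[OF refl]]
  proof eventually_elim
    case (elim k)
    have e: "X1 k = \<theta> (L (X1 k)) pb qb" "X2 k = \<theta> (L (X2 k)) pb qb" using \<theta> elim by blast+
    have "norm ((L (X1 k) - L (X2 k)) - (2 * \<kappa>) *\<^sub>R (\<theta> (L (X1 k)) pb qb - \<theta> (L (X2 k)) pb
        qb)) \<le> norm (L (X1 k) - L (X2 k))"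
      using est[rule_format, of "L (X1 k)" "L (X2 k)" pb pb qb qb] elim pq by simp
    then have "\<kappa> * (norm (X1 k - X2 k))\<^sup>2 \<le> inner (L (X1 k) - L (X2 k)) (X1 k - X2 k)"
      unfolding e[symmetric] norm_diff_scaled_le_iff[OF \<kappa>] .
    then have "\<kappa> * (norm (X1 k - X2 k))\<^sup>2 / (t k)\<^sup>2 \<le> inner (L (X1 k) - L (X2 k)) (X1 k - X2
        k) / (t k)\<^sup>2"
      by (rule divide_right_mono) simp
    moreover have "(norm ((X1 k - X2 k) /\<^sub>R t k))\<^sup>2 = (norm (X1 k - X2 k))\<^sup>2 / (t k)\<^sup>2"
      using tpos[of k] by (simp add: power_divide divide_inverse power_mult_distrib power_inverse mult.commute)
    ultimately show ?case by (metis times_divide_eq_right)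
  qed
  have u12: "(\<lambda>k. (X1 k - X2 k) /\<^sub>R t k) \<longlonglongrightarrow> u"
    using tendsto_diff[OF X1(2) X2(2)] by (simp add: w1_def flip: scaleR_diff_right)
  have quad: "(\<lambda>k. inner (L (X1 k) - L (X2 k)) (X1 k - X2 k) / (t k)\<^sup>2) \<longlonglongrightarrow>
      lagrangian_quadratic lam u"
  proof -
    have z: "(\<lambda>k. norm (pb - pb) / t k) \<longlonglongrightarrow> 0" "(\<lambda>k. norm (qb - qb) / t k)
        \<longlonglongrightarrow> 0" by simp_all
    have "(lam + lam) /\<^sub>R 2 = lam" by (simp add: vec_eq_iff)
    then show ?thesis
      using lagrangian_difference_tendsto[OF X1(1) X2(1) tendsto_const tendsto_const tendsto_const tendsto_const
          tpos u12 z tendsto_const[of lam] tendsto_const[of lam] L_def L_def]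
      by simp
  qed
  have "(\<lambda>k. \<kappa> * (norm ((X1 k - X2 k) /\<^sub>R t k))\<^sup>2) \<longlonglongrightarrow> \<kappa> *
      (norm u)\<^sup>2"
    by (intro tendsto_intros u12)
  then have "\<kappa> * (norm u)\<^sup>2 \<le> lagrangian_quadratic lam u"
    by (rule tendsto_le[OF sequentially_bot quad _ monotone])
  moreover have "0 < \<kappa> * (norm u)\<^sup>2" using \<kappa> u by simp
  ultimately show "0 < lagrangian_quadratic lam u" by linarith
qed

end

theorem corollary9p5:
  fixes f :: "(real^'n) \<times> (real^'l) \<times> (real^'m) \<Rightarrow> real^'n"
    and \<phi> :: "'s::finite \<Rightarrow> (real^'n) \<times> (real^'l) \<Rightarrow> real"
    and xb vb :: "real^'n" and pb :: "real^'l" and qb :: "real^'m"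
  assumes sol: "xb \<in> solution_map f \<phi> vb pb qb"
    and smooth: "\<And>i. C2_around (\<phi> i) (xb, pb)"
    and A1: "lipschitz_around f (xb, pb, qb)"
    and A4_diff: "uniformly_differentiable_x f xb pb qb"
    and A4_cont: "isCont (jac_x f) (xb, pb, qb)"
  shows "(partial_MFCQ \<phi> xb pb \<and> partial_CRCQ \<phi> xb pb \<and> GSSOSC f \<phi> xb pb qb vb
            \<longrightarrow> fully_stable (solution_map f \<phi>) xb vb pb qb)
       \<and> (partial_LICQ \<phi> xb pb
            \<longrightarrow> (GSSOSC f \<phi> xb pb qb vb \<longleftrightarrow> fully_stable (solution_map f \<phi>) xb vb pb qb))"
proof -
  have feas: "xb \<in> feasible_set \<phi> pb"
    using sol unfolding solution_map_def limiting_normal_cone_def by (auto split: if_splits)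
  have f: "partial_strict_derivative f (\<lambda>h. jac_x f (xb, pb, qb) *v h) xb (pb, qb)"
    by (rule jac_x_imp_partial_strict_derivative[OF A1 A4_diff A4_cont])
  have "\<forall>i. \<exists>H. partial_strict_derivative (grad_x (\<phi> i)) H xb pb"
    using C2_around_imp_partial_strict_derivatives[OF smooth] by blast
  then obtain H where "\<forall>i. partial_strict_derivative (grad_x (\<phi> i)) (H i) xb pb"
    by (elim choice[THEN exE]) (rule that)
  then have grad: "\<And>i. partial_strict_derivative (grad_x (\<phi> i)) (H i) xb pb" ..
  have phi: "partial_strict_derivative (\<phi> i) (\<lambda>h. inner (grad_x (\<phi> i) (xb, pb)) h) xb pb" for i
    by (rule C2_around_imp_partial_strict_derivatives[OF smooth[of i]])
  have der: "\<exists>r>0. \<forall>x\<in>ball xb r. \<forall>p\<in>ball pb r.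
        ((\<lambda>y. \<phi> i (y, p)) has_derivative (\<lambda>h. inner (grad_x (\<phi> i) (x, p)) h)) (at x)" for i
    by (rule C2_around_imp_partial_strict_derivatives[OF smooth[of i]]) blast
  note exists = parametric_system_exists[OF f phi grad der feas]
  obtain r0 K0 where sys0: "parametric_system f \<phi> xb pb qb (\<lambda>h. jac_x f (xb, pb, qb) *v h) H r0 K0"
    by (rule exists[OF zero_less_one])
  have sufficient: "fully_stable (solution_map f \<phi>) xb vb pb qb"
    if mfcq: "partial_MFCQ \<phi> xb pb" and crcq: "partial_CRCQ \<phi> xb pb" and G: "GSSOSC f \<phi> xb pb qb vb"
  proof -
    obtain d \<sigma> \<rho>1 where \<sigma>: "0 < \<sigma>" and \<rho>1: "0 < \<rho>1"
      and d: "\<And>i x p. \<lbrakk>i \<in> active_set \<phi> xb pb; x \<in> ball xb \<rho>1; p \<in> ball pb \<rho>1\<rbrakk> \<Longrightarrow> inner (grad_x (\<phi> i) (x, p)) d \<le> - \<sigma>"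
      by (rule parametric_system.partial_MFCQ_uniform[OF sys0 mfcq]) (rule that)
    obtain \<rho>2 where \<rho>2: "0 < \<rho>2" and c: "\<And>J x p. \<lbrakk>J \<subseteq> active_set \<phi> xb pb; x \<in> ball xb \<rho>2; p \<in> ball pb \<rho>2;
        independent_family J (\<lambda>i. grad_x (\<phi> i) (x, p))\<rbrakk> \<Longrightarrow> independent_family J (\<lambda>i. grad_x (\<phi> i) (xb, pb))"
      by (rule partial_CRCQ_independent[OF crcq]) (rule that)
    have "0 < min \<rho>1 \<rho>2" using \<rho>1 \<rho>2 by simp
    then obtain r K where r: "r \<le> min \<rho>1 \<rho>2"
      and sys: "parametric_system f \<phi> xb pb qb (\<lambda>h. jac_x f (xb, pb, qb) *v h) H r K"
      by (rule exists) (rule that)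
    have sub: "ball z r \<subseteq> ball z \<rho>1" "ball z r \<subseteq> ball z \<rho>2" for z :: "'z::metric_space" using r by auto
    interpret parametric_mfcq_system f \<phi> xb pb qb "\<lambda>h. jac_x f (xb, pb, qb) *v h" H r K d \<sigma>
      by (intro parametric_mfcq_system.intro parametric_mfcq_system_axioms.intro sys \<sigma> d)
        (use r in auto)
    show ?thesis
    proof (rule fully_stable_if_GSSOSC[OF G sol])
      fix J x p assume "J \<subseteq> active_set \<phi> xb pb" "x \<in> ball xb r" "p \<in> ball pb r"
        "independent_family J (\<lambda>i. grad_x (\<phi> i) (x, p))"
      then show "independent_family J (\<lambda>i. grad_x (\<phi> i) (xb, pb))"
        by (intro c[OF _ subsetD[OF sub(2)] subsetD[OF sub(2)]])
    qed
  qed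
  have necessary: "GSSOSC f \<phi> xb pb qb vb" if "partial_LICQ \<phi> xb pb" "fully_stable (solution_map f \<phi>) xb vb pb qb"
    by (rule parametric_system.GSSOSC_if_fully_stable[OF sys0 that])
  have licq: "partial_MFCQ \<phi> xb pb \<and> partial_CRCQ \<phi> xb pb" if "partial_LICQ \<phi> xb pb"
    using partial_LICQ_imp_MFCQ[OF that] parametric_system.partial_LICQ_imp_CRCQ[OF sys0 that] by simp
  show ?thesis using sufficient necessary licq by blast
qed

end
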